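(* Let $\mathbb{K}$ be a field, let $G$ be a group acting on a nonempty set $E$, let $D=G\times E$ be the associated generalized digroup, and let $Q,W\in\mathsf{Rep}(D)$. Let $\mathcal{F}=\operatorname{Hom}_{B_E}(Q,-):\mathsf{Rep}(D)\to\mathbb{K}G\text{-}\mathsf{Mod}$, with right derived functors $R^q\mathcal{F}$. Then for every $q\ge 0$, $$R^q\mathcal{F}(W)\cong\operatorname{Ext}^q_{B_E}(Q,W)$$ as left $G$-modules. Consequently, if $G$ is finite and $\operatorname{char}(\mathbb{K})=0$, the first-quadrant spectral sequence $E_2^{p,q}\cong H^p(G,R^q\mathcal{F}(W))\Longrightarrow\operatorname{Ext}^{p+q}_{\mathsf{Rep}(D)}(Q,W)$ (the Grothendieck spectral sequence of the composite of $\mathcal{F}$ with the invariants functor $(-)^G$) takes the form $$E_2^{p,q}\cong H^p\bigl(G,\operatorname{Ext}^q_{B_E}(Q,W)\bigr)\Longrightarrow\operatorname{Ext}^{p+q}_{\mathsf{Rep}(D)}(Q,W).$$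
   Context: Let $G$ be a group with identity $1$ acting on the left on a nonempty set $E$, $(g,\alpha)\mapsto g\bullet\alpha$. The associated generalized digroup is $D=G\times E$ with operations $(g,\alpha)\vdash(h,\beta)=(gh,g\bullet\beta)$, $(g,\alpha)\dashv(h,\beta)=(gh,\alpha)$ and halo $\overline{E}=\{(1,\alpha)\mid\alpha\in E\}$. (Every generalized digroup is isomorphic to one of this form.) A representation of $D$ over $\mathbb{K}$ is a triple $(V,\lambda,\rho)$ where $V$ is a $\mathbb{K}$-vector space and $\lambda:D\to\operatorname{End}(V)$, $\rho:D\to\operatorname{Aut}(V)$ are maps such that for all $x,y\in D$ and $e\in\overline{E}$: $\lambda_{x\dashv y}=\lambda_x\lambda_y$, $\rho_{x\vdash y}=\rho_x\rho_y$, $\rho_e=\mathrm{id}_V$, $\rho_x\lambda_y=\lambda_{x\vdash y}$, $\lambda_x\rho_y=\lambda_{x\dashv y}$. A morphism of representations is a $\mathbb{K}$-linear map commuting with all $\lambda_x$ and $\rho_x$. These form the category $\mathsf{Rep}(D)$, which is abelian with enough injectives. For any representation, $\rho_{(g,\alpha)}$ depends only on $g$, is written $\rho_g$, and $g\mapsto\rho_g$ is a representation of $G$. The halo algebra $B_E$ is the unital associative $\mathbb{K}$-algebra generated by symbols $\varepsilon_\alpha$ ($\alpha\in E$) subject to $\varepsilon_\alpha\varepsilon_\beta=\varepsilon_\alpha$ for all $\alpha,\beta\in E$. Every representation $(V,\lambda,\rho)$ is a left $B_E$-module via $\varepsilon_\alpha\cdot v=\lambda_{(1,\alpha)}(v)$.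 The group $G$ acts on $\operatorname{Hom}_{B_E}(Q,W)$ by $(g\cdot f)(q)=\rho_g^W(f((\rho_g^Q)^{-1}(q)))$; this makes $\mathcal{F}=\operatorname{Hom}_{B_E}(Q,-)$ a left exact functor $\mathsf{Rep}(D)\to\mathbb{K}G\text{-}\mathsf{Mod}$, and $\operatorname{Hom}_{\mathsf{Rep}(D)}(Q,W)=\operatorname{Hom}_{B_E}(Q,W)^G$. The $G$-module structure on $\operatorname{Ext}^q_{B_E}(Q,W)$ is the one induced by this action on the complex $\operatorname{Hom}_{B_E}(Q,I^\bullet)$, where $W\to I^\bullet$ is an injective resolution in $\mathsf{Rep}(D)$, whose underlying complex of $B_E$-modules is an injective resolution of $W$ in $B_E\text{-}\mathsf{Mod}$. *)

theory Defs
  imports "HOL-Algebra.Module" "HOL-Algebra.QuotRing" "HOL-Algebra.Group_Action"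
begin

section \<open>Vector spaces with operators\<close>

text \<open>
  Representations of a digroup, modules over the halo algebra and \<open>G\<close>-modules are all \<open>K\<close>-vector
  spaces (HOL-Algebra modules over a field \<open>K\<close>) with operators indexed by a set, and the morphisms
  are in each case the linear maps that commute with the operators.  The three categories
  differ in the index set and in the axioms for objects.  The components \<open>mult\<close> and
  \<open>one\<close> that HOL-Algebra module records inherit from ring records carry no meaning.
\<close>

record ('k, 'v, 's) opmod = "('k, 'v) module" +
  act :: "'s \<Rightarrow> 'v \<Rightarrow> 'v"

definition with_act ::
  "('k, 'v, 'x) module_scheme \<Rightarrow> ('s \<Rightarrow> 'v \<Rightarrow> 'v) \<Rightarrow> ('k, 'v, 's) opmod" where
  "with_act M a = \<lparr>carrier = carrier M, monoid.mult = monoid.mult M, one = one M, zero = zero M,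
     add = add M, smult = smult M, act = a\<rparr>"

definition linear_maps ::
  "('k, 'm) ring_scheme \<Rightarrow> ('k, 'a, 'x) module_scheme \<Rightarrow> ('k, 'b, 'y) module_scheme
    \<Rightarrow> ('a \<Rightarrow> 'b) set" where
  "linear_maps K M N = {f \<in> carrier M \<rightarrow> carrier N.
     (\<forall>x \<in> carrier M. \<forall>y \<in> carrier M. f (x \<oplus>\<^bsub>M\<^esub> y) = f x \<oplus>\<^bsub>N\<^esub> f y) \<and>
     (\<forall>k \<in> carrier K. \<forall>x \<in> carrier M. f (k \<odot>\<^bsub>M\<^esub> x) = k \<odot>\<^bsub>N\<^esub> f x)}"

definition op_hom ::
  "('k, 'm) ring_scheme \<Rightarrow> 's set \<Rightarrow> ('k, 'a, 's) opmod \<Rightarrow> ('k, 'b, 's) opmod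
    \<Rightarrow> ('a \<Rightarrow> 'b) set" where
  "op_hom K S M N = {f \<in> linear_maps K M N.
     \<forall>s \<in> S. \<forall>x \<in> carrier M. f (act M s x) = act N s (f x)}"

definition module_iso ::
  "('k, 'm) ring_scheme \<Rightarrow> ('k, 'a, 'x) module_scheme \<Rightarrow> ('k, 'b, 'y) module_scheme \<Rightarrow> bool" where
  "module_iso K M N \<longleftrightarrow> (\<exists>f \<in> linear_maps K M N. bij_betw f (carrier M) (carrier N))"

definition opmod_iso ::
  "('k, 'm) ring_scheme \<Rightarrow> 's set \<Rightarrow> ('k, 'a, 's) opmod \<Rightarrow> ('k, 'b, 's) opmod \<Rightarrow> bool" where
  "opmod_iso K S M N \<longleftrightarrow> (\<exists>f \<in> op_hom K S M N. bij_betw f (carrier M) (carrier N))"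

text \<open>Members of the Hom space are made extensional so that equality of maps is equality on
  the domain.\<close>

definition hom_space ::
  "('k, 'm) ring_scheme \<Rightarrow> 's set \<Rightarrow> ('k, 'a, 's) opmod \<Rightarrow> ('k, 'b, 's) opmod
    \<Rightarrow> ('k, 'a \<Rightarrow> 'b) module" where
  "hom_space K S M N =
    \<lparr>carrier = op_hom K S M N \<inter> extensional (carrier M),
     monoid.mult = undefined, one = undefined,
     zero = (\<lambda>x \<in> carrier M. \<zero>\<^bsub>N\<^esub>),
     add = (\<lambda>f g. \<lambda>x \<in> carrier M. f x \<oplus>\<^bsub>N\<^esub> g x),
     smult = (\<lambda>k f. \<lambda>x \<in> carrier M. k \<odot>\<^bsub>N\<^esub> f x)\<rparr>"

text \<open>The map on cosets of a submodule \<open>B\<close> of \<open>M\<close> induced by \<open>f\<close>, and the quotient \<open>Z / B\<close> of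
  submodules \<open>B \<subseteq> Z\<close> of \<open>M\<close>.\<close>

definition coset_map ::
  "('k, 'b, 'y) module_scheme \<Rightarrow> 'b set \<Rightarrow> ('a \<Rightarrow> 'b) \<Rightarrow> 'a set \<Rightarrow> 'b set" where
  "coset_map M B f X = (\<Union>x \<in> X. B +>\<^bsub>M\<^esub> f x)"

definition subquotient ::
  "('k, 'v, 'x) module_scheme \<Rightarrow> 'v set \<Rightarrow> 'v set \<Rightarrow> ('k, 'v set) module" where
  "subquotient M Z B =
    \<lparr>carrier = {B +>\<^bsub>M\<^esub> z | z. z \<in> Z},
     monoid.mult = undefined, one = undefined,
     zero = B, add = set_add M,
     smult = (\<lambda>k. coset_map M B (\<lambda>x. k \<odot>\<^bsub>M\<^esub> x))\<rparr>"


section \<open>Cohomology, injective objects and resolutions\<close>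

definition cocycles ::
  "(nat \<Rightarrow> ('k, 'v, 'x) module_scheme) \<Rightarrow> (nat \<Rightarrow> 'v \<Rightarrow> 'v) \<Rightarrow> nat \<Rightarrow> 'v set" where
  "cocycles A \<delta> q = {x \<in> carrier (A q). \<delta> q x = \<zero>\<^bsub>A (Suc q)\<^esub>}"

definition coboundaries ::
  "(nat \<Rightarrow> ('k, 'v, 'x) module_scheme) \<Rightarrow> (nat \<Rightarrow> 'v \<Rightarrow> 'v) \<Rightarrow> nat \<Rightarrow> 'v set" where
  "coboundaries A \<delta> q = (case q of 0 \<Rightarrow> {\<zero>\<^bsub>A 0\<^esub>} | Suc p \<Rightarrow> \<delta> p ` carrier (A p))"

definition cohomology ::
  "(nat \<Rightarrow> ('k, 'v, 'x) module_scheme) \<Rightarrow> (nat \<Rightarrow> 'v \<Rightarrow> 'v) \<Rightarrow> nat \<Rightarrow> ('k, 'v set) module" where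
  "cohomology A \<delta> q = subquotient (A q) (cocycles A \<delta> q) (coboundaries A \<delta> q)"

definition cohomology_map ::
  "(nat \<Rightarrow> ('k, 'b, 'y) module_scheme) \<Rightarrow> (nat \<Rightarrow> 'b \<Rightarrow> 'b) \<Rightarrow> nat \<Rightarrow> ('a \<Rightarrow> 'b)
    \<Rightarrow> 'a set \<Rightarrow> 'b set" where
  "cohomology_map A \<delta> q f = coset_map (A q) (coboundaries A \<delta> q) f"

definition op_cohomology ::
  "(nat \<Rightarrow> ('k, 'v, 's) opmod) \<Rightarrow> (nat \<Rightarrow> 'v \<Rightarrow> 'v) \<Rightarrow> nat \<Rightarrow> ('k, 'v set, 's) opmod" where
  "op_cohomology A \<delta> q =
     with_act (cohomology A \<delta> q) (\<lambda>s. cohomology_map A \<delta> q (act (A q) s))"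

text \<open>
  \<open>Obj\<close> is the class of objects of the category, restricted to those with carrier in the type
  \<open>'v\<close>.  The monomorphisms are the injective morphisms.  An object is tested for injectivity against
  all monomorphisms between objects with carrier in \<open>'v\<close>; by Baer's criterion this is
  injectivity without any bound on the size of the test objects as soon as the algebra whose
  modules are considered (generated by \<open>K\<close>, \<open>G\<close> and \<open>E\<close>) embeds as a set into \<open>'v\<close>.
\<close>

definition injective_object ::
  "('k, 'm) ring_scheme \<Rightarrow> 's set \<Rightarrow> (('k, 'v, 's) opmod \<Rightarrow> bool) \<Rightarrow> ('k, 'v, 's) opmod
    \<Rightarrow> bool" where
  "injective_object K S Obj I \<longleftrightarrow> Obj I \<and>
     (\<forall>A B i f. Obj A \<and> Obj B \<and> i \<in> op_hom K S A B \<and> inj_on i (carrier A) \<and> f \<in> op_hom K S A I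
        \<longrightarrow> (\<exists>h \<in> op_hom K S B I. \<forall>a \<in> carrier A. h (i a) = f a))"

text \<open>\<open>0 \<rightarrow> M \<rightarrow> I 0 \<rightarrow> I 1 \<rightarrow> \<dots>\<close> is exact with all \<open>I n\<close> injective.\<close>

definition injective_resolution ::
  "('k, 'm) ring_scheme \<Rightarrow> 's set \<Rightarrow> (('k, 'v, 's) opmod \<Rightarrow> bool) \<Rightarrow> ('k, 'a, 's) opmod
    \<Rightarrow> ('a \<Rightarrow> 'v) \<Rightarrow> (nat \<Rightarrow> ('k, 'v, 's) opmod) \<Rightarrow> (nat \<Rightarrow> 'v \<Rightarrow> 'v) \<Rightarrow> bool" where
  "injective_resolution K S Obj M \<eta> I d \<longleftrightarrow>
     (\<forall>n. injective_object K S Obj (I n)) \<and>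
     \<eta> \<in> op_hom K S M (I 0) \<and> inj_on \<eta> (carrier M) \<and>
     (\<forall>n. d n \<in> op_hom K S (I n) (I (Suc n))) \<and>
     cocycles I d 0 = \<eta> ` carrier M \<and>
     (\<forall>n. cocycles I d (Suc n) = coboundaries I d (Suc n))"


section \<open>Group modules and invariants\<close>

definition is_gmod ::
  "('k, 'm) ring_scheme \<Rightarrow> ('g, 'n) monoid_scheme \<Rightarrow> ('k, 'v, 'g) opmod \<Rightarrow> bool" where
  "is_gmod K G M \<longleftrightarrow> module K M \<and>
     (\<forall>g \<in> carrier G. act M g \<in> linear_maps K M M) \<and>
     (\<forall>x \<in> carrier M. act M \<one>\<^bsub>G\<^esub> x = x) \<and>
     (\<forall>g \<in> carrier G. \<forall>h \<in> carrier G. \<forall>x \<in> carrier M.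
        act M (g \<otimes>\<^bsub>G\<^esub> h) x = act M g (act M h x))"

abbreviation gmod_injective_resolution where
  "gmod_injective_resolution K G \<equiv> injective_resolution K (carrier G) (is_gmod K G)"

definition invariants ::
  "('g, 'n) monoid_scheme \<Rightarrow> ('k, 'v, 'g) opmod \<Rightarrow> ('k, 'v, 'g) opmod" where
  "invariants G M = M\<lparr>carrier := {x \<in> carrier M. \<forall>g \<in> carrier G. act M g x = x}\<rparr>"

text \<open>Group cohomology \<open>H\<^sup>p(G, M)\<close> is the \<open>p\<close>-th right derived functor of the invariants
  functor, computed from an injective resolution \<open>(N, dN)\<close> of \<open>M\<close> in the category of \<open>KG\<close>-modules.\<close>

definition group_cohomology ::
  "('g, 'n) monoid_scheme \<Rightarrow> (nat \<Rightarrow> ('k, 'v, 'g) opmod) \<Rightarrow> (nat \<Rightarrow> 'v \<Rightarrow> 'v) \<Rightarrow> nat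
    \<Rightarrow> ('k, 'v set) module" where
  "group_cohomology G N dN p = cohomology (\<lambda>n. invariants G (N n)) dN p"


section \<open>Generalized digroups and their representations\<close>

definition dig :: "('g, 'n) monoid_scheme \<Rightarrow> 'e set \<Rightarrow> ('g \<times> 'e) set" where
  "dig G E = carrier G \<times> E"

definition dig_vdash ::
  "('g, 'n) monoid_scheme \<Rightarrow> ('g \<Rightarrow> 'e \<Rightarrow> 'e) \<Rightarrow> 'g \<times> 'e \<Rightarrow> 'g \<times> 'e \<Rightarrow> 'g \<times> 'e" where
  "dig_vdash G \<phi> x y = (fst x \<otimes>\<^bsub>G\<^esub> fst y, \<phi> (fst x) (snd y))"

definition dig_dashv ::
  "('g, 'n) monoid_scheme \<Rightarrow> 'g \<times> 'e \<Rightarrow> 'g \<times> 'e \<Rightarrow> 'g \<times> 'e" where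
  "dig_dashv G x y = (fst x \<otimes>\<^bsub>G\<^esub> fst y, snd x)"

definition dig_halo :: "('g, 'n) monoid_scheme \<Rightarrow> 'e set \<Rightarrow> ('g \<times> 'e) set" where
  "dig_halo G E = {(\<one>\<^bsub>G\<^esub>, \<alpha>) | \<alpha>. \<alpha> \<in> E}"

text \<open>A representation carries two families of operators indexed by the digroup; they are
  stored as one family indexed by the disjoint union of two copies of the digroup.\<close>

type_synonym ('k, 'g, 'e, 'v) dig_rep = "('k, 'v, ('g \<times> 'e) + ('g \<times> 'e)) opmod"

definition lam :: "('k, 'g, 'e, 'v) dig_rep \<Rightarrow> 'g \<times> 'e \<Rightarrow> 'v \<Rightarrow> 'v" where
  "lam V x = act V (Inl x)"

definition rho :: "('k, 'g, 'e, 'v) dig_rep \<Rightarrow> 'g \<times> 'e \<Rightarrow> 'v \<Rightarrow> 'v" where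
  "rho V x = act V (Inr x)"

definition is_rep ::
  "('k, 'm) ring_scheme \<Rightarrow> ('g, 'n) monoid_scheme \<Rightarrow> 'e set \<Rightarrow> ('g \<Rightarrow> 'e \<Rightarrow> 'e)
    \<Rightarrow> ('k, 'g, 'e, 'v) dig_rep \<Rightarrow> bool" where
  "is_rep K G E \<phi> V \<longleftrightarrow> module K V \<and>
     (\<forall>x \<in> dig G E. lam V x \<in> linear_maps K V V) \<and>
     (\<forall>x \<in> dig G E. rho V x \<in> linear_maps K V V \<and> bij_betw (rho V x) (carrier V) (carrier V)) \<and>
     (\<forall>x \<in> dig G E. \<forall>y \<in> dig G E. \<forall>v \<in> carrier V.
        lam V (dig_dashv G x y) v = lam V x (lam V y v) \<and>
        rho V (dig_vdash G \<phi> x y) v = rho V x (rho V y v) \<and>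
        rho V x (lam V y v) = lam V (dig_vdash G \<phi> x y) v \<and>
        lam V x (rho V y v) = lam V (dig_dashv G x y) v) \<and>
     (\<forall>e \<in> dig_halo G E. \<forall>v \<in> carrier V. rho V e v = v)"

definition rep_ops :: "('g, 'n) monoid_scheme \<Rightarrow> 'e set \<Rightarrow> (('g \<times> 'e) + ('g \<times> 'e)) set" where
  "rep_ops G E = Inl ` dig G E \<union> Inr ` dig G E"

abbreviation rep_injective_resolution where
  "rep_injective_resolution K G E \<phi> \<equiv> injective_resolution K (rep_ops G E) (is_rep K G E \<phi>)"

text \<open>\<open>\<rho>\<^bsub>(g, \<alpha>)\<^esub>\<close> does not depend on \<open>\<alpha>\<close>.\<close>

definition rho_grp :: "'e set \<Rightarrow> ('k, 'g, 'e, 'v) dig_rep \<Rightarrow> 'g \<Rightarrow> 'v \<Rightarrow> 'v" where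
  "rho_grp E V g = rho V (g, SOME \<alpha>. \<alpha> \<in> E)"


section \<open>The halo algebra and its modules\<close>

text \<open>The free unital associative algebra on \<open>E\<close>: finitely supported functions on words over
  \<open>E\<close>, with the convolution product.\<close>

definition free_algebra :: "('k, 'm) ring_scheme \<Rightarrow> 'e set \<Rightarrow> ('e list \<Rightarrow> 'k) ring" where
  "free_algebra K E =
    \<lparr>carrier = {f. (\<forall>w. f w \<in> carrier K) \<and> (\<forall>w. w \<notin> lists E \<longrightarrow> f w = \<zero>\<^bsub>K\<^esub>) \<and>
                   finite {w. f w \<noteq> \<zero>\<^bsub>K\<^esub>}},
     monoid.mult = (\<lambda>f g w. \<Oplus>\<^bsub>K\<^esub>i \<in> {..length w}. f (take i w) \<otimes>\<^bsub>K\<^esub> g (drop i w)),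
     one = (\<lambda>w. if w = [] then \<one>\<^bsub>K\<^esub> else \<zero>\<^bsub>K\<^esub>),
     zero = (\<lambda>w. \<zero>\<^bsub>K\<^esub>),
     add = (\<lambda>f g w. f w \<oplus>\<^bsub>K\<^esub> g w)\<rparr>"

definition free_gen :: "('k, 'm) ring_scheme \<Rightarrow> 'e \<Rightarrow> 'e list \<Rightarrow> 'k" where
  "free_gen K \<alpha> = (\<lambda>w. if w = [\<alpha>] then \<one>\<^bsub>K\<^esub> else \<zero>\<^bsub>K\<^esub>)"

definition halo_ideal :: "('k, 'm) ring_scheme \<Rightarrow> 'e set \<Rightarrow> ('e list \<Rightarrow> 'k) set" where
  "halo_ideal K E = Idl\<^bsub>free_algebra K E\<^esub>
     {(free_gen K \<alpha> \<otimes>\<^bsub>free_algebra K E\<^esub> free_gen K \<beta>) \<ominus>\<^bsub>free_algebra K E\<^esub> free_gen K \<alpha>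
       | \<alpha> \<beta>. \<alpha> \<in> E \<and> \<beta> \<in> E}"

definition halo_algebra :: "('k, 'm) ring_scheme \<Rightarrow> 'e set \<Rightarrow> ('e list \<Rightarrow> 'k) set ring" where
  "halo_algebra K E = free_algebra K E Quot halo_ideal K E"

definition halo_scalar :: "('k, 'm) ring_scheme \<Rightarrow> 'e set \<Rightarrow> 'k \<Rightarrow> ('e list \<Rightarrow> 'k) set" where
  "halo_scalar K E k =
     halo_ideal K E +>\<^bsub>free_algebra K E\<^esub> (\<lambda>w. if w = [] then k else \<zero>\<^bsub>K\<^esub>)"

text \<open>HOL-Algebra modules are modules over commutative rings only, so left modules over the
  halo algebra are described as vector spaces with a compatible action of the algebra.\<close>

definition is_halo_module ::
  "('k, 'm) ring_scheme \<Rightarrow> 'e set \<Rightarrow> ('k, 'v, ('e list \<Rightarrow> 'k) set) opmod \<Rightarrow> bool" where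
  "is_halo_module K E M \<longleftrightarrow> module K M \<and>
     (\<forall>b \<in> carrier (halo_algebra K E). act M b \<in> linear_maps K M M) \<and>
     (\<forall>b \<in> carrier (halo_algebra K E). \<forall>c \<in> carrier (halo_algebra K E). \<forall>x \<in> carrier M.
        act M (b \<oplus>\<^bsub>halo_algebra K E\<^esub> c) x = act M b x \<oplus>\<^bsub>M\<^esub> act M c x \<and>
        act M (b \<otimes>\<^bsub>halo_algebra K E\<^esub> c) x = act M b (act M c x)) \<and>
     (\<forall>x \<in> carrier M. act M \<one>\<^bsub>halo_algebra K E\<^esub> x = x) \<and>
     (\<forall>k \<in> carrier K. \<forall>x \<in> carrier M. act M (halo_scalar K E k) x = k \<odot>\<^bsub>M\<^esub> x)"

abbreviation halo_injective_resolution where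
  "halo_injective_resolution K E \<equiv>
     injective_resolution K (carrier (halo_algebra K E)) (is_halo_module K E)"

text \<open>The left module over the halo algebra underlying a representation: the generator
  indexed by \<open>\<alpha>\<close> acts as \<open>\<lambda>\<^bsub>(1, \<alpha>)\<^esub>\<close>, hence the class of \<open>f\<close> acts as the sum of
  \<open>f w\<close> times the composite of the operators along the word \<open>w\<close>.  The result does not depend on the
  representative \<open>f\<close> of the class.\<close>

definition halo_restrict ::
  "('k, 'm) ring_scheme \<Rightarrow> ('g, 'n) monoid_scheme \<Rightarrow> ('k, 'g, 'e, 'v) dig_rep
    \<Rightarrow> ('k, 'v, ('e list \<Rightarrow> 'k) set) opmod" where
  "halo_restrict K G V = with_act V (\<lambda>b v. let f = (SOME f. f \<in> b) in
     (\<Oplus>\<^bsub>V\<^esub>w \<in> {w. f w \<noteq> \<zero>\<^bsub>K\<^esub>}. f w \<odot>\<^bsub>V\<^esub> foldr (\<lambda>\<alpha>. lam V (\<one>\<^bsub>G\<^esub>, \<alpha>)) w v))"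


section \<open>The functor to group modules, and the Ext spaces\<close>

abbreviation halo_hom where
  "halo_hom K E \<equiv> hom_space K (carrier (halo_algebra K E))"

definition F_obj ::
  "('k, 'm) ring_scheme \<Rightarrow> ('g, 'n) monoid_scheme \<Rightarrow> 'e set
    \<Rightarrow> ('k, 'g, 'e, 'a) dig_rep \<Rightarrow> ('k, 'g, 'e, 'b) dig_rep \<Rightarrow> ('k, 'a \<Rightarrow> 'b, 'g) opmod" where
  "F_obj K G E Q W =
     with_act (halo_hom K E (halo_restrict K G Q) (halo_restrict K G W))
       (\<lambda>g f. \<lambda>x \<in> carrier Q. rho_grp E W g (f (inv_into (carrier Q) (rho_grp E Q g) x)))"

text \<open>The map \<open>Hom(Q, W) \<rightarrow> Hom(Q, W')\<close> induced by \<open>u : W \<rightarrow> W'\<close>.\<close>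

definition post :: "('k, 'a, 's) opmod \<Rightarrow> ('b \<Rightarrow> 'c) \<Rightarrow> ('a \<Rightarrow> 'b) \<Rightarrow> ('a \<Rightarrow> 'c)" where
  "post Q u = compose (carrier Q) u"

text \<open>\<open>R\<^sup>q F(W)\<close>, where \<open>(I, d)\<close> is an injective resolution of \<open>W\<close> in the category of
  representations.\<close>

definition RF ::
  "('k, 'm) ring_scheme \<Rightarrow> ('g, 'n) monoid_scheme \<Rightarrow> 'e set \<Rightarrow> ('k, 'g, 'e, 'a) dig_rep
    \<Rightarrow> (nat \<Rightarrow> ('k, 'g, 'e, 'u) dig_rep) \<Rightarrow> (nat \<Rightarrow> 'u \<Rightarrow> 'u) \<Rightarrow> nat
    \<Rightarrow> ('k, ('a \<Rightarrow> 'u) set, 'g) opmod" where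
  "RF K G E Q I d = op_cohomology (\<lambda>n. F_obj K G E Q (I n)) (\<lambda>n. post Q (d n))"

text \<open>\<open>Ext\<^sup>n(Q, W)\<close> in the category of representations, from the same data.\<close>

definition Ext_rep ::
  "('k, 'm) ring_scheme \<Rightarrow> ('g, 'n) monoid_scheme \<Rightarrow> 'e set \<Rightarrow> ('k, 'g, 'e, 'a) dig_rep
    \<Rightarrow> (nat \<Rightarrow> ('k, 'g, 'e, 'u) dig_rep) \<Rightarrow> (nat \<Rightarrow> 'u \<Rightarrow> 'u) \<Rightarrow> nat
    \<Rightarrow> ('k, ('a \<Rightarrow> 'u) set) module" where
  "Ext_rep K G E Q I d =
     cohomology (\<lambda>n. hom_space K (rep_ops G E) Q (I n)) (\<lambda>n. post Q (d n))"

text \<open>\<open>Ext\<^sup>q(Q, W)\<close> over the halo algebra as a vector space, where \<open>(J, \<epsilon>)\<close> is an injective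
  resolution of \<open>W\<close> in the category of modules over the halo algebra.\<close>

definition Ext_halo ::
  "('k, 'm) ring_scheme \<Rightarrow> ('g, 'n) monoid_scheme \<Rightarrow> 'e set \<Rightarrow> ('k, 'g, 'e, 'a) dig_rep
    \<Rightarrow> (nat \<Rightarrow> ('k, 'u, ('e list \<Rightarrow> 'k) set) opmod) \<Rightarrow> (nat \<Rightarrow> 'u \<Rightarrow> 'u) \<Rightarrow> nat
    \<Rightarrow> ('k, ('a \<Rightarrow> 'u) set) module" where
  "Ext_halo K G E Q J \<epsilon> =
     cohomology (\<lambda>n. halo_hom K E (halo_restrict K G Q) (J n)) (\<lambda>n. post Q (\<epsilon> n))"

text \<open>A chain map over the identity of \<open>W\<close> from the complex underlying an injective resolution
  of \<open>W\<close> by representations to an injective resolution by modules over the halo algebra.\<close>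

definition halo_comparison ::
  "('k, 'm) ring_scheme \<Rightarrow> ('g, 'n) monoid_scheme \<Rightarrow> 'e set \<Rightarrow> ('k, 'g, 'e, 'a) dig_rep
    \<Rightarrow> ('a \<Rightarrow> 'u) \<Rightarrow> (nat \<Rightarrow> ('k, 'g, 'e, 'u) dig_rep) \<Rightarrow> (nat \<Rightarrow> 'u \<Rightarrow> 'u)
    \<Rightarrow> ('a \<Rightarrow> 'v) \<Rightarrow> (nat \<Rightarrow> ('k, 'v, ('e list \<Rightarrow> 'k) set) opmod) \<Rightarrow> (nat \<Rightarrow> 'v \<Rightarrow> 'v)
    \<Rightarrow> (nat \<Rightarrow> 'u \<Rightarrow> 'v) \<Rightarrow> bool" where
  "halo_comparison K G E W \<eta> I d \<theta> J \<epsilon> c \<longleftrightarrow>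
     (\<forall>n. c n \<in> op_hom K (carrier (halo_algebra K E)) (halo_restrict K G (I n)) (J n)) \<and>
     (\<forall>n. \<forall>x \<in> carrier (I n). c (Suc n) (d n x) = \<epsilon> n (c n x)) \<and>
     (\<forall>x \<in> carrier W. c 0 (\<eta> x) = \<theta> x)"

text \<open>\<open>Ext\<^sup>q(Q, W)\<close> over the halo algebra, computed from \<open>(J, \<epsilon>)\<close>, as a \<open>G\<close>-module: the action of
  \<open>G\<close> on the complex of Hom spaces into a resolution \<open>(I, d)\<close> by representations induces an action
  on its cohomology, which is transported along the comparison isomorphism given by \<open>c\<close>.\<close>

definition Ext_halo_G ::
  "('k, 'm) ring_scheme \<Rightarrow> ('g, 'n) monoid_scheme \<Rightarrow> 'e set \<Rightarrow> ('k, 'g, 'e, 'a) dig_rep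
    \<Rightarrow> (nat \<Rightarrow> ('k, 'g, 'e, 'u) dig_rep) \<Rightarrow> (nat \<Rightarrow> 'u \<Rightarrow> 'u)
    \<Rightarrow> (nat \<Rightarrow> ('k, 'v, ('e list \<Rightarrow> 'k) set) opmod) \<Rightarrow> (nat \<Rightarrow> 'v \<Rightarrow> 'v)
    \<Rightarrow> (nat \<Rightarrow> 'u \<Rightarrow> 'v) \<Rightarrow> nat \<Rightarrow> ('k, ('a \<Rightarrow> 'v) set, 'g) opmod" where
  "Ext_halo_G K G E Q I d J \<epsilon> c q =
     (let H = op_cohomology (\<lambda>n. F_obj K G E Q (I n)) (\<lambda>n. post Q (d n)) q;
          \<Theta> = cohomology_map (\<lambda>n. halo_hom K E (halo_restrict K G Q) (J n))
                (\<lambda>n. post Q (\<epsilon> n)) q (post Q (c q))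
      in with_act (Ext_halo K G E Q J \<epsilon> q)
           (\<lambda>g y. \<Theta> (act H g (inv_into (carrier H) \<Theta> y))))"


section \<open>First-quadrant spectral sequences\<close>

text \<open>\<open>d r p q\<close> goes from \<open>E r p q\<close> to \<open>E r (p + r) (q - r + 1)\<close>; the target is zero if
  \<open>q + 1 < r\<close>.  Pages with \<open>r < 2\<close> play no role.\<close>

definition page_kernel ::
  "(nat \<Rightarrow> nat \<Rightarrow> nat \<Rightarrow> ('k, 'v) module) \<Rightarrow> (nat \<Rightarrow> nat \<Rightarrow> nat \<Rightarrow> 'v \<Rightarrow> 'v)
    \<Rightarrow> nat \<Rightarrow> nat \<Rightarrow> nat \<Rightarrow> 'v set" where
  "page_kernel E d r p q = (if r \<le> q + 1
     then {x \<in> carrier (E r p q). d r p q x = \<zero>\<^bsub>E r (p + r) (q + 1 - r)\<^esub>}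
     else carrier (E r p q))"

definition page_image ::
  "(nat \<Rightarrow> nat \<Rightarrow> nat \<Rightarrow> ('k, 'v) module) \<Rightarrow> (nat \<Rightarrow> nat \<Rightarrow> nat \<Rightarrow> 'v \<Rightarrow> 'v)
    \<Rightarrow> nat \<Rightarrow> nat \<Rightarrow> nat \<Rightarrow> 'v set" where
  "page_image E d r p q = (if r \<le> p
     then d r (p - r) (q + r - 1) ` carrier (E r (p - r) (q + r - 1))
     else {\<zero>\<^bsub>E r p q\<^esub>})"

definition spectral_sequence ::
  "('k, 'm) ring_scheme \<Rightarrow> (nat \<Rightarrow> nat \<Rightarrow> nat \<Rightarrow> ('k, 'v) module)
    \<Rightarrow> (nat \<Rightarrow> nat \<Rightarrow> nat \<Rightarrow> 'v \<Rightarrow> 'v) \<Rightarrow> bool" where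
  "spectral_sequence K E d \<longleftrightarrow> (\<forall>r \<ge> 2. \<forall>p q.
     module K (E r p q) \<and>
     (r \<le> q + 1 \<longrightarrow> d r p q \<in> linear_maps K (E r p q) (E r (p + r) (q + 1 - r))) \<and>
     page_image E d r p q \<subseteq> page_kernel E d r p q \<and>
     module_iso K (E (Suc r) p q)
       (subquotient (E r p q) (page_kernel E d r p q) (page_image E d r p q)))"

text \<open>For fixed \<open>p\<close> and \<open>q\<close> the pages are eventually constant up to isomorphism; the limit term is
  expressed by "all sufficiently large \<open>r\<close>".\<close>

definition converges_to ::
  "('k, 'm) ring_scheme \<Rightarrow> (nat \<Rightarrow> nat \<Rightarrow> nat \<Rightarrow> ('k, 'v) module)
    \<Rightarrow> (nat \<Rightarrow> ('k, 'h) module) \<Rightarrow> bool" where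
  "converges_to K E H \<longleftrightarrow> (\<forall>n. \<exists>F :: nat \<Rightarrow> 'h set.
     F 0 = carrier (H n) \<and> F (Suc n) = {\<zero>\<^bsub>H n\<^esub>} \<and>
     (\<forall>p. submodule (F p) K (H n) \<and> F (Suc p) \<subseteq> F p) \<and>
     (\<forall>p \<le> n. \<exists>r0. \<forall>r \<ge> r0.
        module_iso K (E r p (n - p)) (subquotient (H n) (F p) (F (Suc p)))))"

text \<open>The spectral sequence of a cochain complex \<open>(T, D)\<close> with a decreasing filtration,
  \<open>Fil p n \<subseteq> T n\<close>, with \<open>Fil 0 n = T n\<close>.  As usual
  \<open>E r p q = Z r p / (Z (r-1) (p+1) + D (Z (r-1) (p-r+1)))\<close>, where
  \<open>Z r p = {x \<in> Fil p. D x \<in> Fil (p+r)}\<close>; truncated subtraction in \<open>p-r+1\<close> is harmless, because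
  the filtration is constant in negative degrees.\<close>

definition filtered_Z ::
  "(nat \<Rightarrow> 'v \<Rightarrow> 'v) \<Rightarrow> (nat \<Rightarrow> nat \<Rightarrow> 'v set) \<Rightarrow> nat \<Rightarrow> nat \<Rightarrow> nat \<Rightarrow> 'v set" where
  "filtered_Z D Fil r p n = {x \<in> Fil p n. D n x \<in> Fil (p + r) (Suc n)}"

definition filtered_B ::
  "(nat \<Rightarrow> ('k, 'v, 'x) module_scheme) \<Rightarrow> (nat \<Rightarrow> 'v \<Rightarrow> 'v) \<Rightarrow> (nat \<Rightarrow> nat \<Rightarrow> 'v set)
    \<Rightarrow> nat \<Rightarrow> nat \<Rightarrow> nat \<Rightarrow> 'v set" where
  "filtered_B T D Fil r p n = (case n of
       0 \<Rightarrow> {\<zero>\<^bsub>T 0\<^esub>}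
     | Suc m \<Rightarrow> {D m y | y. y \<in> Fil (p - (r - 1)) m \<and> D m y \<in> Fil p n})"

definition filtered_denominator ::
  "(nat \<Rightarrow> ('k, 'v, 'x) module_scheme) \<Rightarrow> (nat \<Rightarrow> 'v \<Rightarrow> 'v) \<Rightarrow> (nat \<Rightarrow> nat \<Rightarrow> 'v set)
    \<Rightarrow> nat \<Rightarrow> nat \<Rightarrow> nat \<Rightarrow> 'v set" where
  "filtered_denominator T D Fil r p n =
     set_add (T n) (filtered_Z D Fil (r - 1) (Suc p) n) (filtered_B T D Fil r p n)"

definition filtered_page ::
  "(nat \<Rightarrow> ('k, 'v, 'x) module_scheme) \<Rightarrow> (nat \<Rightarrow> 'v \<Rightarrow> 'v) \<Rightarrow> (nat \<Rightarrow> nat \<Rightarrow> 'v set)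
    \<Rightarrow> nat \<Rightarrow> nat \<Rightarrow> nat \<Rightarrow> ('k, 'v set) module" where
  "filtered_page T D Fil r p q =
     subquotient (T (p + q)) (filtered_Z D Fil r p (p + q))
       (filtered_denominator T D Fil r p (p + q))"

definition filtered_diff ::
  "(nat \<Rightarrow> ('k, 'v, 'x) module_scheme) \<Rightarrow> (nat \<Rightarrow> 'v \<Rightarrow> 'v) \<Rightarrow> (nat \<Rightarrow> nat \<Rightarrow> 'v set)
    \<Rightarrow> nat \<Rightarrow> nat \<Rightarrow> nat \<Rightarrow> 'v set \<Rightarrow> 'v set" where
  "filtered_diff T D Fil r p q =
     coset_map (T (Suc (p + q))) (filtered_denominator T D Fil r (p + r) (Suc (p + q))) (D (p + q))"


section \<open>The Grothendieck spectral sequence\<close>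

text \<open>Total complex of a double complex \<open>X\<close> with commuting differentials
  \<open>dh i j : X i j \<rightarrow> X (i+1) j\<close> and \<open>dv i j : X i j \<rightarrow> X i (j+1)\<close>, and its filtration by the second
  index.  A cochain \<open>x\<close> of degree \<open>n\<close> has the components \<open>x i \<in> X i (n - i)\<close> for \<open>i \<le> n\<close>.\<close>

definition total ::
  "(nat \<Rightarrow> nat \<Rightarrow> ('k, 'v, 'x) module_scheme) \<Rightarrow> nat \<Rightarrow> ('k, nat \<Rightarrow> 'v) module" where
  "total X n =
    \<lparr>carrier = (\<Pi>\<^sub>E i \<in> {..n}. carrier (X i (n - i))),
     monoid.mult = undefined, one = undefined,
     zero = (\<lambda>i \<in> {..n}. \<zero>\<^bsub>X i (n - i)\<^esub>),
     add = (\<lambda>x y. \<lambda>i \<in> {..n}. x i \<oplus>\<^bsub>X i (n - i)\<^esub> y i),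
     smult = (\<lambda>k x. \<lambda>i \<in> {..n}. k \<odot>\<^bsub>X i (n - i)\<^esub> x i)\<rparr>"

definition total_diff ::
  "(nat \<Rightarrow> nat \<Rightarrow> ('k, 'v, 'x) module_scheme) \<Rightarrow> (nat \<Rightarrow> nat \<Rightarrow> 'v \<Rightarrow> 'v)
    \<Rightarrow> (nat \<Rightarrow> nat \<Rightarrow> 'v \<Rightarrow> 'v) \<Rightarrow> nat \<Rightarrow> (nat \<Rightarrow> 'v) \<Rightarrow> (nat \<Rightarrow> 'v)" where
  "total_diff X dh dv n x = (\<lambda>i \<in> {..Suc n}.
     (case i of 0 \<Rightarrow> \<zero>\<^bsub>X 0 (Suc n)\<^esub> | Suc i' \<Rightarrow> dh i' (n - i') (x i'))
     \<oplus>\<^bsub>X i (Suc n - i)\<^esub>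
     (if i = Suc n then \<zero>\<^bsub>X i 0\<^esub>
      else if even i then dv i (n - i) (x i)
      else \<ominus>\<^bsub>X i (Suc n - i)\<^esub> dv i (n - i) (x i)))"

definition total_filtration ::
  "(nat \<Rightarrow> nat \<Rightarrow> ('k, 'v, 'x) module_scheme) \<Rightarrow> nat \<Rightarrow> nat \<Rightarrow> (nat \<Rightarrow> 'v) set" where
  "total_filtration X p n =
     {x \<in> carrier (total X n). \<forall>i \<le> n. n - i < p \<longrightarrow> x i = \<zero>\<^bsub>X i (n - i)\<^esub>}"

text \<open>An injective Cartan--Eilenberg resolution of a complex \<open>(A, \<delta>)\<close> of \<open>G\<close>-modules: a double
  complex \<open>C\<close> with augmentation \<open>\<eta> i : A i \<rightarrow> C i 0\<close> such that, for each \<open>i\<close>, the terms, the cocycles,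
  the coboundaries and the cohomology with respect to \<open>dh\<close> form injective resolutions of
  those of \<open>A\<close>.\<close>

definition cartan_eilenberg ::
  "('k, 'm) ring_scheme \<Rightarrow> ('g, 'n) monoid_scheme
    \<Rightarrow> (nat \<Rightarrow> ('k, 'a, 'g) opmod) \<Rightarrow> (nat \<Rightarrow> 'a \<Rightarrow> 'a)
    \<Rightarrow> (nat \<Rightarrow> 'a \<Rightarrow> 'w) \<Rightarrow> (nat \<Rightarrow> nat \<Rightarrow> ('k, 'w, 'g) opmod)
    \<Rightarrow> (nat \<Rightarrow> nat \<Rightarrow> 'w \<Rightarrow> 'w) \<Rightarrow> (nat \<Rightarrow> nat \<Rightarrow> 'w \<Rightarrow> 'w) \<Rightarrow> bool" where
  "cartan_eilenberg K G A \<delta> \<eta> C dh dv \<longleftrightarrow>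
     (\<forall>i j. dh i j \<in> op_hom K (carrier G) (C i j) (C (Suc i) j)) \<and>
     (\<forall>i j. \<forall>x \<in> carrier (C i j). dh (Suc i) j (dh i j x) = \<zero>\<^bsub>C (Suc (Suc i)) j\<^esub>) \<and>
     (\<forall>i j. \<forall>x \<in> carrier (C i j). dh i (Suc j) (dv i j x) = dv (Suc i) j (dh i j x)) \<and>
     (\<forall>i. \<forall>a \<in> carrier (A i). dh i 0 (\<eta> i a) = \<eta> (Suc i) (\<delta> i a)) \<and>
     (\<forall>i. gmod_injective_resolution K G (A i) (\<eta> i) (C i) (dv i)) \<and>
     (\<forall>i. gmod_injective_resolution K G
        ((A i)\<lparr>carrier := cocycles A \<delta> i\<rparr>) (\<eta> i)
        (\<lambda>j. (C i j)\<lparr>carrier := cocycles (\<lambda>i. C i j) (\<lambda>i. dh i j) i\<rparr>) (dv i)) \<and>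
     (\<forall>i. gmod_injective_resolution K G
        ((A i)\<lparr>carrier := coboundaries A \<delta> i\<rparr>) (\<eta> i)
        (\<lambda>j. (C i j)\<lparr>carrier := coboundaries (\<lambda>i. C i j) (\<lambda>i. dh i j) i\<rparr>) (dv i)) \<and>
     (\<forall>i. gmod_injective_resolution K G
        (op_cohomology A \<delta> i)
        (cohomology_map (\<lambda>i. C i 0) (\<lambda>i. dh i 0) i (\<eta> i))
        (\<lambda>j. op_cohomology (\<lambda>i. C i j) (\<lambda>i. dh i j) i)
        (\<lambda>j. cohomology_map (\<lambda>i. C i (Suc j)) (\<lambda>i. dh i (Suc j)) i (dv i j)))"

text \<open>The Grothendieck spectral sequence of the composite of a functor \<open>F\<close> with the invariants
  functor is the spectral sequence of the double complex of invariants of a Cartan--Eilenberg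
  resolution \<open>C\<close> of \<open>F(I)\<close>, filtered by the resolution degree.\<close>

definition grothendieck_page ::
  "('g, 'n) monoid_scheme \<Rightarrow> (nat \<Rightarrow> nat \<Rightarrow> ('k, 'w, 'g) opmod)
    \<Rightarrow> (nat \<Rightarrow> nat \<Rightarrow> 'w \<Rightarrow> 'w) \<Rightarrow> (nat \<Rightarrow> nat \<Rightarrow> 'w \<Rightarrow> 'w)
    \<Rightarrow> nat \<Rightarrow> nat \<Rightarrow> nat \<Rightarrow> ('k, (nat \<Rightarrow> 'w) set) module" where
  "grothendieck_page G C dh dv =
     (let X = (\<lambda>i j. invariants G (C i j))
      in filtered_page (total X) (total_diff X dh dv) (total_filtration X))"

definition grothendieck_diff ::
  "('g, 'n) monoid_scheme \<Rightarrow> (nat \<Rightarrow> nat \<Rightarrow> ('k, 'w, 'g) opmod)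
    \<Rightarrow> (nat \<Rightarrow> nat \<Rightarrow> 'w \<Rightarrow> 'w) \<Rightarrow> (nat \<Rightarrow> nat \<Rightarrow> 'w \<Rightarrow> 'w)
    \<Rightarrow> nat \<Rightarrow> nat \<Rightarrow> nat \<Rightarrow> (nat \<Rightarrow> 'w) set \<Rightarrow> (nat \<Rightarrow> 'w) set" where
  "grothendieck_diff G C dh dv =
     (let X = (\<lambda>i j. invariants G (C i j))
      in filtered_diff (total X) (total_diff X dh dv) (total_filtration X))"

end

theory Submission
  imports Defs
begin

text \<open>
  A representation of the digroup \<open>G \<times> E\<close> is a module over the skew group algebra of \<open>G\<close> over the
  halo algebra: it is given by operators \<open>\<epsilon>\<^bsub>\<alpha>\<^esub>\<close> that satisfy the relations of the halo algebra and
  by an action \<open>\<rho>\<close> of \<open>G\<close> with \<open>\<rho>\<^bsub>g\<^esub> \<epsilon>\<^bsub>\<alpha>\<^esub> = \<epsilon>\<^bsub>g\<bullet>\<alpha>\<^esub> \<rho>\<^bsub>g\<^esub>\<close>.  The skew group algebra is free over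
  the halo algebra, so restriction to the halo algebra has an exact left adjoint and preserves
  injective objects (\<open>halo_restrict_injective\<close>).  An injective resolution by representations is
  therefore an injective resolution over the halo algebra, and the complex \<open>Hom(Q, I)\<close> that
  defines \<open>R\<^sup>qF(W)\<close> also computes \<open>Ext\<^sup>q(Q, W)\<close> over the halo algebra.  Different resolutions are
  compared by the comparison theorem (\<open>comparison_bij\<close>); a comparison map between resolutions by
  representations commutes with \<open>\<rho>\<close>, hence induces a \<open>G\<close>-equivariant map on \<open>Hom(Q, -)\<close>
  (\<open>RF_iso_Ext\<close>).

  Injectivity is tested on objects whose elements lie in one fixed type.  An induced
  representation consists of finitely supported functions on \<open>G\<close>, and it becomes a test object once
  these functions are coded by elements of that type, which is possible because the type is
  infinite and contains a copy of \<open>G\<close>.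

  If \<open>G\<close> is finite and its order is invertible in \<open>K\<close>, then averaging projects every \<open>G\<close>-module onto
  its invariants, naturally.  Hence invariants are exact: they commute with cohomology, and group
  cohomology vanishes in positive degrees.  In a Cartan--Eilenberg resolution the row cohomology
  is a resolution of \<open>H\<^sup>q(F(I))\<close>; its invariants are exact except at the start, where they give
  \<open>H\<^sup>q(F(I)\<^sup>G) = Ext\<^sup>q(Q, W)\<close> over the digroup.  So for \<open>r \<ge> 2\<close> the page \<open>E\<^sub>r\<close> is concentrated in the
  column \<open>p = 0\<close> and equal to \<open>H\<^sup>q(F(I)\<^sup>G)\<close> there (\<open>page_zero\<close>, \<open>page_first_column\<close>).  All
  differentials vanish, the limit is reached at \<open>r = 2\<close>, and the second page agrees with
  \<open>H\<^sup>p(G, Ext\<^sup>q(Q, W))\<close>, which also vanishes for \<open>p > 0\<close> and is \<open>(H\<^sup>q(F(I)))\<^sup>G = H\<^sup>q(F(I)\<^sup>G)\<close> for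
  \<open>p = 0\<close> (\<open>invariants_cohomology_iso\<close>).
\<close>

section \<open>Linear maps, subquotients and cohomology\<close>

lemma linear_mapsI:
  assumes "\<And>x. x \<in> carrier M \<Longrightarrow> f x \<in> carrier N"
    and "\<And>x y. x \<in> carrier M \<Longrightarrow> y \<in> carrier M \<Longrightarrow> f (x \<oplus>\<^bsub>M\<^esub> y) = f x \<oplus>\<^bsub>N\<^esub> f y"
    and "\<And>k x. k \<in> carrier K \<Longrightarrow> x \<in> carrier M \<Longrightarrow> f (k \<odot>\<^bsub>M\<^esub> x) = k \<odot>\<^bsub>N\<^esub> f x"
  shows "f \<in> linear_maps K M N"
  using assms by (auto simp: linear_maps_def)

lemma linear_mapsD:
  assumes "f \<in> linear_maps K M N"
  shows "x \<in> carrier M \<Longrightarrow> f x \<in> carrier N"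
    and "x \<in> carrier M \<Longrightarrow> y \<in> carrier M \<Longrightarrow> f (x \<oplus>\<^bsub>M\<^esub> y) = f x \<oplus>\<^bsub>N\<^esub> f y"
    and "k \<in> carrier K \<Longrightarrow> x \<in> carrier M \<Longrightarrow> f (k \<odot>\<^bsub>M\<^esub> x) = k \<odot>\<^bsub>N\<^esub> f x"
  using assms by (auto simp: linear_maps_def)

lemma linear_comp:
  assumes "f \<in> linear_maps K L M" "g \<in> linear_maps K M N"
  shows "(\<lambda>x. g (f x)) \<in> linear_maps K L N"
  using assms by (auto simp: linear_maps_def Pi_iff)

lemma module_abelian: "module K M \<Longrightarrow> abelian_group M"
  by (rule module.axioms(2))

lemma linear_zero:
  assumes "module K M" "module K N" "f \<in> linear_maps K M N"
  shows "f \<zero>\<^bsub>M\<^esub> = \<zero>\<^bsub>N\<^esub>"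
proof -
  interpret M: module K M by fact
  interpret N: module K N by fact
  have "f \<zero>\<^bsub>M\<^esub> \<oplus>\<^bsub>N\<^esub> f \<zero>\<^bsub>M\<^esub> = f \<zero>\<^bsub>M\<^esub>"
    using linear_mapsD(2)[OF assms(3), of "\<zero>\<^bsub>M\<^esub>" "\<zero>\<^bsub>M\<^esub>"] by simp
  then show ?thesis using linear_mapsD(1)[OF assms(3), of "\<zero>\<^bsub>M\<^esub>"] by simp
qed

lemma linear_uminus:
  assumes "module K M" "module K N" "f \<in> linear_maps K M N" "x \<in> carrier M"
  shows "f (\<ominus>\<^bsub>M\<^esub> x) = \<ominus>\<^bsub>N\<^esub> f x"
proof -
  interpret M: module K M by fact
  interpret N: module K N by fact
  note f = linear_mapsD[OF assms(3)]
  have "f (\<ominus>\<^bsub>M\<^esub> x) \<oplus>\<^bsub>N\<^esub> f x = \<zero>\<^bsub>N\<^esub>"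
    using f(2)[of "\<ominus>\<^bsub>M\<^esub> x" x] assms(4) linear_zero[OF assms(1-3)] by (simp add: M.l_neg)
  then show ?thesis using assms(4) f(1) by (simp add: N.minus_equality)
qed

lemma linear_minus:
  assumes "module K M" "module K N" "f \<in> linear_maps K M N" "x \<in> carrier M" "y \<in> carrier M"
  shows "f (x \<ominus>\<^bsub>M\<^esub> y) = f x \<ominus>\<^bsub>N\<^esub> f y"
proof -
  interpret M: module K M by fact
  interpret N: module K N by fact
  show ?thesis
    using linear_mapsD(2)[OF assms(3), of x "\<ominus>\<^bsub>M\<^esub> y"] linear_uminus[OF assms(1-3)] assms(4,5)
    by (simp add: M.minus_eq N.minus_eq)
qed

lemma minus_eq_zero_iff:
  assumes "module K M" "x \<in> carrier M" "y \<in> carrier M"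
  shows "x \<ominus>\<^bsub>M\<^esub> y = \<zero>\<^bsub>M\<^esub> \<longleftrightarrow> x = y"
proof -
  interpret M: module K M by fact
  show ?thesis using assms M.add.inv_solve_right[of "\<zero>\<^bsub>M\<^esub>" x y] by (auto simp: M.minus_eq M.r_neg)
qed

lemma linear_finsum:
  assumes "module K M" "module K N" "f \<in> linear_maps K M N" "h \<in> A \<rightarrow> carrier M"
  shows "f (\<Oplus>\<^bsub>M\<^esub>i\<in>A. h i) = (\<Oplus>\<^bsub>N\<^esub>i\<in>A. f (h i))"
proof -
  interpret M: module K M by fact
  interpret N: module K N by fact
  note f = linear_mapsD[OF assms(3)]
  show ?thesis
    using assms(4)
  proof (induction A rule: infinite_finite_induct)
    case (infinite A) then show ?case by (simp add: M.finsum_infinite N.finsum_infinite linear_zero[OF assms(1-3)])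
  next
    case empty then show ?case by (simp add: linear_zero[OF assms(1-3)])
  next
    case (insert a A)
    then have "h a \<in> carrier M" "h \<in> A \<rightarrow> carrier M" by auto
    with insert show ?case by (simp add: f Pi_iff)
  qed
qed

lemma smult_linear:
  assumes "module K M" "k \<in> carrier K"
  shows "(\<lambda>x. k \<odot>\<^bsub>M\<^esub> x) \<in> linear_maps K M M"
proof -
  interpret M: module K M by fact
  show ?thesis using assms(2) M.smult_assoc1[symmetric] M.R.m_comm
    by (intro linear_mapsI) (auto simp: M.smult_r_distr)
qed

lemma submodule_carrierD: "submodule B K M \<Longrightarrow> x \<in> B \<Longrightarrow> x \<in> carrier M"
  using submodule.axioms(1) subgroup.subset by fastforce

lemma zero_submodule: "module K M \<Longrightarrow> submodule {\<zero>\<^bsub>M\<^esub>} K M"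
  by (rule module.submoduleI)
    (auto simp: module.smult_r_null abelian_group.axioms module_abelian
       abelian_monoid.zero_closed abelian_monoid.l_zero abelian_group.minus_equality)

lemma submodule_zero: "module K M \<Longrightarrow> submodule B K M \<Longrightarrow> \<zero>\<^bsub>M\<^esub> \<in> B"
  using subgroup.one_closed submodule.axioms(1) by fastforce

lemma image_submodule:
  assumes "module K M" "module K N" "f \<in> linear_maps K M N" "submodule B K M"
  shows "submodule (f ` B) K N"
proof -
  interpret M: module K M by fact
  interpret N: module K N by fact
  note f = linear_mapsD[OF assms(3)] and B = M.submoduleE[OF assms(4)]
  note z = submodule_zero[OF assms(1,4)]
  note c = submodule_carrierD[OF assms(4)]
  show ?thesis
  proof (rule N.submoduleI)
    show "f ` B \<subseteq> carrier N" using f c by auto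
    show "\<zero>\<^bsub>N\<^esub> \<in> f ` B" using z linear_zero[OF assms(1-3)] by force
    show "\<ominus>\<^bsub>N\<^esub> a \<in> f ` B" if "a \<in> f ` B" for a
      using that linear_uminus[OF assms(1-3)] B(3) c by (smt (verit, ccfv_SIG) image_iff)
    show "a \<oplus>\<^bsub>N\<^esub> b \<in> f ` B" if "a \<in> f ` B" "b \<in> f ` B" for a b
      using that f(2) B(5) c by (smt (verit, ccfv_SIG) image_iff)
    show "a \<odot>\<^bsub>N\<^esub> b \<in> f ` B" if "a \<in> carrier K" "b \<in> f ` B" for a b
      using that f(3) B(4) c by (smt (verit, ccfv_SIG) image_iff)
  qed
qed

lemma kernel_submodule:
  assumes "module K M" "module K N" "f \<in> linear_maps K M N" "submodule B K N"
  shows "submodule {x \<in> carrier M. f x \<in> B} K M"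
proof -
  interpret M: module K M by fact
  interpret N: module K N by fact
  note f = linear_mapsD[OF assms(3)] and B = N.submoduleE[OF assms(4)]
  note z = submodule_zero[OF assms(2,4)]
  show ?thesis
    by (rule M.submoduleI)
      (auto simp: f B z linear_zero[OF assms(1-3)] linear_uminus[OF assms(1-3)])
qed

lemma set_add_submodule:
  assumes "module K M" "submodule A K M" "submodule B K M"
  shows "submodule (set_add M A B) K M"
proof -
  interpret M: module K M by fact
  note A = M.submoduleE[OF assms(2)] and B = M.submoduleE[OF assms(3)]
  note c = submodule_carrierD[OF assms(2)] submodule_carrierD[OF assms(3)]
  have mem: "x \<in> set_add M A B \<longleftrightarrow> (\<exists>a\<in>A. \<exists>b\<in>B. x = a \<oplus>\<^bsub>M\<^esub> b)" for x
    by (auto simp: set_add_def set_mult_def)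
  show ?thesis
  proof (rule M.submoduleI)
    show "set_add M A B \<subseteq> carrier M" using c by (auto simp: mem)
    show "\<zero>\<^bsub>M\<^esub> \<in> set_add M A B"
      unfolding mem by (rule bexI[OF _ submodule_zero[OF assms(1,2)]], rule bexI[OF _ submodule_zero[OF assms(1,3)]]) simp
    show "\<ominus>\<^bsub>M\<^esub> a \<in> set_add M A B" if "a \<in> set_add M A B" for a
      using that unfolding mem using A(3) B(3) c by (metis M.minus_add)
    show "a \<oplus>\<^bsub>M\<^esub> b \<in> set_add M A B" if ab: "a \<in> set_add M A B" "b \<in> set_add M A B" for a b
    proof -
      from ab obtain x y x' y' where *: "x \<in> A" "x' \<in> A" "y \<in> B" "y' \<in> B" "a = x \<oplus>\<^bsub>M\<^esub> y" "b = x' \<oplus>\<^bsub>M\<^esub> y'"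
        unfolding mem by blast
      then have "a \<oplus>\<^bsub>M\<^esub> b = (x \<oplus>\<^bsub>M\<^esub> x') \<oplus>\<^bsub>M\<^esub> (y \<oplus>\<^bsub>M\<^esub> y')" using c by (simp add: M.M.a_ac)
      then show ?thesis unfolding mem using * A(5) B(5) by blast
    qed
    show "k \<odot>\<^bsub>M\<^esub> a \<in> set_add M A B" if "k \<in> carrier K" "a \<in> set_add M A B" for k a
      using that unfolding mem using A(4) B(4) c by (metis M.smult_r_distr)
  qed
qed

lemma submodule_abelian_subgroup:
  assumes "module K M" "submodule B K M"
  shows "abelian_subgroup B M"
  using assms by (intro abelian_subgroupI3 additive_subgroupI module_abelian)
    (auto intro: submodule.axioms(1))

lemma coset_mem_self:
  assumes "module K M" "submodule B K M" "x \<in> carrier M"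
  shows "x \<in> B +>\<^bsub>M\<^esub> x"
  using abelian_subgroup.a_rcos_self[OF submodule_abelian_subgroup[OF assms(1,2)] assms(3)] .

lemma coset_memE:
  assumes "y \<in> B +>\<^bsub>M\<^esub> x"
  obtains b where "b \<in> B" "y = b \<oplus>\<^bsub>M\<^esub> x"
  using assms by (auto simp: a_r_coset_def r_coset_def)

lemma coset_eq_iff:
  assumes "module K M" "submodule B K M" "x \<in> carrier M" "y \<in> carrier M"
  shows "B +>\<^bsub>M\<^esub> x = B +>\<^bsub>M\<^esub> y \<longleftrightarrow> x \<ominus>\<^bsub>M\<^esub> y \<in> B"
proof -
  interpret B: abelian_subgroup B M by (rule submodule_abelian_subgroup[OF assms(1,2)])
  have "B +>\<^bsub>M\<^esub> x = B +>\<^bsub>M\<^esub> y \<longleftrightarrow> x \<in> B +>\<^bsub>M\<^esub> y"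
    using B.a_repr_independence'[of x y] B.a_rcos_self[of x] assms by auto
  then show ?thesis using assms by (simp add: B.a_rcos_module B.minus_eq)
qed

lemma coset_zero:
  assumes "module K M" "submodule B K M" "x \<in> B"
  shows "B +>\<^bsub>M\<^esub> x = B"
  using abelian_subgroup.a_rcos_const[OF submodule_abelian_subgroup[OF assms(1,2)] assms(3)] .

lemma coset_eq_zero_iff:
  assumes "module K M" "submodule B K M" "x \<in> carrier M"
  shows "B +>\<^bsub>M\<^esub> x = B \<longleftrightarrow> x \<in> B"
  using coset_zero[OF assms(1,2)] coset_mem_self[OF assms] by blast

lemma coset_add:
  assumes "module K M" "submodule B K M" "x \<in> carrier M" "y \<in> carrier M"
  shows "set_add M (B +>\<^bsub>M\<^esub> x) (B +>\<^bsub>M\<^esub> y) = B +>\<^bsub>M\<^esub> (x \<oplus>\<^bsub>M\<^esub> y)"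
  using abelian_subgroup.a_rcos_sum[OF submodule_abelian_subgroup[OF assms(1,2)] assms(3,4)] .

text \<open>The members of a coset of \<open>B\<close> have their values in one coset of \<open>B'\<close>, so the union that
  defines the map on cosets has a single member.\<close>

lemma coset_map_coset:
  assumes "module K M" "module K N" "f \<in> linear_maps K M N" "submodule B K M" "submodule B' K N"
    and "\<And>b. b \<in> B \<Longrightarrow> f b \<in> B'" "x \<in> carrier M"
  shows "coset_map N B' f (B +>\<^bsub>M\<^esub> x) = B' +>\<^bsub>N\<^esub> f x"
proof -
  interpret M: module K M by fact
  interpret N: module K N by fact
  have "B' +>\<^bsub>N\<^esub> f y = B' +>\<^bsub>N\<^esub> f x" if "y \<in> B +>\<^bsub>M\<^esub> x" for y
  proof -
    from that obtain b where b: "b \<in> B" "y = b \<oplus>\<^bsub>M\<^esub> x" by (rule coset_memE)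
    then have "f b \<in> carrier N" "f x \<in> carrier N" "b \<in> carrier M"
      using assms submodule_carrierD linear_mapsD(1) by metis+
    then have "f y \<ominus>\<^bsub>N\<^esub> f x = f b"
      using b assms(7) by (simp add: linear_mapsD(2)[OF assms(3)] N.minus_eq N.M.a_assoc N.r_neg)
    then show ?thesis
      using coset_eq_iff[OF assms(2,5)] b assms(6,7) \<open>f b \<in> _\<close> \<open>f x \<in> _\<close> \<open>b \<in> carrier M\<close>
      by (simp add: linear_mapsD(2)[OF assms(3)])
  qed
  then show ?thesis using coset_mem_self[OF assms(1,4,7)] unfolding coset_map_def by blast
qed

lemma subquotient_simps [simp]:
  "carrier (subquotient M Z B) = (\<lambda>z. B +>\<^bsub>M\<^esub> z) ` Z"
  "zero (subquotient M Z B) = B"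
  "add (subquotient M Z B) = set_add M"
  "smult (subquotient M Z B) k = coset_map M B (\<lambda>x. k \<odot>\<^bsub>M\<^esub> x)"
  by (auto simp: subquotient_def)

lemma coset_smult:
  assumes "module K M" "submodule B K M" "x \<in> carrier M" "k \<in> carrier K"
  shows "coset_map M B (\<lambda>x. k \<odot>\<^bsub>M\<^esub> x) (B +>\<^bsub>M\<^esub> x) = B +>\<^bsub>M\<^esub> (k \<odot>\<^bsub>M\<^esub> x)"
  by (rule coset_map_coset[OF assms(1,1) smult_linear[OF assms(1,4)] assms(2,2) _ assms(3)])
     (rule submodule.smult_closed[OF assms(2,4)])

lemma subquotient_module:
  assumes "module K M" "submodule Z K M" "submodule B K M" "B \<subseteq> Z"
  shows "module K (subquotient M Z B)"
proof -
  interpret M: module K M by fact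
  note c = submodule_carrierD[OF assms(2)] and Z = M.submoduleE[OF assms(2)]
  note z = submodule_zero[OF assms(1,2)]
  have B0: "B = B +>\<^bsub>M\<^esub> \<zero>\<^bsub>M\<^esub>" using coset_zero[OF assms(1,3)] submodule_zero[OF assms(1,3)] by simp
  note cs = coset_add[OF assms(1,3)] coset_smult[OF assms(1,3)]
  show ?thesis
  proof (rule moduleI)
    show "cring K" by (rule M.R.is_cring)
    have addB: "set_add M B (B +>\<^bsub>M\<^esub> x) = B +>\<^bsub>M\<^esub> x" if "x \<in> carrier M" for x
      using cs(1)[of "\<zero>\<^bsub>M\<^esub>" x] that B0 by simp
    show "abelian_group (subquotient M Z B)"
    proof (rule abelian_groupI)
      fix x y assume *: "x \<in> carrier (subquotient M Z B)" "y \<in> carrier (subquotient M Z B)"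
      then show "x \<oplus>\<^bsub>subquotient M Z B\<^esub> y \<in> carrier (subquotient M Z B)" using c Z cs by auto
      show "x \<oplus>\<^bsub>subquotient M Z B\<^esub> y = y \<oplus>\<^bsub>subquotient M Z B\<^esub> x" using * c cs by (auto simp: M.M.a_ac)
      fix z assume "z \<in> carrier (subquotient M Z B)"
      then show "x \<oplus>\<^bsub>subquotient M Z B\<^esub> y \<oplus>\<^bsub>subquotient M Z B\<^esub> z = x \<oplus>\<^bsub>subquotient M Z B\<^esub> (y \<oplus>\<^bsub>subquotient M Z B\<^esub> z)"
        using * c cs by (auto simp: M.M.a_ac)
    next
      show "\<zero>\<^bsub>subquotient M Z B\<^esub> \<in> carrier (subquotient M Z B)" using B0 z by auto
      fix x assume *: "x \<in> carrier (subquotient M Z B)"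
      then show "\<zero>\<^bsub>subquotient M Z B\<^esub> \<oplus>\<^bsub>subquotient M Z B\<^esub> x = x" using addB c by auto
      from * obtain u where u: "u \<in> Z" "x = B +>\<^bsub>M\<^esub> u" by auto
      then have "set_add M (B +>\<^bsub>M\<^esub> (\<ominus>\<^bsub>M\<^esub> u)) x = B" using cs(1) c B0 by (simp add: M.l_neg)
      then show "\<exists>y\<in>carrier (subquotient M Z B). y \<oplus>\<^bsub>subquotient M Z B\<^esub> x = \<zero>\<^bsub>subquotient M Z B\<^esub>"
        using Z(3) u by auto
    qed
  qed (use c Z cs in \<open>auto simp: M.smult_l_distr M.smult_r_distr M.smult_assoc1\<close>)
qed

text \<open>The first isomorphism theorem.  The inverse image of a point of \<open>N\<close> is a single coset of the
  kernel, so the value at a coset is the value of \<open>f\<close> at any of its members.\<close>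

lemma subquotient_iso:
  assumes M: "module K M" and N: "module K N" and Z: "submodule Z K M"
    and f: "f \<in> linear_maps K (M\<lparr>carrier := Z\<rparr>) N" and surj: "f ` Z = carrier N"
    and B: "B = {x \<in> Z. f x = \<zero>\<^bsub>N\<^esub>}"
  shows "module_iso K (subquotient M Z B) N"
proof -
  interpret M: module K M by fact
  interpret N: module K N by fact
  interpret Z: module K "M\<lparr>carrier := Z\<rparr>" by (rule submodule.submodule_is_module[OF Z M])
  note c = submodule_carrierD[OF Z] and ZE = M.submoduleE[OF Z]
  note fD = linear_mapsD[OF f, simplified]
  have subB: "submodule B K M"
  proof -
    have inv: "f (\<ominus>\<^bsub>M\<^esub> x) = \<ominus>\<^bsub>N\<^esub> f x" if "x \<in> Z" for x
    proof -
      have "f (\<ominus>\<^bsub>M\<^esub> x) \<oplus>\<^bsub>N\<^esub> f x = \<zero>\<^bsub>N\<^esub>"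
        using fD(2)[of "\<ominus>\<^bsub>M\<^esub> x" x] that c ZE linear_zero[OF Z.module_axioms N f] by (simp add: M.l_neg)
      then show ?thesis using that fD(1) ZE by (simp add: N.minus_equality)
    qed
    show ?thesis unfolding B
      by (rule M.submoduleI)
        (use ZE c fD linear_zero[OF Z.module_axioms N f] submodule_zero[OF M Z] inv in \<open>auto\<close>)
  qed
  have diff: "f (x \<ominus>\<^bsub>M\<^esub> y) = f x \<ominus>\<^bsub>N\<^esub> f y" if "x \<in> Z" "y \<in> Z" for x y
  proof -
    have "f (x \<ominus>\<^bsub>M\<^esub> y) \<oplus>\<^bsub>N\<^esub> f y = f x"
      using fD(2)[of "x \<ominus>\<^bsub>M\<^esub> y" y] that c ZE by (simp add: M.minus_eq M.M.a_assoc M.l_neg)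
    then show ?thesis using that fD(1) ZE
      by (metis M.minus_eq N.add.inv_solve_right N.minus_eq)
  qed
  define h where "h X = f (SOME x. x \<in> X)" for X
  have h: "h (B +>\<^bsub>M\<^esub> x) = f x" if x: "x \<in> Z" for x
  proof -
    have "(SOME y. y \<in> B +>\<^bsub>M\<^esub> x) \<in> B +>\<^bsub>M\<^esub> x"
      using coset_mem_self[OF M subB c[OF x]] by (rule someI)
    then obtain b where b: "b \<in> B" "(SOME y. y \<in> B +>\<^bsub>M\<^esub> x) = b \<oplus>\<^bsub>M\<^esub> x" by (rule coset_memE)
    then have "b \<in> Z" "f b = \<zero>\<^bsub>N\<^esub>" using B by auto
    then show ?thesis using b x fD by (simp add: h_def)
  qed
  have "h \<in> linear_maps K (subquotient M Z B) N"
    by (rule linear_mapsI)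
      (use h c ZE fD coset_add[OF M subB] coset_smult[OF M subB] in \<open>auto\<close>)
  moreover have "inj_on h (carrier (subquotient M Z B))"
  proof (rule inj_onI, clarsimp)
    fix x y assume xy: "x \<in> Z" "y \<in> Z" "h (B +>\<^bsub>M\<^esub> x) = h (B +>\<^bsub>M\<^esub> y)"
    then have "f (x \<ominus>\<^bsub>M\<^esub> y) = \<zero>\<^bsub>N\<^esub>" using h diff fD(1) by (simp add: N.minus_eq N.r_neg)
    moreover have "x \<ominus>\<^bsub>M\<^esub> y \<in> Z" using ZE xy by (simp add: M.minus_eq)
    ultimately show "B +>\<^bsub>M\<^esub> x = B +>\<^bsub>M\<^esub> y" using coset_eq_iff[OF M subB] xy c B by simp
  qed
  moreover have "h ` carrier (subquotient M Z B) = carrier N"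
    using h surj by (auto simp: image_iff) (metis imageE)
  ultimately show ?thesis unfolding module_iso_def bij_betw_def by blast
qed

lemma module_iso_sym:
  assumes "module K M" "module K N" "module_iso K M N"
  shows "module_iso K N M"
proof -
  interpret M: module K M by fact
  from assms(3) obtain f where f: "f \<in> linear_maps K M N" "bij_betw f (carrier M) (carrier N)"
    unfolding module_iso_def by blast
  let ?g = "inv_into (carrier M) f"
  note fD = linear_mapsD[OF f(1)]
  have g: "?g y \<in> carrier M" "f (?g y) = y" if "y \<in> carrier N" for y
    using f(2) that by (auto simp: bij_betw_def inv_into_into f_inv_into_f)
  have gf: "?g (f x) = x" if "x \<in> carrier M" for x
    using f(2) that by (auto simp: bij_betw_def)
  have "?g \<in> linear_maps K N M"
  proof (rule linear_mapsI)
    fix x y assume "x \<in> carrier N" "y \<in> carrier N"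
    then have "x \<oplus>\<^bsub>N\<^esub> y = f (?g x \<oplus>\<^bsub>M\<^esub> ?g y)" using g fD by simp
    then show "?g (x \<oplus>\<^bsub>N\<^esub> y) = ?g x \<oplus>\<^bsub>M\<^esub> ?g y" using gf g \<open>x \<in> _\<close> \<open>y \<in> _\<close> by simp
  next
    fix k x assume "k \<in> carrier K" "x \<in> carrier N"
    then have "k \<odot>\<^bsub>N\<^esub> x = f (k \<odot>\<^bsub>M\<^esub> ?g x)" using g fD by simp
    then show "?g (k \<odot>\<^bsub>N\<^esub> x) = k \<odot>\<^bsub>M\<^esub> ?g x" using gf g \<open>x \<in> _\<close> \<open>k \<in> _\<close> by simp
  qed (use g in auto)
  then show ?thesis unfolding module_iso_def using bij_betw_inv_into[OF f(2)] by blast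
qed

lemma module_iso_trans:
  assumes "module_iso K L M" "module_iso K M N"
  shows "module_iso K L N"
proof -
  from assms obtain f g where "f \<in> linear_maps K L M" "bij_betw f (carrier L) (carrier M)"
    "g \<in> linear_maps K M N" "bij_betw g (carrier M) (carrier N)"
    unfolding module_iso_def by blast
  then show ?thesis unfolding module_iso_def
    by (intro bexI[of _ "\<lambda>x. g (f x)"]) (auto intro: linear_comp dest: bij_betw_trans simp: comp_def)
qed

lemma module_iso_zero:
  assumes "module K M" "module K N" "carrier M = {\<zero>\<^bsub>M\<^esub>}" "carrier N = {\<zero>\<^bsub>N\<^esub>}"
  shows "module_iso K M N"
proof -
  interpret N: module K N by fact
  have "(\<lambda>_. \<zero>\<^bsub>N\<^esub>) \<in> linear_maps K M N" by (rule linear_mapsI) auto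
  then show ?thesis unfolding module_iso_def using assms(3,4) by (auto simp: bij_betw_def)
qed

lemma subquotient_whole_iso:
  assumes "module K M"
  shows "module_iso K (subquotient M (carrier M) {\<zero>\<^bsub>M\<^esub>}) M"
proof (rule subquotient_iso[OF assms assms])
  interpret M: module K M by fact
  show "submodule (carrier M) K M" by (rule M.carrier_is_submodule)
  show "(\<lambda>x. x) \<in> linear_maps K (M\<lparr>carrier := carrier M\<rparr>) M" by (rule linear_mapsI) auto
qed (auto simp: submodule_zero[OF assms module.carrier_is_submodule[OF assms]])


text \<open>Used to replace a complex of \<open>G\<close>-modules or of invariants by a complex of \<open>Hom\<close> spaces, which
  has another record type and the same underlying vector spaces.\<close>

lemma cohomology_cong:
  assumes "\<And>n. carrier (A n) = carrier (A' n)" "\<And>n. add (A n) = add (A' n)"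
    "\<And>n. zero (A n) = zero (A' n)" "\<And>n. smult (A n) = smult (A' n)"
  shows "cohomology A \<delta> q = cohomology A' \<delta> q"
    and "cohomology_map A \<delta> q = cohomology_map A' \<delta> q"
    and "cocycles A \<delta> q = cocycles A' \<delta> q" "coboundaries A \<delta> q = coboundaries A' \<delta> q"
proof -
  have z: "cocycles A \<delta> q = cocycles A' \<delta> q" and b: "coboundaries A \<delta> q = coboundaries A' \<delta> q"
    using assms by (auto simp: cocycles_def coboundaries_def split: nat.splits)
  have m: "coset_map (A n) = coset_map (A' n)" for n
    by (simp add: fun_eq_iff coset_map_def a_r_coset_def r_coset_def assms)
  have a: "set_add (A n) = set_add (A' n)" for n
    by (simp add: fun_eq_iff set_add_def set_mult_def assms)
  show "cohomology A \<delta> q = cohomology A' \<delta> q"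
    by (simp add: cohomology_def subquotient_def z b a a_r_coset_def r_coset_def assms m)
  show "cohomology_map A \<delta> q = cohomology_map A' \<delta> q"
    by (simp add: cohomology_map_def fun_eq_iff b m)
  show "cocycles A \<delta> q = cocycles A' \<delta> q" "coboundaries A \<delta> q = coboundaries A' \<delta> q"
    by (fact z b)+
qed

locale cochain_complex =
  fixes K :: "('k, 'm) ring_scheme" and A :: "nat \<Rightarrow> ('k, 'v, 'x) module_scheme"
    and \<delta> :: "nat \<Rightarrow> 'v \<Rightarrow> 'v"
  assumes mod: "module K (A n)"
    and diff: "\<delta> n \<in> linear_maps K (A n) (A (Suc n))"
    and diff_diff: "x \<in> carrier (A n) \<Longrightarrow> \<delta> (Suc n) (\<delta> n x) = \<zero>\<^bsub>A (Suc (Suc n))\<^esub>"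
begin

lemma cocycles_submodule: "submodule (cocycles A \<delta> q) K (A q)"
  using kernel_submodule[OF mod mod diff zero_submodule[OF mod]]
  by (simp add: cocycles_def)

lemma coboundaries_submodule: "submodule (coboundaries A \<delta> q) K (A q)"
  by (cases q)
    (auto simp: coboundaries_def zero_submodule[OF mod]
      intro!: image_submodule[OF mod mod diff] module.carrier_is_submodule[OF mod])

lemma coboundaries_subset: "coboundaries A \<delta> q \<subseteq> cocycles A \<delta> q"
  by (cases q)
    (auto simp: coboundaries_def cocycles_def diff_diff linear_mapsD(1)[OF diff]
      linear_zero[OF mod mod diff] submodule_zero[OF mod module.carrier_is_submodule[OF mod]])

lemma cocycles_carrier: "x \<in> cocycles A \<delta> q \<Longrightarrow> x \<in> carrier (A q)"
  by (simp add: cocycles_def)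

lemma coboundaries_carrier: "x \<in> coboundaries A \<delta> q \<Longrightarrow> x \<in> carrier (A q)"
  using coboundaries_subset cocycles_carrier by blast

lemma cohomology_module: "module K (cohomology A \<delta> q)"
  unfolding cohomology_def
  by (rule subquotient_module[OF mod cocycles_submodule coboundaries_submodule coboundaries_subset])

lemma cohomology_simps:
  "carrier (cohomology A \<delta> q) = (\<lambda>x. coboundaries A \<delta> q +>\<^bsub>A q\<^esub> x) ` cocycles A \<delta> q"
  "zero (cohomology A \<delta> q) = coboundaries A \<delta> q"
  by (auto simp: cohomology_def)

lemma class_eq_iff:
  assumes "x \<in> carrier (A q)" "y \<in> carrier (A q)"
  shows "coboundaries A \<delta> q +>\<^bsub>A q\<^esub> x = coboundaries A \<delta> q +>\<^bsub>A q\<^esub> y \<longleftrightarrow> x \<ominus>\<^bsub>A q\<^esub> y \<in> coboundaries A \<delta> q"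
  by (rule coset_eq_iff[OF mod coboundaries_submodule assms])

lemma class_eq_zero_iff:
  assumes "x \<in> carrier (A q)"
  shows "coboundaries A \<delta> q +>\<^bsub>A q\<^esub> x = coboundaries A \<delta> q \<longleftrightarrow> x \<in> coboundaries A \<delta> q"
  by (rule coset_eq_zero_iff[OF mod coboundaries_submodule assms])

lemma class_add:
  assumes "x \<in> carrier (A q)" "y \<in> carrier (A q)"
  shows "(coboundaries A \<delta> q +>\<^bsub>A q\<^esub> x) \<oplus>\<^bsub>cohomology A \<delta> q\<^esub> (coboundaries A \<delta> q +>\<^bsub>A q\<^esub> y)
    = coboundaries A \<delta> q +>\<^bsub>A q\<^esub> (x \<oplus>\<^bsub>A q\<^esub> y)"
  using coset_add[OF mod coboundaries_submodule assms] by (simp add: cohomology_def)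

lemma class_smult:
  assumes "x \<in> carrier (A q)" "k \<in> carrier K"
  shows "k \<odot>\<^bsub>cohomology A \<delta> q\<^esub> (coboundaries A \<delta> q +>\<^bsub>A q\<^esub> x) = coboundaries A \<delta> q +>\<^bsub>A q\<^esub> (k \<odot>\<^bsub>A q\<^esub> x)"
  using coset_smult[OF mod coboundaries_submodule assms] by (simp add: cohomology_def)

end

locale cochain_map = A: cochain_complex K A \<delta> + A': cochain_complex K A' \<delta>'
  for K :: "('k, 'm) ring_scheme" and A :: "nat \<Rightarrow> ('k, 'v, 'x) module_scheme" and \<delta>
    and A' :: "nat \<Rightarrow> ('k, 'w, 'y) module_scheme" and \<delta>' +
  fixes u :: "nat \<Rightarrow> 'v \<Rightarrow> 'w"
  assumes lin: "u n \<in> linear_maps K (A n) (A' n)"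
    and chain: "x \<in> carrier (A n) \<Longrightarrow> u (Suc n) (\<delta> n x) = \<delta>' n (u n x)"
begin

lemma maps_cocycles: "x \<in> cocycles A \<delta> q \<Longrightarrow> u q x \<in> cocycles A' \<delta>' q"
  using chain[of x q] linear_zero[OF A.mod A'.mod lin] linear_mapsD(1)[OF lin]
  by (auto simp: cocycles_def)

lemma maps_coboundaries: "x \<in> coboundaries A \<delta> q \<Longrightarrow> u q x \<in> coboundaries A' \<delta>' q"
  using chain linear_zero[OF A.mod A'.mod lin] linear_mapsD(1)[OF lin]
  by (auto simp: coboundaries_def split: nat.splits)

lemma map_class:
  assumes "x \<in> carrier (A q)"
  shows "cohomology_map A' \<delta>' q (u q) (coboundaries A \<delta> q +>\<^bsub>A q\<^esub> x) = coboundaries A' \<delta>' q +>\<^bsub>A' q\<^esub> u q x"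
  unfolding cohomology_map_def
  by (rule coset_map_coset[OF A.mod A'.mod lin A.coboundaries_submodule A'.coboundaries_submodule
        maps_coboundaries assms])

lemma map_linear: "cohomology_map A' \<delta>' q (u q) \<in> linear_maps K (cohomology A \<delta> q) (cohomology A' \<delta>' q)"
proof (rule linear_mapsI)
  note c = A.cocycles_carrier
  note ops = abelian_monoid.a_closed[OF abelian_group.axioms(1)[OF module_abelian[OF A.mod]]]
    module.smult_closed[OF A.mod]
  fix X assume "X \<in> carrier (cohomology A \<delta> q)"
  then obtain x where x: "x \<in> cocycles A \<delta> q" "X = coboundaries A \<delta> q +>\<^bsub>A q\<^esub> x"
    unfolding A.cohomology_simps by blast
  then show "cohomology_map A' \<delta>' q (u q) X \<in> carrier (cohomology A' \<delta>' q)"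
    using c maps_cocycles by (simp add: map_class A'.cohomology_simps)
  { fix Y assume "Y \<in> carrier (cohomology A \<delta> q)"
    then obtain y where y: "y \<in> cocycles A \<delta> q" "Y = coboundaries A \<delta> q +>\<^bsub>A q\<^esub> y"
      unfolding A.cohomology_simps by blast
    show "cohomology_map A' \<delta>' q (u q) (X \<oplus>\<^bsub>cohomology A \<delta> q\<^esub> Y)
      = cohomology_map A' \<delta>' q (u q) X \<oplus>\<^bsub>cohomology A' \<delta>' q\<^esub> cohomology_map A' \<delta>' q (u q) Y"
      using x y c by (simp add: A.class_add map_class ops A'.class_add linear_mapsD[OF lin]) }
  { fix k assume "k \<in> carrier K"
    then show "cohomology_map A' \<delta>' q (u q) (k \<odot>\<^bsub>cohomology A \<delta> q\<^esub> X)
      = k \<odot>\<^bsub>cohomology A' \<delta>' q\<^esub> cohomology_map A' \<delta>' q (u q) X"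
      using x c by (simp add: A.class_smult map_class ops A'.class_smult linear_mapsD[OF lin]) }
qed

end

text \<open>Being inverse to each other up to coboundaries is all that a pair of homotopy inverses
  contributes to cohomology.\<close>

lemma cohomology_map_bij:
  assumes "cochain_map K A \<delta> A' \<delta>' u" "cochain_map K A' \<delta>' A \<delta> v"
    and vu: "\<And>x. x \<in> cocycles A \<delta> q \<Longrightarrow> v q (u q x) \<ominus>\<^bsub>A q\<^esub> x \<in> coboundaries A \<delta> q"
    and uv: "\<And>x. x \<in> cocycles A' \<delta>' q \<Longrightarrow> u q (v q x) \<ominus>\<^bsub>A' q\<^esub> x \<in> coboundaries A' \<delta>' q"
  shows "bij_betw (cohomology_map A' \<delta>' q (u q)) (carrier (cohomology A \<delta> q)) (carrier (cohomology A' \<delta>' q))"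
proof -
  interpret U: cochain_map K A \<delta> A' \<delta>' u by fact
  interpret V: cochain_map K A' \<delta>' A \<delta> v by fact
  note c = U.A.cocycles_carrier U.A'.cocycles_carrier
    linear_mapsD(1)[OF U.lin] linear_mapsD(1)[OF V.lin]
  show ?thesis
    by (rule bij_betw_byWitness[where f' = "cohomology_map A \<delta> q (v q)"])
      (use vu uv c in \<open>auto simp: U.A.cohomology_simps U.A'.cohomology_simps U.map_class V.map_class
         U.A.class_eq_iff U.A'.class_eq_iff intro: U.maps_cocycles V.maps_cocycles\<close>)
qed

section \<open>Comparison of injective resolutions\<close>

definition operator_module :: "('k, 'm) ring_scheme \<Rightarrow> 's set \<Rightarrow> ('k, 'v, 's) opmod \<Rightarrow> bool" where
  "operator_module K S M \<longleftrightarrow> module K M \<and> (\<forall>s \<in> S. act M s \<in> linear_maps K M M)"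

lemma operator_moduleD:
  assumes "operator_module K S M"
  shows "module K M" and "s \<in> S \<Longrightarrow> act M s \<in> linear_maps K M M"
    and "s \<in> S \<Longrightarrow> x \<in> carrier M \<Longrightarrow> act M s x \<in> carrier M"
  using assms by (auto simp: operator_module_def linear_maps_def)

lemma op_homI:
  assumes "f \<in> linear_maps K M N"
    and "\<And>s x. s \<in> S \<Longrightarrow> x \<in> carrier M \<Longrightarrow> f (act M s x) = act N s (f x)"
  shows "f \<in> op_hom K S M N"
  using assms by (simp add: op_hom_def)

lemma op_homD:
  assumes "f \<in> op_hom K S M N"
  shows "f \<in> linear_maps K M N" and "x \<in> carrier M \<Longrightarrow> f x \<in> carrier N"
    and "s \<in> S \<Longrightarrow> x \<in> carrier M \<Longrightarrow> f (act M s x) = act N s (f x)"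
  using assms by (auto simp: op_hom_def linear_maps_def)

lemma op_hom_comp:
  assumes "f \<in> op_hom K S L M" "g \<in> op_hom K S M N"
  shows "(\<lambda>x. g (f x)) \<in> op_hom K S L N"
  using assms by (auto simp: op_hom_def linear_maps_def Pi_iff)

lemma op_hom_id: "(\<lambda>x. x) \<in> op_hom K S M M"
  by (simp add: op_hom_def linear_maps_def)

lemma op_hom_diff:
  assumes N: "operator_module K S N" and f: "f \<in> op_hom K S M N" and g: "g \<in> op_hom K S M N"
  shows "(\<lambda>x. f x \<ominus>\<^bsub>N\<^esub> g x) \<in> op_hom K S M N"
proof -
  note NM = operator_moduleD(1)[OF N]
  interpret N: module K N by (rule NM)
  note fg = op_homD(2)[OF f] op_homD(2)[OF g] op_homD(3)[OF f] op_homD(3)[OF g]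
    linear_mapsD[OF op_homD(1)[OF f]] linear_mapsD[OF op_homD(1)[OF g]]
  show ?thesis
  proof (intro op_homI linear_mapsI)
    fix x y assume "x \<in> carrier M" "y \<in> carrier M"
    then show "f (x \<oplus>\<^bsub>M\<^esub> y) \<ominus>\<^bsub>N\<^esub> g (x \<oplus>\<^bsub>M\<^esub> y) = f x \<ominus>\<^bsub>N\<^esub> g x \<oplus>\<^bsub>N\<^esub> (f y \<ominus>\<^bsub>N\<^esub> g y)"
      using fg by (simp add: N.minus_eq N.minus_add N.M.a_ac)
  next
    fix k x assume "x \<in> carrier M" "k \<in> carrier K"
    then show "f (k \<odot>\<^bsub>M\<^esub> x) \<ominus>\<^bsub>N\<^esub> g (k \<odot>\<^bsub>M\<^esub> x) = k \<odot>\<^bsub>N\<^esub> (f x \<ominus>\<^bsub>N\<^esub> g x)"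
      using fg by (simp add: N.minus_eq N.smult_r_distr N.smult_r_minus)
  next
    fix s x assume "x \<in> carrier M" "s \<in> S"
    then show "f (act M s x) \<ominus>\<^bsub>N\<^esub> g (act M s x) = act N s (f x \<ominus>\<^bsub>N\<^esub> g x)"
      using fg by (simp add: linear_minus[OF NM NM operator_moduleD(2)[OF N]])
  qed (use fg in auto)
qed

lemma hom_space_simps [simp]:
  "carrier (hom_space K S M N) = op_hom K S M N \<inter> extensional (carrier M)"
  "zero (hom_space K S M N) = (\<lambda>x \<in> carrier M. \<zero>\<^bsub>N\<^esub>)"
  "add (hom_space K S M N) = (\<lambda>f g. \<lambda>x \<in> carrier M. f x \<oplus>\<^bsub>N\<^esub> g x)"
  "smult (hom_space K S M N) = (\<lambda>k f. \<lambda>x \<in> carrier M. k \<odot>\<^bsub>N\<^esub> f x)"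
  by (auto simp: hom_space_def)

lemma op_hom_restrict:
  assumes "operator_module K S M" "f \<in> op_hom K S M N"
  shows "restrict f (carrier M) \<in> op_hom K S M N"
proof -
  interpret M: module K M by (rule operator_moduleD(1)[OF assms(1)])
  show ?thesis
    by (intro op_homI linear_mapsI)
      (use op_homD[OF assms(2)] linear_mapsD[OF op_homD(1)[OF assms(2)]] operator_moduleD(3)[OF assms(1)] in auto)
qed

lemma hom_space_module:
  assumes M: "operator_module K S M" and N: "operator_module K S N"
  shows "module K (hom_space K S M N)"
proof -
  note NM = operator_moduleD(1)[OF N]
  interpret M: module K M by (rule operator_moduleD(1)[OF M])
  interpret N: module K N by (rule NM)
  note H = op_homD(2,3) linear_mapsD[OF op_homD(1)]
  note D = H operator_moduleD(3)[OF M] linear_mapsD[OF operator_moduleD(2)[OF N]]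
  have zero: "(\<lambda>x. \<zero>\<^bsub>N\<^esub>) \<in> op_hom K S M N"
    by (intro op_homI linear_mapsI) (auto simp: linear_zero[OF NM NM operator_moduleD(2)[OF N]])
  have add: "(\<lambda>x. f x \<oplus>\<^bsub>N\<^esub> g x) \<in> op_hom K S M N"
    if "f \<in> op_hom K S M N" "g \<in> op_hom K S M N" for f g
    by (intro op_homI linear_mapsI)
      (use that in \<open>auto simp: H[OF that(1)] H[OF that(2)] D N.smult_r_distr N.M.a_ac\<close>)
  have sm: "(\<lambda>x. k \<odot>\<^bsub>N\<^esub> f x) \<in> op_hom K S M N" if "f \<in> op_hom K S M N" "k \<in> carrier K" for f k
    by (intro op_homI linear_mapsI)
      (use that N.smult_assoc1[symmetric] M.R.m_comm in \<open>auto simp: H[OF that(1)] D N.smult_r_distr\<close>)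
  have neg: "(\<lambda>x. \<ominus>\<^bsub>N\<^esub> f x) \<in> op_hom K S M N" if "f \<in> op_hom K S M N" for f
    by (intro op_homI linear_mapsI)
      (use that in \<open>auto simp: H[OF that] D N.minus_add N.smult_r_minus
         linear_uminus[OF NM NM operator_moduleD(2)[OF N]]\<close>)
  note r = op_hom_restrict[OF M]
  show ?thesis
  proof (rule moduleI)
    show "cring K" by (rule M.R.is_cring)
    show "abelian_group (hom_space K S M N)"
    proof (rule abelian_groupI)
      fix f assume f: "f \<in> carrier (hom_space K S M N)"
      have "\<ominus>\<^bsub>N\<^esub> f x \<oplus>\<^bsub>N\<^esub> f x = \<zero>\<^bsub>N\<^esub>" if "x \<in> carrier M" for x
        using f that op_homD(2)[of f K S M N x] by (simp add: N.l_neg)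
      then show "\<exists>g\<in>carrier (hom_space K S M N). g \<oplus>\<^bsub>hom_space K S M N\<^esub> f = \<zero>\<^bsub>hom_space K S M N\<^esub>"
        using f r[OF neg[of f]] by (intro bexI[of _ "\<lambda>x\<in>carrier M. \<ominus>\<^bsub>N\<^esub> f x"]) (auto intro!: restrict_ext)
      show "\<zero>\<^bsub>hom_space K S M N\<^esub> \<oplus>\<^bsub>hom_space K S M N\<^esub> f = f"
        using f by (auto simp: D fun_eq_iff extensional_def)
    qed (auto simp: D N.M.a_ac intro!: r zero add restrict_ext)
  qed (auto simp: D N.smult_l_distr N.smult_r_distr N.smult_assoc1 fun_eq_iff extensional_def
      intro!: r sm restrict_ext)
qed

lemma post_simps [simp]: "x \<in> carrier Q \<Longrightarrow> post Q u f x = u (f x)"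
  by (simp add: post_def compose_def)

lemma post_extensional [simp]: "post Q u f \<in> extensional (carrier Q)"
  by (simp add: post_def)

lemma post_op_hom:
  assumes "operator_module K S Q" "u \<in> op_hom K S M N" "f \<in> op_hom K S Q M"
  shows "post Q u f \<in> op_hom K S Q N"
  using op_hom_restrict[OF assms(1) op_hom_comp[OF assms(3,2)]]
  by (simp add: post_def compose_def)

lemma post_linear:
  assumes "operator_module K S Q" "u \<in> op_hom K S M N"
  shows "post Q u \<in> linear_maps K (hom_space K S Q M) (hom_space K S Q N)"
proof (rule linear_mapsI)
  note D = op_homD(2) linear_mapsD[OF op_homD(1)[OF assms(2)]]
  fix f g assume "f \<in> carrier (hom_space K S Q M)" "g \<in> carrier (hom_space K S Q M)"
  then show "post Q u (f \<oplus>\<^bsub>hom_space K S Q M\<^esub> g)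
    = post Q u f \<oplus>\<^bsub>hom_space K S Q N\<^esub> post Q u g"
    by (auto simp: post_def compose_def D intro!: restrict_ext)
next
  note D = op_homD(2) linear_mapsD[OF op_homD(1)[OF assms(2)]]
  fix k f assume "f \<in> carrier (hom_space K S Q M)" "k \<in> carrier K"
  then show "post Q u (k \<odot>\<^bsub>hom_space K S Q M\<^esub> f) = k \<odot>\<^bsub>hom_space K S Q N\<^esub> post Q u f"
    by (auto simp: post_def compose_def D intro!: restrict_ext)
qed (auto intro: post_op_hom[OF assms])

text \<open>The properties of a class of objects that the comparison theorem needs: its members are
  vector spaces with linear operators, and it is closed under subobjects, so that the image of a
  morphism is again a test object.\<close>

locale operator_category =
  fixes K :: "('k, 'm) ring_scheme" and S :: "'s set" and Obj :: "('k, 'v, 's) opmod \<Rightarrow> bool"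
  assumes obj_operator: "Obj M \<Longrightarrow> operator_module K S M"
    and obj_sub: "Obj M \<Longrightarrow> submodule N K M \<Longrightarrow> (\<And>s x. s \<in> S \<Longrightarrow> x \<in> N \<Longrightarrow> act M s x \<in> N)
      \<Longrightarrow> Obj (M\<lparr>carrier := N\<rparr>)"
begin

text \<open>The monomorphism on which injectivity is tested is the inclusion of the image of \<open>d\<close>; the map \<open>f\<close>
  factors through this image because it vanishes on the kernel of \<open>d\<close>.\<close>

lemma injective_extension:
  assumes X: "injective_object K S Obj X" and M: "operator_module K S M" and N: "Obj N"
    and d: "d \<in> op_hom K S M N" and f: "f \<in> op_hom K S M X"
    and ker: "\<And>x. x \<in> carrier M \<Longrightarrow> d x = \<zero>\<^bsub>N\<^esub> \<Longrightarrow> f x = \<zero>\<^bsub>X\<^esub>"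
  shows "\<exists>h \<in> op_hom K S N X. \<forall>x \<in> carrier M. h (d x) = f x"
proof -
  note MM = operator_moduleD(1)[OF M] and NM = operator_moduleD(1)[OF obj_operator[OF N]]
  have "Obj X" using X by (simp add: injective_object_def)
  note XM = operator_moduleD(1)[OF obj_operator[OF this]]
  interpret M: module K M by (rule MM)
  interpret N: module K N by (rule NM)
  interpret X: module K X by (rule XM)
  note dD = op_homD[OF d] and fD = op_homD[OF f]
  define A where "A = N\<lparr>carrier := d ` carrier M\<rparr>"
  have A: "Obj A"
    unfolding A_def
    by (rule obj_sub[OF N image_submodule[OF MM NM dD(1) M.carrier_is_submodule]])
      (use dD(3) operator_moduleD(3)[OF M] in \<open>force simp: image_iff\<close>)
  define g where "g y = f (inv_into (carrier M) d y)" for y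
  have g: "g (d x) = f x" if x: "x \<in> carrier M" for x
  proof -
    let ?x = "inv_into (carrier M) d (d x)"
    have x': "?x \<in> carrier M" "d ?x = d x" using x by (auto intro: inv_into_into f_inv_into_f)
    then have "d (?x \<ominus>\<^bsub>M\<^esub> x) = \<zero>\<^bsub>N\<^esub>"
      using x dD(2) by (simp add: linear_minus[OF MM NM dD(1)] N.minus_eq N.r_neg)
    then have "f (?x \<ominus>\<^bsub>M\<^esub> x) = \<zero>\<^bsub>X\<^esub>" by (rule ker[rotated]) (use x x' in simp)
    then have "f ?x \<ominus>\<^bsub>X\<^esub> f x = \<zero>\<^bsub>X\<^esub>"
      using x x' linear_minus[OF MM XM fD(1)] by simp
    then show ?thesis using x x' fD(2) minus_eq_zero_iff[OF XM] by (simp add: g_def)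
  qed
  have "g \<in> op_hom K S A X"
  proof (intro op_homI linear_mapsI)
    fix y z assume "y \<in> carrier A" "z \<in> carrier A"
    then obtain u v where uv: "u \<in> carrier M" "v \<in> carrier M" "y = d u" "z = d v" by (auto simp: A_def)
    then have "y \<oplus>\<^bsub>A\<^esub> z = d (u \<oplus>\<^bsub>M\<^esub> v)" by (simp add: A_def linear_mapsD[OF dD(1)])
    then show "g (y \<oplus>\<^bsub>A\<^esub> z) = g y \<oplus>\<^bsub>X\<^esub> g z" using uv g by (simp add: linear_mapsD[OF fD(1)])
  next
    fix k y assume "k \<in> carrier K" "y \<in> carrier A"
    then obtain u where u: "u \<in> carrier M" "y = d u" by (auto simp: A_def)
    then have "k \<odot>\<^bsub>A\<^esub> y = d (k \<odot>\<^bsub>M\<^esub> u)" using \<open>k \<in> _\<close> by (simp add: A_def linear_mapsD[OF dD(1)])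
    then show "g (k \<odot>\<^bsub>A\<^esub> y) = k \<odot>\<^bsub>X\<^esub> g y" using u g \<open>k \<in> _\<close> by (simp add: linear_mapsD[OF fD(1)])
  next
    fix s y assume "s \<in> S" "y \<in> carrier A"
    then obtain u where u: "u \<in> carrier M" "y = d u" by (auto simp: A_def)
    then have "act A s y = d (act M s u)" using \<open>s \<in> S\<close> by (simp add: A_def dD(3))
    then show "g (act A s y) = act X s (g y)" using u g \<open>s \<in> S\<close> fD(3) operator_moduleD(3)[OF M] by simp
  qed (auto simp: A_def g fD(2))
  moreover have "(\<lambda>x. x) \<in> op_hom K S A N"
    by (intro op_homI linear_mapsI) (auto simp: A_def dD(2))
  ultimately obtain h where "h \<in> op_hom K S N X" "\<forall>a \<in> carrier A. h a = g a"
    using X A N unfolding injective_object_def by (metis inj_on_def)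
  then show ?thesis using g by (auto simp: A_def)
qed

lemma resolutionD:
  assumes "injective_resolution K S Obj W \<eta> I d"
  shows "injective_object K S Obj (I n)" "Obj (I n)" "operator_module K S (I n)" "module K (I n)"
    and "\<eta> \<in> op_hom K S W (I 0)" "inj_on \<eta> (carrier W)" "d n \<in> op_hom K S (I n) (I (Suc n))"
    and "cocycles I d 0 = \<eta> ` carrier W" "cocycles I d (Suc n) = coboundaries I d (Suc n)"
    and "y \<in> carrier W \<Longrightarrow> d 0 (\<eta> y) = \<zero>\<^bsub>I (Suc 0)\<^esub>"
    and "x \<in> carrier (I n) \<Longrightarrow> d (Suc n) (d n x) = \<zero>\<^bsub>I (Suc (Suc n))\<^esub>"
proof -
  note * = assms[unfolded injective_resolution_def]
  show 1: "injective_object K S Obj (I n)" "\<eta> \<in> op_hom K S W (I 0)" "inj_on \<eta> (carrier W)"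
    "d n \<in> op_hom K S (I n) (I (Suc n))" "cocycles I d 0 = \<eta> ` carrier W"
    "cocycles I d (Suc n) = coboundaries I d (Suc n)"
    using * by auto
  then show 2: "Obj (I n)" by (simp add: injective_object_def)
  show "operator_module K S (I n)" using obj_operator[OF 2] .
  then show "module K (I n)" by (rule operator_moduleD)
  show "d 0 (\<eta> y) = \<zero>\<^bsub>I (Suc 0)\<^esub>" if "y \<in> carrier W"
    using 1(5) that by (auto simp: cocycles_def)
  show "d (Suc n) (d n x) = \<zero>\<^bsub>I (Suc (Suc n))\<^esub>" if "x \<in> carrier (I n)"
    using 1(6) that by (auto simp: cocycles_def coboundaries_def)
qed

text \<open>The comparison theorem, existence: the components are built one after the other, and each
  one is composed with the differential of the target to a map that kills cocycles, hence extends
  along the differential of the source.\<close>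

lemma comparison_exists:
  assumes I: "injective_resolution K S Obj W \<eta> I d" and J: "injective_resolution K S Obj W \<theta> J \<epsilon>"
    and W: "operator_module K S W"
  shows "\<exists>u. (\<forall>n. u n \<in> op_hom K S (I n) (J n)) \<and>
    (\<forall>n. \<forall>x \<in> carrier (I n). u (Suc n) (d n x) = \<epsilon> n (u n x)) \<and> (\<forall>x \<in> carrier W. u 0 (\<eta> x) = \<theta> x)"
proof -
  note ID = resolutionD[OF I] and JD = resolutionD[OF J]
  \<comment> \<open>the last conjunct is what lets the next component be built by extension\<close>
  define P where "P n f \<longleftrightarrow> f \<in> op_hom K S (I n) (J n) \<and> (n = 0 \<longrightarrow> (\<forall>x \<in> carrier W. f (\<eta> x) = \<theta> x)) \<and>
     (\<forall>x \<in> cocycles I d n. \<epsilon> n (f x) = \<zero>\<^bsub>J (Suc n)\<^esub>)" for n f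
  have "\<exists>f. \<forall>n. P n (f n) \<and> (\<forall>x \<in> carrier (I n). f (Suc n) (d n x) = \<epsilon> n (f n x))"
  proof (rule dependent_nat_choice)
    have "\<theta> x = \<zero>\<^bsub>J 0\<^esub>" if "x \<in> carrier W" "\<eta> x = \<zero>\<^bsub>I 0\<^esub>" for x
    proof -
      have "\<eta> \<zero>\<^bsub>W\<^esub> = \<zero>\<^bsub>I 0\<^esub>" "\<theta> \<zero>\<^bsub>W\<^esub> = \<zero>\<^bsub>J 0\<^esub>"
        using linear_zero[OF operator_moduleD(1)[OF W]] ID(4) JD(4) op_homD(1) ID(5) JD(5) by blast+
      then show ?thesis using that ID(6) submodule_zero[OF operator_moduleD(1)[OF W]
          module.carrier_is_submodule[OF operator_moduleD(1)[OF W]]] by (metis inj_onD)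
    qed
    then obtain f where "f \<in> op_hom K S (I 0) (J 0)" "\<forall>x \<in> carrier W. f (\<eta> x) = \<theta> x"
      using injective_extension[OF JD(1) W ID(2) ID(5) JD(5)] by blast
    moreover from this have "\<epsilon> 0 (f x) = \<zero>\<^bsub>J (Suc 0)\<^esub>" if "x \<in> cocycles I d 0" for x
      using that JD(10) unfolding ID(8) by auto
    ultimately show "\<exists>f. P 0 f" unfolding P_def by blast
  next
    fix f n assume f: "P n f"
    then have fh: "f \<in> op_hom K S (I n) (J n)" and f0: "\<And>x. x \<in> cocycles I d n \<Longrightarrow> \<epsilon> n (f x) = \<zero>\<^bsub>J (Suc n)\<^esub>"
      by (auto simp: P_def)
    obtain h where h: "h \<in> op_hom K S (I (Suc n)) (J (Suc n))"
      "\<And>x. x \<in> carrier (I n) \<Longrightarrow> h (d n x) = \<epsilon> n (f x)"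
      using injective_extension[OF JD(1) ID(3) ID(2) ID(7) op_hom_comp[OF fh JD(7)]] f0
      by (auto simp: cocycles_def)
    have "\<epsilon> (Suc n) (h x) = \<zero>\<^bsub>J (Suc (Suc n))\<^esub>" if "x \<in> cocycles I d (Suc n)" for x
      using that h(2) JD(11) op_homD(2)[OF fh] unfolding ID(9) by (auto simp: coboundaries_def)
    then show "\<exists>g. P (Suc n) g \<and> (\<forall>x \<in> carrier (I n). g (d n x) = \<epsilon> n (f x))"
      using h by (auto simp: P_def)
  qed
  then obtain f where "\<And>n. P n (f n)" "\<And>n x. x \<in> carrier (I n) \<Longrightarrow> f (Suc n) (d n x) = \<epsilon> n (f n x)"
    by blast
  then show ?thesis by (intro exI[of _ f]) (simp add: P_def)
qed

text \<open>The comparison theorem, uniqueness: \<open>w\<close> is a difference of two comparison maps.  Once \<open>s n\<close> is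
  found, \<open>w (Suc n) - \<epsilon> n s n\<close> vanishes on the image of \<open>d n\<close>, which is the kernel of \<open>d (Suc n)\<close>, so it
  extends along \<open>d (Suc n)\<close>.\<close>

lemma null_homotopic:
  assumes I: "injective_resolution K S Obj W \<eta> I d" and J: "injective_resolution K S Obj W \<theta> J \<epsilon>"
    and w: "\<And>n. w n \<in> op_hom K S (I n) (J n)"
    and chain: "\<And>n x. x \<in> carrier (I n) \<Longrightarrow> w (Suc n) (d n x) = \<epsilon> n (w n x)"
    and w0: "\<And>x. x \<in> carrier W \<Longrightarrow> w 0 (\<eta> x) = \<zero>\<^bsub>J 0\<^esub>"
  shows "\<exists>s. (\<forall>n. s n \<in> op_hom K S (I (Suc n)) (J n)) \<and>
    (\<forall>x \<in> carrier (I 0). w 0 x = s 0 (d 0 x)) \<and>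
    (\<forall>n. \<forall>x \<in> carrier (I (Suc n)). w (Suc n) x = s (Suc n) (d (Suc n) x) \<oplus>\<^bsub>J (Suc n)\<^esub> \<epsilon> n (s n x))"
proof -
  note ID = resolutionD[OF I] and JD = resolutionD[OF J]
  define P where "P n s \<longleftrightarrow> s \<in> op_hom K S (I (Suc n)) (J n) \<and>
     (n = 0 \<longrightarrow> (\<forall>x \<in> carrier (I 0). w 0 x = s (d 0 x))) \<and>
     (\<forall>x \<in> carrier (I n). \<epsilon> n (w n x) = \<epsilon> n (s (d n x)))" for n s
  have "\<exists>s. \<forall>n. P n (s n) \<and>
    (\<forall>x \<in> carrier (I (Suc n)). w (Suc n) x = s (Suc n) (d (Suc n) x) \<oplus>\<^bsub>J (Suc n)\<^esub> \<epsilon> n (s n x))"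
  proof (rule dependent_nat_choice)
    have "w 0 x = \<zero>\<^bsub>J 0\<^esub>" if "x \<in> carrier (I 0)" "d 0 x = \<zero>\<^bsub>I (Suc 0)\<^esub>" for x
    proof -
      have "x \<in> cocycles I d 0" using that by (simp add: cocycles_def)
      then show ?thesis unfolding ID(8) using w0 by auto
    qed
    then obtain s where "s \<in> op_hom K S (I (Suc 0)) (J 0)" "\<forall>x \<in> carrier (I 0). s (d 0 x) = w 0 x"
      using injective_extension[OF JD(1) ID(3) ID(2) ID(7) w] by blast
    then show "\<exists>s. P 0 s" by (auto simp: P_def)
  next
    fix s n assume "P n s"
    then have sh: "s \<in> op_hom K S (I (Suc n)) (J n)"
      and s: "\<And>x. x \<in> carrier (I n) \<Longrightarrow> \<epsilon> n (w n x) = \<epsilon> n (s (d n x))"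
      by (auto simp: P_def)
    interpret J: module K "J (Suc n)" by (rule JD(4))
    let ?f = "\<lambda>x. w (Suc n) x \<ominus>\<^bsub>J (Suc n)\<^esub> \<epsilon> n (s x)"
    have f: "?f \<in> op_hom K S (I (Suc n)) (J (Suc n))"
      by (rule op_hom_diff[OF JD(3) w op_hom_comp[OF sh JD(7)]])
    note cl = op_homD(2)[OF w] op_homD(2)[OF sh] op_homD(2)[OF JD(7)] op_homD(2)[OF ID(7)]
    have "?f x = \<zero>\<^bsub>J (Suc n)\<^esub>" if "x \<in> carrier (I (Suc n))" "d (Suc n) x = \<zero>\<^bsub>I (Suc (Suc n))\<^esub>" for x
    proof -
      have "x \<in> coboundaries I d (Suc n)" using that ID(9) by (auto simp: cocycles_def)
      then obtain y where "y \<in> carrier (I n)" "x = d n y" by (auto simp: coboundaries_def)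
      then show ?thesis using chain s cl by (simp add: J.minus_eq J.r_neg)
    qed
    then obtain h where h: "h \<in> op_hom K S (I (Suc (Suc n))) (J (Suc n))"
      "\<And>x. x \<in> carrier (I (Suc n)) \<Longrightarrow> h (d (Suc n) x) = ?f x"
      using injective_extension[OF JD(1) ID(3) ID(2) ID(7) f] by blast
    have 1: "w (Suc n) x = h (d (Suc n) x) \<oplus>\<^bsub>J (Suc n)\<^esub> \<epsilon> n (s x)" if "x \<in> carrier (I (Suc n))" for x
      using h(2) that cl by (simp add: J.minus_eq J.M.a_assoc J.l_neg)
    have 2: "\<epsilon> (Suc n) (w (Suc n) x) = \<epsilon> (Suc n) (h (d (Suc n) x))" if x: "x \<in> carrier (I (Suc n))" for x
    proof -
      interpret J': module K "J (Suc (Suc n))" by (rule JD(4))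
      have "h (d (Suc n) x) \<in> carrier (J (Suc n))" using x cl op_homD(2)[OF h(1)] by blast
      then show ?thesis using 1[OF x] x cl JD(11)[of "s x" n]
        by (simp add: linear_mapsD[OF op_homD(1)[OF JD(7)]])
    qed
    show "\<exists>y. P (Suc n) y \<and>
      (\<forall>x \<in> carrier (I (Suc n)). w (Suc n) x = y (d (Suc n) x) \<oplus>\<^bsub>J (Suc n)\<^esub> \<epsilon> n (s x))"
      using h(1) 1 2 by (auto simp: P_def)
  qed
  then obtain s where "\<And>n. P n (s n)" "\<And>n x. x \<in> carrier (I (Suc n)) \<Longrightarrow>
    w (Suc n) x = s (Suc n) (d (Suc n) x) \<oplus>\<^bsub>J (Suc n)\<^esub> \<epsilon> n (s n x)"
    by blast
  then show ?thesis by (intro exI[of _ s]) (simp add: P_def)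
qed

lemma hom_complex:
  assumes Q: "operator_module K S Q" and I: "injective_resolution K S Obj W \<eta> I d"
  shows "cochain_complex K (\<lambda>n. hom_space K S Q (I n)) (\<lambda>n. post Q (d n))"
proof (rule cochain_complex.intro)
  note ID = resolutionD[OF I]
  show "module K (hom_space K S Q (I n))" for n by (rule hom_space_module[OF Q ID(3)])
  show "post Q (d n) \<in> linear_maps K (hom_space K S Q (I n)) (hom_space K S Q (I (Suc n)))" for n
    by (rule post_linear[OF Q ID(7)])
  show "post Q (d (Suc n)) (post Q (d n) x) = \<zero>\<^bsub>hom_space K S Q (I (Suc (Suc n)))\<^esub>"
    if "x \<in> carrier (hom_space K S Q (I n))" for x n
    using that by (auto simp: post_def compose_def ID(11) op_homD(2) intro!: restrict_ext)
qed

lemma hom_cochain_map: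
  assumes Q: "operator_module K S Q"
    and I: "injective_resolution K S Obj W \<eta> I d" and J: "injective_resolution K S Obj W \<theta> J \<epsilon>"
    and u: "\<And>n. u n \<in> op_hom K S (I n) (J n)"
    and chain: "\<And>n x. x \<in> carrier (I n) \<Longrightarrow> u (Suc n) (d n x) = \<epsilon> n (u n x)"
  shows "cochain_map K (\<lambda>n. hom_space K S Q (I n)) (\<lambda>n. post Q (d n))
     (\<lambda>n. hom_space K S Q (J n)) (\<lambda>n. post Q (\<epsilon> n)) (\<lambda>n. post Q (u n))"
  by (intro cochain_map.intro hom_complex[OF Q I] hom_complex[OF Q J] cochain_map_axioms.intro
      post_linear[OF Q u])
    (auto simp: post_def compose_def chain op_homD(2) intro!: restrict_ext)

text \<open>The chain map \<open>t - id\<close> vanishes on the resolved object, hence is null-homotopic; on a cocycle \<open>f\<close> of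
  the \<open>Hom\<close> complex the half of the homotopy that starts with \<open>d\<close> gives zero and the other half is a
  coboundary.\<close>

lemma homotopic_to_identity:
  assumes Q: "operator_module K S Q" and I: "injective_resolution K S Obj W \<eta> I d"
    and t: "\<And>n. t n \<in> op_hom K S (I n) (I n)"
    and chain: "\<And>n x. x \<in> carrier (I n) \<Longrightarrow> t (Suc n) (d n x) = d n (t n x)"
    and t0: "\<And>x. x \<in> carrier W \<Longrightarrow> t 0 (\<eta> x) = \<eta> x"
    and f: "f \<in> cocycles (\<lambda>n. hom_space K S Q (I n)) (\<lambda>n. post Q (d n)) q"
  shows "post Q (t q) f \<ominus>\<^bsub>hom_space K S Q (I q)\<^esub> f
    \<in> coboundaries (\<lambda>n. hom_space K S Q (I n)) (\<lambda>n. post Q (d n)) q"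
proof -
  note ID = resolutionD[OF I]
  interpret H: cochain_complex K "\<lambda>n. hom_space K S Q (I n)" "\<lambda>n. post Q (d n)"
    by (rule hom_complex[OF Q I])
  interpret Hq: module K "hom_space K S Q (I q)" by (rule H.mod)
  define w where "w n x = t n x \<ominus>\<^bsub>I n\<^esub> x" for n x
  have w: "w n \<in> op_hom K S (I n) (I n)" for n
    unfolding w_def by (rule op_hom_diff[OF ID(3) t op_hom_id])
  have cw: "w (Suc n) (d n x) = d n (w n x)" if "x \<in> carrier (I n)" for n x
    unfolding w_def using that chain
    by (simp add: linear_minus[OF ID(4) ID(4) op_homD(1)[OF ID(7)]] op_homD(2)[OF t])
  have w0: "w 0 (\<eta> x) = \<zero>\<^bsub>I 0\<^esub>" if "x \<in> carrier W" for x
    using that t0 op_homD(2)[OF ID(5)] ID(4)[of 0]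
    by (simp add: w_def abelian_group.minus_eq abelian_group.r_neg module_abelian)
  obtain s where s: "\<And>n. s n \<in> op_hom K S (I (Suc n)) (I n)"
    "\<And>x. x \<in> carrier (I 0) \<Longrightarrow> w 0 x = s 0 (d 0 x)"
    "\<And>n x. x \<in> carrier (I (Suc n)) \<Longrightarrow> w (Suc n) x = s (Suc n) (d (Suc n) x) \<oplus>\<^bsub>I (Suc n)\<^esub> d n (s n x)"
    using null_homotopic[OF I I w cw w0] by blast
  have df: "d q (f x) = \<zero>\<^bsub>I (Suc q)\<^esub>" if "x \<in> carrier Q" for x
    using f that by (auto simp: cocycles_def fun_eq_iff) (metis post_simps)
  have fh: "f \<in> op_hom K S Q (I q)" "f \<in> extensional (carrier Q)"
    using f by (auto simp: cocycles_def)
  have eq: "post Q (t q) f \<ominus>\<^bsub>hom_space K S Q (I q)\<^esub> f = post Q (w q) f"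
  proof -
    interpret Iq: module K "I q" by (rule ID(4))
    have "post Q (w q) f \<oplus>\<^bsub>hom_space K S Q (I q)\<^esub> f = post Q (t q) f"
      using op_homD(2)[OF fh(1)] op_homD(2)[OF t]
      by (auto simp: w_def Iq.minus_eq Iq.M.a_assoc Iq.l_neg post_def compose_def intro!: restrict_ext)
    then show ?thesis
      using post_op_hom[OF Q w fh(1)] post_op_hom[OF Q t fh(1)] fh
      by (metis Hq.add.inv_solve_right Hq.minus_eq IntI hom_space_simps(1) post_extensional)
  qed
  show ?thesis
  proof (cases q)
    case 0
    have "post Q (w q) f = \<zero>\<^bsub>hom_space K S Q (I q)\<^esub>"
      using s(2) df op_homD(2)[OF fh(1)] linear_zero[OF ID(4) ID(4) op_homD(1)[OF s(1)]] 0
      by (auto simp: post_def compose_def intro!: restrict_ext)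
    then show ?thesis using 0 eq by (simp add: coboundaries_def)
  next
    case (Suc p)
    interpret Iq: module K "I q" by (rule ID(4))
    have "post Q (w q) f = post Q (d p) (post Q (s p) f)"
      using s(3) df op_homD(2)[OF fh(1)] linear_zero[OF ID(4) ID(4) op_homD(1)[OF s(1)]] Suc
        op_homD(2)[OF s(1)] op_homD(2)[OF ID(7)] Iq.l_zero
      by (auto simp: post_def compose_def intro!: restrict_ext)
    moreover have "post Q (s p) f \<in> carrier (hom_space K S Q (I p))"
      using post_op_hom[OF Q s(1)] fh Suc by auto
    ultimately show ?thesis using eq Suc by (auto simp: coboundaries_def)
  qed
qed

text \<open>A comparison map \<open>v\<close> in the other direction exists, and both composites of \<open>u\<close> and \<open>v\<close> are
  comparison maps of a resolution with itself, hence homotopic to the identity.\<close>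

theorem comparison_bij:
  assumes Q: "operator_module K S Q" and W: "operator_module K S W"
    and I: "injective_resolution K S Obj W \<eta> I d" and J: "injective_resolution K S Obj W \<theta> J \<epsilon>"
    and u: "\<And>n. u n \<in> op_hom K S (I n) (J n)"
    and chain: "\<And>n x. x \<in> carrier (I n) \<Longrightarrow> u (Suc n) (d n x) = \<epsilon> n (u n x)"
    and u0: "\<And>x. x \<in> carrier W \<Longrightarrow> u 0 (\<eta> x) = \<theta> x"
  shows "bij_betw (cohomology_map (\<lambda>n. hom_space K S Q (J n)) (\<lambda>n. post Q (\<epsilon> n)) q (post Q (u q)))
    (carrier (cohomology (\<lambda>n. hom_space K S Q (I n)) (\<lambda>n. post Q (d n)) q))
    (carrier (cohomology (\<lambda>n. hom_space K S Q (J n)) (\<lambda>n. post Q (\<epsilon> n)) q))"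
proof -
  obtain v where v: "\<And>n. v n \<in> op_hom K S (J n) (I n)"
    "\<And>n x. x \<in> carrier (J n) \<Longrightarrow> v (Suc n) (\<epsilon> n x) = d n (v n x)"
    "\<And>x. x \<in> carrier W \<Longrightarrow> v 0 (\<theta> x) = \<eta> x"
    using comparison_exists[OF J I W] by blast
  have vu: "post Q (\<lambda>x. v q (u q x)) f = post Q (v q) (post Q (u q) f)"
    and uv: "post Q (\<lambda>x. u q (v q x)) f = post Q (u q) (post Q (v q) f)" for f
    by (auto simp: post_def compose_def intro!: restrict_ext)
  show ?thesis
  proof (rule cohomology_map_bij[OF hom_cochain_map[OF Q I J u chain] hom_cochain_map[OF Q J I v(1,2)]])
    fix f assume "f \<in> cocycles (\<lambda>n. hom_space K S Q (I n)) (\<lambda>n. post Q (d n)) q"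
    then show "post Q (v q) (post Q (u q) f) \<ominus>\<^bsub>hom_space K S Q (I q)\<^esub> f
      \<in> coboundaries (\<lambda>n. hom_space K S Q (I n)) (\<lambda>n. post Q (d n)) q"
      unfolding vu[symmetric]
      by (intro homotopic_to_identity[OF Q I, where t = "\<lambda>n x. v n (u n x)"] op_hom_comp[OF u v(1)])
        (auto simp: chain u0 v op_homD(2)[OF u])
  next
    fix f assume "f \<in> cocycles (\<lambda>n. hom_space K S Q (J n)) (\<lambda>n. post Q (\<epsilon> n)) q"
    then show "post Q (u q) (post Q (v q) f) \<ominus>\<^bsub>hom_space K S Q (J q)\<^esub> f
      \<in> coboundaries (\<lambda>n. hom_space K S Q (J n)) (\<lambda>n. post Q (\<epsilon> n)) q"
      unfolding uv[symmetric]
      by (intro homotopic_to_identity[OF Q J, where t = "\<lambda>n x. u n (v n x)"] op_hom_comp[OF v(1) u])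
        (auto simp: chain u0 v op_homD(2)[OF v(1)])
  qed
qed

end

section \<open>Modules over the halo algebra\<close>

lemma with_act_simps [simp]:
  "carrier (with_act M a) = carrier M" "zero (with_act M a) = zero M" "add (with_act M a) = add M"
  "smult (with_act M a) = smult M" "act (with_act M a) = a"
  by (simp_all add: with_act_def)

lemma linear_maps_cong:
  assumes "carrier M = carrier M'" "add M = add M'" "smult M = smult M'"
    and "carrier N = carrier N'" "add N = add N'" "smult N = smult N'"
  shows "linear_maps K M N = linear_maps K M' N'"
  using assms by (simp add: linear_maps_def)

lemma module_cong:
  assumes "module K M" "carrier M = carrier M'" "add M = add M'" "zero M = zero M'" "smult M = smult M'"
  shows "module K M'"
proof -
  interpret M: module K M by fact
  note eq = assms(2-5)[symmetric]
  show ?thesis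
  proof (rule moduleI)
    show "cring K" by (rule M.R.is_cring)
    show "abelian_group M'"
      by (rule abelian_groupI)
        (auto simp: eq M.M.a_ac intro: M.l_neg)
  qed (auto simp: eq M.smult_l_distr M.smult_r_distr M.smult_assoc1)
qed

lemma module_with_act: "module K M \<Longrightarrow> module K (with_act M a)"
  by (erule module_cong) simp_all

definition single :: "('k, 'm) ring_scheme \<Rightarrow> 'k \<Rightarrow> 'e list \<Rightarrow> 'e list \<Rightarrow> 'k" where
  "single K k u = (\<lambda>w. if w = u then k else \<zero>\<^bsub>K\<^esub>)"

lemma free_gen_single: "free_gen K \<alpha> = single K \<one>\<^bsub>K\<^esub> [\<alpha>]"
  by (simp add: free_gen_def single_def)

lemma free_algebra_simps [simp]:
  "carrier (free_algebra K E) = {f. (\<forall>w. f w \<in> carrier K) \<and> (\<forall>w. w \<notin> lists E \<longrightarrow> f w = \<zero>\<^bsub>K\<^esub>) \<and>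
                   finite {w. f w \<noteq> \<zero>\<^bsub>K\<^esub>}}"
  "zero (free_algebra K E) = (\<lambda>w. \<zero>\<^bsub>K\<^esub>)"
  "add (free_algebra K E) = (\<lambda>f g w. f w \<oplus>\<^bsub>K\<^esub> g w)"
  "one (free_algebra K E) = single K \<one>\<^bsub>K\<^esub> []"
  by (auto simp: free_algebra_def single_def)

lemma free_algebra_mult:
  "(f \<otimes>\<^bsub>free_algebra K E\<^esub> g) w = (\<Oplus>\<^bsub>K\<^esub>i \<in> {..length w}. f (take i w) \<otimes>\<^bsub>K\<^esub> g (drop i w))"
  by (simp add: free_algebra_def)

context cring
begin

abbreviation Fr where "Fr E \<equiv> free_algebra R E"

lemma free_carrierD: "f \<in> carrier (Fr E) \<Longrightarrow> f w \<in> carrier R"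
  by simp

lemma single_carrier: "k \<in> carrier R \<Longrightarrow> u \<in> lists E \<Longrightarrow> single R k u \<in> carrier (Fr E)"
  by (auto simp: single_def intro: finite_subset[of _ "{u}"])

lemma free_add_carrier: "f \<in> carrier (Fr E) \<Longrightarrow> g \<in> carrier (Fr E) \<Longrightarrow> f \<oplus>\<^bsub>Fr E\<^esub> g \<in> carrier (Fr E)"
  by (auto intro: finite_subset[of _ "{w. f w \<noteq> \<zero>} \<union> {w. g w \<noteq> \<zero>}"])

text \<open>Elements of the free algebra are sums of multiples of words, so multilinear identities such as
  associativity need only be checked on multiples of words.\<close>

lemma free_induct [consumes 1, case_names single add]:
  assumes "f \<in> carrier (Fr E)"
    and single: "\<And>k u. k \<in> carrier R \<Longrightarrow> u \<in> lists E \<Longrightarrow> P (single R k u)"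
    and add: "\<And>f g. f \<in> carrier (Fr E) \<Longrightarrow> g \<in> carrier (Fr E) \<Longrightarrow> P f \<Longrightarrow> P g \<Longrightarrow> P (f \<oplus>\<^bsub>Fr E\<^esub> g)"
  shows "P f"
proof -
  define A where "A = {w. f w \<noteq> \<zero>}"
  have "finite A" using assms(1) by (simp add: A_def)
  then show ?thesis using assms(1) A_def
  proof (induction A arbitrary: f rule: finite_induct)
    case empty
    then have "f = single R \<zero> []" by (auto simp: single_def)
    then show ?case using single[of \<zero> "[]"] by simp
  next
    case (insert u A)
    define g where "g = f(u := \<zero>)"
    have supp: "{w. g w \<noteq> \<zero>} = A" using insert.hyps insert.prems(2) by (auto simp: g_def)
    have g: "g \<in> carrier (Fr E)" using insert.prems(1) supp insert.hyps by (auto simp: g_def)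
    have u: "u \<in> lists E" "f u \<in> carrier R" using insert.prems by auto
    have "f = single R (f u) u \<oplus>\<^bsub>Fr E\<^esub> g"
      using insert.prems(1) u by (auto simp: single_def g_def fun_eq_iff)
    then show ?case
      using add[OF single_carrier[OF u(2,1)] g single[OF u(2,1)]] insert.IH[OF g] supp by simp
  qed
qed

lemma free_mult_single:
  assumes "k \<in> carrier R" "l \<in> carrier R"
  shows "single R k u \<otimes>\<^bsub>Fr E\<^esub> single R l v = single R (k \<otimes> l) (u @ v)"
proof
  fix w
  let ?t = "\<lambda>i. single R k u (take i w) \<otimes> single R l v (drop i w)"
  have t: "?t i = (if i = length u then single R (k \<otimes> l) (u @ v) w else \<zero>)" if "i \<le> length w" for i
  proof (cases "take i w = u \<and> drop i w = v")
    case True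
    then have "w = u @ v" "i = length u" using that by (auto simp: min_def)
    then show ?thesis by (simp add: single_def)
  next
    case False
    then have "?t i = \<zero>" using assms by (auto simp: single_def)
    moreover have "w \<noteq> u @ v" if "i = length u" using False that by auto
    ultimately show ?thesis by (auto simp: single_def)
  qed
  have "(single R k u \<otimes>\<^bsub>Fr E\<^esub> single R l v) w
    = (\<Oplus>i \<in> {..length w}. if length u = i then single R (k \<otimes> l) (u @ v) w else \<zero>)"
    unfolding free_algebra_mult using t assms
    by (intro finsum_cong') (auto simp: single_def)
  also have "\<dots> = single R (k \<otimes> l) (u @ v) w"
  proof (cases "length u \<le> length w")
    case True
    then show ?thesis using assms
      by (intro finsum_singleton[of "length u" "{..length w}" "\<lambda>_. single R (k \<otimes> l) (u @ v) w"])
         (auto simp: single_def)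
  next
    case False
    then have "w \<noteq> u @ v" by auto
    moreover have "(\<Oplus>i \<in> {..length w}. if length u = i then single R (k \<otimes> l) (u @ v) w else \<zero>)
      = (\<Oplus>i \<in> {..length w}. \<zero>)"
      using False by (intro finsum_cong') auto
    ultimately show ?thesis by (simp add: single_def)
  qed
  finally show "(single R k u \<otimes>\<^bsub>Fr E\<^esub> single R l v) w = single R (k \<otimes> l) (u @ v) w" .
qed

lemma free_distr_fun:
  assumes "\<And>w. f w \<in> carrier R" "\<And>w. g w \<in> carrier R" "\<And>w. h w \<in> carrier R"
  shows "(f \<oplus>\<^bsub>Fr E\<^esub> g) \<otimes>\<^bsub>Fr E\<^esub> h = (f \<otimes>\<^bsub>Fr E\<^esub> h) \<oplus>\<^bsub>Fr E\<^esub> (g \<otimes>\<^bsub>Fr E\<^esub> h)"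
    and "h \<otimes>\<^bsub>Fr E\<^esub> (f \<oplus>\<^bsub>Fr E\<^esub> g) = (h \<otimes>\<^bsub>Fr E\<^esub> f) \<oplus>\<^bsub>Fr E\<^esub> (h \<otimes>\<^bsub>Fr E\<^esub> g)"
  using assms by (auto simp: fun_eq_iff free_algebra_mult l_distr r_distr finsum_addf Pi_iff)

lemma free_distr:
  assumes "f \<in> carrier (Fr E)" "g \<in> carrier (Fr E)" "h \<in> carrier (Fr E)"
  shows "(f \<oplus>\<^bsub>Fr E\<^esub> g) \<otimes>\<^bsub>Fr E\<^esub> h = (f \<otimes>\<^bsub>Fr E\<^esub> h) \<oplus>\<^bsub>Fr E\<^esub> (g \<otimes>\<^bsub>Fr E\<^esub> h)"
    and "h \<otimes>\<^bsub>Fr E\<^esub> (f \<oplus>\<^bsub>Fr E\<^esub> g) = (h \<otimes>\<^bsub>Fr E\<^esub> f) \<oplus>\<^bsub>Fr E\<^esub> (h \<otimes>\<^bsub>Fr E\<^esub> g)"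
  using assms by (intro free_distr_fun; simp)+

lemma free_mult_carrier:
  assumes "f \<in> carrier (Fr E)" "g \<in> carrier (Fr E)"
  shows "f \<otimes>\<^bsub>Fr E\<^esub> g \<in> carrier (Fr E)"
  using assms
proof (induction f rule: free_induct)
  case (single k u)
  from single.prems show ?case
  proof (induction g rule: free_induct)
    case (single l v)
    then show ?case using \<open>k \<in> carrier R\<close> \<open>u \<in> lists E\<close>
      by (simp only: free_mult_single) (rule single_carrier, auto)
  next
    case (add g h)
    then show ?case
      using free_distr_fun(2)[of g h "single R k u" E] free_add_carrier \<open>k \<in> carrier R\<close> \<open>u \<in> lists E\<close>
        free_carrierD single_carrier by metis
  qed
next
  case (add f h)
  then show ?case using free_distr_fun(1)[of f h g E] free_add_carrier free_carrierD by metis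
qed

lemma free_assoc:
  assumes "f \<in> carrier (Fr E)" "g \<in> carrier (Fr E)" "h \<in> carrier (Fr E)"
  shows "(f \<otimes>\<^bsub>Fr E\<^esub> g) \<otimes>\<^bsub>Fr E\<^esub> h = f \<otimes>\<^bsub>Fr E\<^esub> (g \<otimes>\<^bsub>Fr E\<^esub> h)"
proof -
  note d = free_distr
  from assms show ?thesis
  proof (induction f rule: free_induct)
    case f: (single k u)
    note fc = single_carrier[OF f(1,2)]
    from f.prems show ?case
    proof (induction g rule: free_induct)
      case g: (single l v)
      note gc = single_carrier[OF g(1,2)]
      from g.prems show ?case
      proof (induction h rule: free_induct)
        case (single m w)
        then show ?case using f g by (simp add: free_mult_single m_assoc)
      next
        case (add h h')
        then show ?case using fc gc
          by (simp only: d[OF free_mult_carrier] d free_mult_carrier)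
      qed
    next
      case (add g g')
      then show ?case using fc by (simp only: d free_mult_carrier)
    qed
  next
    case (add f f')
    then show ?case by (simp only: d free_mult_carrier)
  qed
qed

lemma free_ring: "ring (Fr E)"
proof (rule ringI)
  note d = free_distr
  show "abelian_group (Fr E)"
  proof (rule abelian_groupI)
    fix f assume "f \<in> carrier (Fr E)"
    then show "\<exists>g\<in>carrier (Fr E). g \<oplus>\<^bsub>Fr E\<^esub> f = \<zero>\<^bsub>Fr E\<^esub>"
      by (intro bexI[of _ "\<lambda>w. \<ominus> f w"])
        (auto simp: l_neg intro: finite_subset[of _ "{w. f w \<noteq> \<zero>}"])
  next
    show "f \<oplus>\<^bsub>Fr E\<^esub> g \<in> carrier (Fr E)" if "f \<in> carrier (Fr E)" "g \<in> carrier (Fr E)" for f g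
      using that by (rule free_add_carrier)
  qed (auto simp: a_ac)
  have one: "single R \<one> [] \<otimes>\<^bsub>Fr E\<^esub> f = f" "f \<otimes>\<^bsub>Fr E\<^esub> single R \<one> [] = f" if "f \<in> carrier (Fr E)" for f
  proof -
    have o: "single R \<one> [] \<in> carrier (Fr E)" by (rule single_carrier) auto
    from that have "single R \<one> [] \<otimes>\<^bsub>Fr E\<^esub> f = f \<and> f \<otimes>\<^bsub>Fr E\<^esub> single R \<one> [] = f"
    proof (induction f rule: free_induct)
      case (single k u)
      then show ?case by (simp add: free_mult_single)
    next
      case (add f g)
      then show ?case using o by (simp only: d)
    qed
    then show "single R \<one> [] \<otimes>\<^bsub>Fr E\<^esub> f = f" "f \<otimes>\<^bsub>Fr E\<^esub> single R \<one> [] = f" by auto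
  qed
  show "Group.monoid (Fr E)"
    by (rule monoidI) (auto simp: one free_assoc simp del: free_algebra_simps(1)
      intro: free_mult_carrier single_carrier)
qed (simp_all only: free_distr)

end

lemma (in cring) halo_ideal: "ideal (halo_ideal R E) (Fr E)"
proof -
  interpret F: ring "Fr E" by (rule free_ring)
  have "free_gen R \<alpha> \<in> carrier (Fr E)" if "\<alpha> \<in> E" for \<alpha>
    unfolding free_gen_single using that by (intro single_carrier) auto
  then show ?thesis unfolding halo_ideal_def
    by (intro F.genideal_ideal) (auto simp del: free_algebra_simps)
qed

definition halo_class :: "('k, 'm) ring_scheme \<Rightarrow> 'e set \<Rightarrow> ('e list \<Rightarrow> 'k) \<Rightarrow> ('e list \<Rightarrow> 'k) set" where
  "halo_class K E f = halo_ideal K E +>\<^bsub>free_algebra K E\<^esub> f"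

abbreviation halo_gen :: "('k, 'm) ring_scheme \<Rightarrow> 'e set \<Rightarrow> 'e \<Rightarrow> ('e list \<Rightarrow> 'k) set" where
  "halo_gen K E \<alpha> \<equiv> halo_class K E (single K \<one>\<^bsub>K\<^esub> [\<alpha>])"

context cring
begin

lemma halo_carrier: "carrier (halo_algebra R E) = halo_class R E ` carrier (Fr E)"
  by (auto simp: halo_algebra_def FactRing_def A_RCOSETS_def' halo_class_def a_r_coset_def r_coset_def simp del: free_algebra_simps)

lemma halo_class_ops:
  assumes "f \<in> carrier (Fr E)" "g \<in> carrier (Fr E)"
  shows "halo_class R E f \<oplus>\<^bsub>halo_algebra R E\<^esub> halo_class R E g = halo_class R E (f \<oplus>\<^bsub>Fr E\<^esub> g)"
    and "halo_class R E f \<otimes>\<^bsub>halo_algebra R E\<^esub> halo_class R E g = halo_class R E (f \<otimes>\<^bsub>Fr E\<^esub> g)"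
proof -
  interpret I: ideal "halo_ideal R E" "Fr E" by (rule halo_ideal)
  show "halo_class R E f \<oplus>\<^bsub>halo_algebra R E\<^esub> halo_class R E g = halo_class R E (f \<oplus>\<^bsub>Fr E\<^esub> g)"
    using I.a_rcos_sum assms by (simp add: halo_class_def halo_algebra_def FactRing_def del: free_algebra_simps)
  show "halo_class R E f \<otimes>\<^bsub>halo_algebra R E\<^esub> halo_class R E g = halo_class R E (f \<otimes>\<^bsub>Fr E\<^esub> g)"
    using I.rcoset_mult_add assms by (simp add: halo_class_def halo_algebra_def FactRing_def del: free_algebra_simps)
qed

lemma halo_one: "\<one>\<^bsub>halo_algebra R E\<^esub> = halo_class R E (single R \<one> [])"
  by (simp add: halo_algebra_def FactRing_def halo_class_def)

lemma halo_scalar_class: "halo_scalar R E k = halo_class R E (single R k [])"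
  by (simp add: halo_scalar_def halo_class_def single_def)

lemma halo_gen_carrier: "\<alpha> \<in> E \<Longrightarrow> halo_gen R E \<alpha> \<in> carrier (halo_algebra R E)"
  unfolding halo_carrier by (intro imageI single_carrier) auto

end

lemma halo_moduleD:
  assumes "is_halo_module K E M"
  shows "operator_module K (carrier (halo_algebra K E)) M" "module K M"
  using assms by (auto simp: is_halo_module_def operator_module_def)

text \<open>The algebra is generated by scalars and the \<open>\<epsilon>\<^bsub>\<alpha>\<^esub>\<close>, so its action on a module is determined by
  the operators of the generators.\<close>

lemma (in cring) halo_act_single:
  assumes M: "is_halo_module R E M" and k: "k \<in> carrier R" and u: "u \<in> lists E" and x: "x \<in> carrier M"
  shows "act M (halo_class R E (single R k u)) x = k \<odot>\<^bsub>M\<^esub> foldr (\<lambda>\<alpha>. act M (halo_gen R E \<alpha>)) u x"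
proof -
  note H = M[unfolded is_halo_module_def]
  have mult: "act M (halo_class R E (f \<otimes>\<^bsub>Fr E\<^esub> g)) x = act M (halo_class R E f) (act M (halo_class R E g) x)"
    if "f \<in> carrier (Fr E)" "g \<in> carrier (Fr E)" for f g
    using H that x unfolding halo_class_ops[OF that, symmetric] halo_carrier by blast
  have 1: "act M (halo_class R E (single R \<one> u)) x = foldr (\<lambda>\<alpha>. act M (halo_gen R E \<alpha>)) u x"
    using u
  proof (induction u)
    case Nil
    then show ?case using H x halo_one[of E] by simp
  next
    case (Cons \<alpha> u)
    then have c: "single R \<one> [\<alpha>] \<in> carrier (Fr E)" "single R \<one> u \<in> carrier (Fr E)"
      by (auto simp del: free_algebra_simps intro!: single_carrier)
    have "act M (halo_class R E (single R \<one> (\<alpha> # u))) x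
      = act M (halo_gen R E \<alpha>) (act M (halo_class R E (single R \<one> u)) x)"
      using mult[OF c] free_mult_single[of \<one> \<one> E "[\<alpha>]" u] by simp
    then show ?case using Cons by simp
  qed
  have c: "single R k [] \<in> carrier (Fr E)" "single R \<one> u \<in> carrier (Fr E)"
    using k u by (auto simp del: free_algebra_simps intro!: single_carrier)
  have mem: "act M (halo_class R E (single R \<one> u)) x \<in> carrier M"
    using operator_moduleD(3)[OF halo_moduleD(1)[OF M] _ x] c halo_carrier by blast
  have "act M (halo_class R E (single R k u)) x
    = act M (halo_scalar R E k) (act M (halo_class R E (single R \<one> u)) x)"
    using mult[OF c] free_mult_single[of k \<one> E "[]" u] k by (simp add: halo_scalar_class)
  then show ?thesis using H k mem 1 by simp
qed

lemma (in cring) halo_homI: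
  assumes M: "is_halo_module R E M" and N: "is_halo_module R E N" and f: "f \<in> linear_maps R M N"
    and gen: "\<And>\<alpha> x. \<alpha> \<in> E \<Longrightarrow> x \<in> carrier M \<Longrightarrow> f (act M (halo_gen R E \<alpha>) x) = act N (halo_gen R E \<alpha>) (f x)"
  shows "f \<in> op_hom R (carrier (halo_algebra R E)) M N"
proof (rule op_homI[OF f])
  note D = linear_mapsD[OF f]
  note am = operator_moduleD(3)[OF halo_moduleD(1)[OF M]] operator_moduleD(3)[OF halo_moduleD(1)[OF N]]
  fix b x assume "b \<in> carrier (halo_algebra R E)" and x: "x \<in> carrier M"
  then obtain g where g: "g \<in> carrier (Fr E)" "b = halo_class R E g" unfolding halo_carrier by blast
  have word: "foldr (\<lambda>\<alpha>. act M (halo_gen R E \<alpha>)) u x \<in> carrier M \<and>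
    f (foldr (\<lambda>\<alpha>. act M (halo_gen R E \<alpha>)) u x) = foldr (\<lambda>\<alpha>. act N (halo_gen R E \<alpha>)) u (f x)"
    if "u \<in> lists E" for u
    using that by (induction u) (auto simp: x gen am halo_gen_carrier)
  from g(1) have "f (act M (halo_class R E g) x) = act N (halo_class R E g) (f x)"
  proof (induction g rule: free_induct)
    case (single k u)
    then show ?case using word x D by (simp add: halo_act_single[OF M] halo_act_single[OF N])
  next
    case (add g h)
    then have c: "halo_class R E g \<in> carrier (halo_algebra R E)" "halo_class R E h \<in> carrier (halo_algebra R E)"
      by (auto simp: halo_carrier simp del: free_algebra_simps)
    have "act M (halo_class R E (g \<oplus>\<^bsub>Fr E\<^esub> h)) x = act M (halo_class R E g) x \<oplus>\<^bsub>M\<^esub> act M (halo_class R E h) x"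
      "act N (halo_class R E (g \<oplus>\<^bsub>Fr E\<^esub> h)) (f x) = act N (halo_class R E g) (f x) \<oplus>\<^bsub>N\<^esub> act N (halo_class R E h) (f x)"
      unfolding halo_class_ops(1)[OF add.hyps, symmetric]
      using M N c x D(1)[OF x] unfolding is_halo_module_def by blast+
    then show ?case using add x c D am by simp
  qed
  then show "f (act M b x) = act N b (f x)" using g(2) by simp
qed

text \<open>Operators that satisfy the relations of the halo algebra make a vector space a
  module over it.  The value of an element of the free algebra on a vector is the sum along its
  words, and the elements that act as zero form an ideal that contains the relations.\<close>

definition word_sum ::
  "('k, 'm) ring_scheme \<Rightarrow> ('k, 'v, 'x) module_scheme \<Rightarrow> ('e \<Rightarrow> 'v \<Rightarrow> 'v) \<Rightarrow> ('e list \<Rightarrow> 'k) \<Rightarrow> 'v \<Rightarrow> 'v" where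
  "word_sum K M T f v = (\<Oplus>\<^bsub>M\<^esub>w \<in> {w. f w \<noteq> \<zero>\<^bsub>K\<^esub>}. f w \<odot>\<^bsub>M\<^esub> foldr T w v)"

definition words_module ::
  "('k, 'm) ring_scheme \<Rightarrow> ('k, 'v, 'x) module_scheme \<Rightarrow> ('e \<Rightarrow> 'v \<Rightarrow> 'v)
    \<Rightarrow> ('k, 'v, ('e list \<Rightarrow> 'k) set) opmod" where
  "words_module K M T = with_act M (\<lambda>b. word_sum K M T (SOME f. f \<in> b))"

lemma words_module_simps [simp]:
  "carrier (words_module K M T) = carrier M" "zero (words_module K M T) = zero M"
  "add (words_module K M T) = add M" "smult (words_module K M T) = smult M"
  "act (words_module K M T) b = word_sum K M T (SOME f. f \<in> b)"
  by (simp_all add: words_module_def)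

locale word_operators = module R M for R (structure) and M (structure) +
  fixes E :: "'e set" and T :: "'e \<Rightarrow> _ \<Rightarrow> _"
  assumes T: "\<alpha> \<in> E \<Longrightarrow> T \<alpha> \<in> linear_maps R M M"
begin

lemma foldr_closed: "w \<in> lists E \<Longrightarrow> v \<in> carrier M \<Longrightarrow> foldr T w v \<in> carrier M"
  by (induction w) (auto simp: linear_mapsD(1)[OF T])

lemma foldr_linear: "w \<in> lists E \<Longrightarrow> foldr T w \<in> linear_maps R M M"
proof (induction w)
  case Nil
  then show ?case by (auto intro: linear_mapsI)
next
  case (Cons a w)
  then show ?case using linear_comp[of "foldr T w" R M M "T a" M] T by (simp add: comp_def)
qed

lemma word_sum_superset:
  assumes f: "f \<in> carrier (Fr E)" and v: "v \<in> carrier M" and A: "finite A" "{w. f w \<noteq> \<zero>} \<subseteq> A" "A \<subseteq> lists E"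
  shows "word_sum R M T f v = (\<Oplus>\<^bsub>M\<^esub>w \<in> A. f w \<odot>\<^bsub>M\<^esub> foldr T w v)"
  unfolding word_sum_def
  by (rule M.add.finprod_mono_neutral_cong_left)
    (use assms foldr_closed[OF subsetD[OF A(3)] v] in auto)

lemma word_sum_single:
  assumes "k \<in> carrier R" "u \<in> lists E" "v \<in> carrier M"
  shows "word_sum R M T (single R k u) v = k \<odot>\<^bsub>M\<^esub> foldr T u v"
  using assms foldr_closed
  by (subst word_sum_superset[OF single_carrier[OF assms(1,2)] assms(3), of "{u}"]) (auto simp: single_def)

lemma word_sum_add:
  assumes f: "f \<in> carrier (Fr E)" and g: "g \<in> carrier (Fr E)" and v: "v \<in> carrier M"
  shows "word_sum R M T (f \<oplus>\<^bsub>Fr E\<^esub> g) v = word_sum R M T f v \<oplus>\<^bsub>M\<^esub> word_sum R M T g v"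
proof -
  let ?A = "{w. f w \<noteq> \<zero>} \<union> {w. g w \<noteq> \<zero>}"
  have A: "finite ?A" "?A \<subseteq> lists E" using f g by auto
  have c: "foldr T w v \<in> carrier M" if "f w \<noteq> \<zero> \<or> g w \<noteq> \<zero>" for w
    using foldr_closed[OF subsetD[OF A(2)] v, of w] that by auto
  have "word_sum R M T (f \<oplus>\<^bsub>Fr E\<^esub> g) v = (\<Oplus>\<^bsub>M\<^esub>w \<in> ?A. (f \<oplus>\<^bsub>Fr E\<^esub> g) w \<odot>\<^bsub>M\<^esub> foldr T w v)"
    by (rule word_sum_superset[OF free_add_carrier[OF f g] v A(1) _ A(2)]) auto
  also have "\<dots> = (\<Oplus>\<^bsub>M\<^esub>w \<in> ?A. f w \<odot>\<^bsub>M\<^esub> foldr T w v \<oplus>\<^bsub>M\<^esub> g w \<odot>\<^bsub>M\<^esub> foldr T w v)"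
    by (rule M.finsum_cong') (use f g A c in \<open>auto simp: smult_l_distr\<close>)
  also have "\<dots> = (\<Oplus>\<^bsub>M\<^esub>w \<in> ?A. f w \<odot>\<^bsub>M\<^esub> foldr T w v) \<oplus>\<^bsub>M\<^esub> (\<Oplus>\<^bsub>M\<^esub>w \<in> ?A. g w \<odot>\<^bsub>M\<^esub> foldr T w v)"
    by (rule M.finsum_addf) (use f g A c in auto)
  also have "\<dots> = word_sum R M T f v \<oplus>\<^bsub>M\<^esub> word_sum R M T g v"
    using word_sum_superset[OF f v A(1) _ A(2)] word_sum_superset[OF g v A(1) _ A(2)] by simp
  finally show ?thesis .
qed

lemma word_sum_linear:
  assumes "f \<in> carrier (Fr E)"
  shows "word_sum R M T f \<in> linear_maps R M M"
  using assms
proof (induction f rule: free_induct)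
  case (single k u)
  then have "(\<lambda>v. k \<odot>\<^bsub>M\<^esub> foldr T u v) \<in> linear_maps R M M"
    by (intro linear_comp[OF foldr_linear smult_linear[OF module_axioms]])
  from linear_mapsD[OF this] show ?case using single
    by (intro linear_mapsI) (simp_all add: word_sum_single)
next
  case (add f g)
  note D = linear_mapsD[OF add.IH(1)] linear_mapsD[OF add.IH(2)]
  show ?case
    by (rule linear_mapsI)
      (use D in \<open>auto simp: word_sum_add[OF add.hyps] M.a_ac smult_r_distr simp del: free_algebra_simps\<close>)
qed

lemma word_sum_mult:
  assumes "f \<in> carrier (Fr E)" "g \<in> carrier (Fr E)" "v \<in> carrier M"
  shows "word_sum R M T (f \<otimes>\<^bsub>Fr E\<^esub> g) v = word_sum R M T f (word_sum R M T g v)"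
  using assms
proof (induction f rule: free_induct)
  case f: (single k u)
  note fc = single_carrier[OF f(1,2)]
  from f.prems show ?case
  proof (induction g rule: free_induct)
    case (single l w)
    then show ?case using f
      by (simp add: free_mult_single word_sum_single foldr_closed smult_assoc1
          linear_mapsD(3)[OF foldr_linear] del: free_algebra_simps)
  next
    case (add g h)
    then show ?case using fc
      by (simp add: free_distr word_sum_add
          free_mult_carrier linear_mapsD[OF word_sum_linear] del: free_algebra_simps)
  qed
next
  case (add f h)
  then show ?case
    by (simp add: free_distr word_sum_add
        free_mult_carrier linear_mapsD[OF word_sum_linear] del: free_algebra_simps)
qed

lemma word_sum_halo_ideal:
  assumes rel: "\<And>\<alpha> \<beta> v. \<alpha> \<in> E \<Longrightarrow> \<beta> \<in> E \<Longrightarrow> v \<in> carrier M \<Longrightarrow> T \<alpha> (T \<beta> v) = T \<alpha> v"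
    and "f \<in> halo_ideal R E" "v \<in> carrier M"
  shows "word_sum R M T f v = \<zero>\<^bsub>M\<^esub>"
proof -
  interpret F: ring "Fr E" by (rule free_ring)
  define J where "J = {f \<in> carrier (Fr E). \<forall>v \<in> carrier M. word_sum R M T f v = \<zero>\<^bsub>M\<^esub>}"
  note wl = linear_mapsD[OF word_sum_linear]
  have neg: "word_sum R M T (\<ominus>\<^bsub>Fr E\<^esub> f) v = \<ominus>\<^bsub>M\<^esub> word_sum R M T f v" if "f \<in> carrier (Fr E)" "v \<in> carrier M" for f v
  proof -
    have "word_sum R M T (\<ominus>\<^bsub>Fr E\<^esub> f \<oplus>\<^bsub>Fr E\<^esub> f) v = \<zero>\<^bsub>M\<^esub>"
      using that unfolding F.l_neg[OF that(1)] by (simp add: word_sum_def)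
    then show ?thesis using that wl(1) F.a_inv_closed[OF that(1)]
      by (subst (asm) word_sum_add) (auto simp del: free_algebra_simps simp: M.minus_equality)
  qed
  have J: "ideal J (Fr E)"
  proof (rule idealI[OF F.ring_axioms])
    show "subgroup J (add_monoid (Fr E))"
    proof
      fix f assume f: "f \<in> J"
      then have "\<ominus>\<^bsub>Fr E\<^esub> f \<in> J" by (auto simp: J_def neg simp del: free_algebra_simps)
      then show "inv\<^bsub>add_monoid (Fr E)\<^esub> f \<in> J" by (simp add: a_inv_def)
    next
      show "\<one>\<^bsub>add_monoid (Fr E)\<^esub> \<in> J" using F.zero_closed by (auto simp: J_def word_sum_def)
    next
      fix f g assume "f \<in> J" "g \<in> J"
      then show "f \<otimes>\<^bsub>add_monoid (Fr E)\<^esub> g \<in> J"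
        by (simp add: J_def word_sum_add free_add_carrier del: free_algebra_simps)
    qed (auto simp: J_def)
  qed (auto simp: J_def word_sum_mult free_mult_carrier wl linear_zero[OF module_axioms module_axioms word_sum_linear]
       simp del: free_algebra_simps)
  have "free_gen R \<alpha> \<otimes>\<^bsub>Fr E\<^esub> free_gen R \<beta> \<ominus>\<^bsub>Fr E\<^esub> free_gen R \<alpha> \<in> J" if ab: "\<alpha> \<in> E" "\<beta> \<in> E" for \<alpha> \<beta>
  proof -
    have c: "single R \<one> [\<alpha>] \<in> carrier (Fr E)" "single R \<one> [\<alpha>, \<beta>] \<in> carrier (Fr E)"
      using ab by (auto simp del: free_algebra_simps intro!: single_carrier)
    have "word_sum R M T (single R \<one> [\<alpha>, \<beta>] \<ominus>\<^bsub>Fr E\<^esub> single R \<one> [\<alpha>]) v = \<zero>\<^bsub>M\<^esub>" if v: "v \<in> carrier M" for v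
      using ab v c rel wl(1)[OF c(1) v] linear_mapsD(1)[OF T]
      by (simp add: F.minus_eq word_sum_add neg word_sum_single M.r_neg del: free_algebra_simps)
    then show ?thesis using c
      by (simp add: J_def free_gen_single free_mult_single del: free_algebra_simps)
  qed
  then have "halo_ideal R E \<subseteq> J" unfolding halo_ideal_def
    by (intro F.genideal_minimal[OF J]) auto
  then show ?thesis using assms by (auto simp: J_def)
qed

lemma word_sum_class:
  assumes rel: "\<And>\<alpha> \<beta> v. \<alpha> \<in> E \<Longrightarrow> \<beta> \<in> E \<Longrightarrow> v \<in> carrier M \<Longrightarrow> T \<alpha> (T \<beta> v) = T \<alpha> v"
    and f: "f \<in> carrier (Fr E)" and v: "v \<in> carrier M"
  shows "word_sum R M T (SOME g. g \<in> halo_class R E f) v = word_sum R M T f v"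
proof -
  interpret I: ideal "halo_ideal R E" "Fr E" by (rule halo_ideal)
  have "(SOME g. g \<in> halo_class R E f) \<in> halo_class R E f"
    unfolding halo_class_def by (rule someI[of _ f]) (rule I.a_rcos_self[OF f])
  then obtain h where h: "h \<in> halo_ideal R E" "(SOME g. g \<in> halo_class R E f) = h \<oplus>\<^bsub>Fr E\<^esub> f"
    unfolding halo_class_def by (rule coset_memE)
  then show ?thesis
    using word_sum_add[OF I.a_Hcarr[OF h(1)] f v] word_sum_halo_ideal[OF rel h(1) v] f v
      linear_mapsD(1)[OF word_sum_linear[OF f]] by simp
qed

lemma halo_module_of_operators:
  assumes rel: "\<And>\<alpha> \<beta> v. \<alpha> \<in> E \<Longrightarrow> \<beta> \<in> E \<Longrightarrow> v \<in> carrier M \<Longrightarrow> T \<alpha> (T \<beta> v) = T \<alpha> v"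
  shows "is_halo_module R E (words_module R M T)"
    and "\<alpha> \<in> E \<Longrightarrow> v \<in> carrier M \<Longrightarrow> act (words_module R M T) (halo_gen R E \<alpha>) v = T \<alpha> v"
proof -
  let ?N = "words_module R M T"
  note wc = word_sum_class[OF rel] and wl = linear_mapsD[OF word_sum_linear]
  show "act ?N (halo_gen R E \<alpha>) v = T \<alpha> v" if "\<alpha> \<in> E" "v \<in> carrier M"
    using that linear_mapsD(1)[OF T]
    by (simp add: wc single_carrier word_sum_single del: free_algebra_simps)
  have lin: "act ?N b \<in> linear_maps R ?N ?N" if b: "b \<in> carrier (halo_algebra R E)" for b
  proof -
    from b obtain f where f: "f \<in> carrier (Fr E)" "b = halo_class R E f" unfolding halo_carrier by blast
    then show ?thesis
      by (intro linear_mapsI) (simp_all add: wc wl del: free_algebra_simps)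
  qed
  show "is_halo_module R E ?N"
    unfolding is_halo_module_def
  proof (intro conjI ballI)
    show "module R ?N" unfolding words_module_def by (rule module_with_act[OF module_axioms])
    fix b v assume b: "b \<in> carrier (halo_algebra R E)" and v: "v \<in> carrier ?N"
    then obtain f where f: "f \<in> carrier (Fr E)" "b = halo_class R E f" unfolding halo_carrier by blast
    fix c assume "c \<in> carrier (halo_algebra R E)"
    then obtain g where g: "g \<in> carrier (Fr E)" "c = halo_class R E g" unfolding halo_carrier by blast
    show "act ?N (b \<oplus>\<^bsub>halo_algebra R E\<^esub> c) v = act ?N b v \<oplus>\<^bsub>?N\<^esub> act ?N c v"
      using f g v by (simp add: halo_class_ops wc word_sum_add free_add_carrier del: free_algebra_simps)
    show "act ?N (b \<otimes>\<^bsub>halo_algebra R E\<^esub> c) v = act ?N b (act ?N c v)"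
      using f g v by (simp add: halo_class_ops wc word_sum_mult free_mult_carrier wl del: free_algebra_simps)
  next
    fix v assume "v \<in> carrier ?N"
    then show "act ?N \<one>\<^bsub>halo_algebra R E\<^esub> v = v"
      by (simp add: halo_one wc single_carrier word_sum_single del: free_algebra_simps)
    fix k assume "k \<in> carrier R"
    then show "act ?N (halo_scalar R E k) v = k \<odot>\<^bsub>?N\<^esub> v"
      using \<open>v \<in> _\<close> by (simp add: halo_scalar_class wc single_carrier word_sum_single del: free_algebra_simps)
  qed (fact lin)
qed

end

section \<open>Representations of the digroup\<close>

lemma (in cring) halo_relation:
  assumes "\<alpha> \<in> E" "\<beta> \<in> E"
  shows "halo_gen R E \<alpha> \<otimes>\<^bsub>halo_algebra R E\<^esub> halo_gen R E \<beta> = halo_gen R E \<alpha>"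
proof -
  interpret F: ring "Fr E" by (rule free_ring)
  have c: "single R \<one> [\<alpha>] \<in> carrier (Fr E)" "single R \<one> [\<beta>] \<in> carrier (Fr E)"
    using assms by (auto simp del: free_algebra_simps intro!: single_carrier)
  have c2: "single R \<one> [\<alpha>] \<otimes>\<^bsub>Fr E\<^esub> single R \<one> [\<beta>] \<in> carrier (Fr E)"
    using free_mult_carrier[OF c] .
  let ?S = "{(free_gen R \<alpha> \<otimes>\<^bsub>Fr E\<^esub> free_gen R \<beta>) \<ominus>\<^bsub>Fr E\<^esub> free_gen R \<alpha>
       | \<alpha> \<beta>. \<alpha> \<in> E \<and> \<beta> \<in> E}"
  have "?S \<subseteq> carrier (Fr E)"
    by (auto simp: free_gen_single simp del: free_algebra_simps
        intro!: F.minus_closed free_mult_carrier single_carrier)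
  then have "?S \<subseteq> halo_ideal R E" unfolding halo_ideal_def by (rule F.genideal_self)
  then have "single R \<one> [\<alpha>] \<otimes>\<^bsub>Fr E\<^esub> single R \<one> [\<beta>] \<ominus>\<^bsub>Fr E\<^esub> single R \<one> [\<alpha>] \<in> halo_ideal R E"
    unfolding free_gen_single using assms by auto
  then have "halo_class R E (single R \<one> [\<alpha>] \<otimes>\<^bsub>Fr E\<^esub> single R \<one> [\<beta>]) = halo_class R E (single R \<one> [\<alpha>])"
    unfolding halo_class_def
    using F.quotient_eq_iff_same_a_r_cos[OF halo_ideal c2 c(1)] by simp
  then show ?thesis by (simp only: halo_class_ops(2)[OF c])
qed

lemma (in cring) halo_module_relation:
  assumes "is_halo_module R E M" "\<alpha> \<in> E" "\<beta> \<in> E" "x \<in> carrier M"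
  shows "act M (halo_gen R E \<alpha>) (act M (halo_gen R E \<beta>) x) = act M (halo_gen R E \<alpha>) x"
  using assms halo_relation[OF assms(2,3)] halo_gen_carrier unfolding is_halo_module_def by metis

locale digroup_setting =
  fixes K :: "('k, 'm) ring_scheme" and G :: "('g, 'n) monoid_scheme" and E :: "'e set"
    and \<phi> :: "'g \<Rightarrow> 'e \<Rightarrow> 'e"
  assumes cring: "cring K" and action: "group_action G E \<phi>" and nonempty: "E \<noteq> {}"
begin

sublocale K: cring K by (rule cring)
sublocale action: group_action G E \<phi> by (rule action)
sublocale G: group G using action.group_hom group_hom.axioms(1) by blast

lemma action_closed: "g \<in> carrier G \<Longrightarrow> \<alpha> \<in> E \<Longrightarrow> \<phi> g \<alpha> \<in> E"
  using action.element_image by blast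

lemma action_one: "\<alpha> \<in> E \<Longrightarrow> \<phi> \<one>\<^bsub>G\<^esub> \<alpha> = \<alpha>"
  using action.id_eq_one by (metis restrict_apply')

lemmas action_mult = action.composition_rule

definition eps :: "('k, 'g, 'e, 'v) dig_rep \<Rightarrow> 'e \<Rightarrow> 'v \<Rightarrow> 'v" where
  "eps V \<alpha> = lam V (\<one>\<^bsub>G\<^esub>, \<alpha>)"

abbreviation rg :: "('k, 'g, 'e, 'v) dig_rep \<Rightarrow> 'g \<Rightarrow> 'v \<Rightarrow> 'v" where
  "rg \<equiv> rho_grp E"

lemma some_point: "(SOME \<alpha>. \<alpha> \<in> E) \<in> E"
  using nonempty by (simp add: some_in_eq)

lemma repD:
  assumes "is_rep K G E \<phi> V"
  shows "module K V" and "x \<in> dig G E \<Longrightarrow> lam V x \<in> linear_maps K V V"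
    and "x \<in> dig G E \<Longrightarrow> rho V x \<in> linear_maps K V V"
    and "x \<in> dig G E \<Longrightarrow> y \<in> dig G E \<Longrightarrow> v \<in> carrier V \<Longrightarrow> lam V (dig_dashv G x y) v = lam V x (lam V y v)"
    and "x \<in> dig G E \<Longrightarrow> y \<in> dig G E \<Longrightarrow> v \<in> carrier V \<Longrightarrow> rho V (dig_vdash G \<phi> x y) v = rho V x (rho V y v)"
    and "x \<in> dig G E \<Longrightarrow> y \<in> dig G E \<Longrightarrow> v \<in> carrier V \<Longrightarrow> lam V (dig_vdash G \<phi> x y) v = rho V x (lam V y v)"
    and "x \<in> dig G E \<Longrightarrow> y \<in> dig G E \<Longrightarrow> v \<in> carrier V \<Longrightarrow> lam V (dig_dashv G x y) v = lam V x (rho V y v)"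
    and "\<alpha> \<in> E \<Longrightarrow> v \<in> carrier V \<Longrightarrow> rho V (\<one>\<^bsub>G\<^esub>, \<alpha>) v = v"
  using assms unfolding is_rep_def dig_halo_def by auto

lemma dig_mem: "(g, \<alpha>) \<in> dig G E \<longleftrightarrow> g \<in> carrier G \<and> \<alpha> \<in> E"
  by (auto simp: dig_def)

lemma rep_operator: "is_rep K G E \<phi> V \<Longrightarrow> operator_module K (rep_ops G E) V"
  using repD(1-3) by (auto simp: operator_module_def rep_ops_def lam_def rho_def)

context
  fixes V :: "('k, 'g, 'e, 'v) dig_rep"
  assumes V: "is_rep K G E \<phi> V"
begin

lemma eps_linear: "\<alpha> \<in> E \<Longrightarrow> eps V \<alpha> \<in> linear_maps K V V"
  unfolding eps_def by (rule repD(2)[OF V]) (simp add: dig_mem)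

lemma rg_linear: "g \<in> carrier G \<Longrightarrow> rg V g \<in> linear_maps K V V"
  unfolding rho_grp_def by (rule repD(3)[OF V]) (simp add: dig_mem some_point)

lemmas eps_closed = linear_mapsD(1)[OF eps_linear] and rg_closed = linear_mapsD(1)[OF rg_linear]

text \<open>Since \<open>(g, \<beta>) \<turnstile> (1, \<gamma>) = (g, g\<bullet>\<gamma>)\<close> and the halo acts trivially under \<open>\<rho>\<close>, the second component can
  be changed to any point of \<open>E\<close>.\<close>

lemma rho_eq_rg:
  assumes "g \<in> carrier G" "\<alpha> \<in> E" "v \<in> carrier V"
  shows "rho V (g, \<alpha>) v = rg V g v"
proof -
  have *: "rho V (g, \<beta>) v = rho V (g, \<alpha>) v" if "\<beta> \<in> E" for \<beta>
  proof -
    let ?c = "\<phi> (inv\<^bsub>G\<^esub> g) \<alpha>"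
    have c: "?c \<in> E" "\<phi> g ?c = \<alpha>"
      using assms action_closed action_mult[of \<alpha> g "inv\<^bsub>G\<^esub> g"] action_one by auto
    have "rho V (g, \<alpha>) v = rho V (g, \<beta>) (rho V (\<one>\<^bsub>G\<^esub>, ?c) v)"
      using repD(5)[OF V, of "(g, \<beta>)" "(\<one>\<^bsub>G\<^esub>, ?c)" v] that c assms
      by (simp add: dig_mem dig_vdash_def)
    then show ?thesis using repD(8)[OF V c(1) assms(3)] by simp
  qed
  show ?thesis unfolding rho_grp_def by (rule *[symmetric]) (rule some_point)
qed

lemma rg_one: "v \<in> carrier V \<Longrightarrow> rg V \<one>\<^bsub>G\<^esub> v = v"
  unfolding rho_grp_def by (rule repD(8)[OF V some_point])

lemma rg_mult:
  assumes "g \<in> carrier G" "h \<in> carrier G" "v \<in> carrier V"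
  shows "rg V (g \<otimes>\<^bsub>G\<^esub> h) v = rg V g (rg V h v)"
  using repD(5)[OF V, of "(g, SOME \<alpha>. \<alpha> \<in> E)" "(h, SOME \<alpha>. \<alpha> \<in> E)" v] assms some_point
    rho_eq_rg[of "g \<otimes>\<^bsub>G\<^esub> h" "\<phi> g (SOME \<alpha>. \<alpha> \<in> E)" v] action_closed
  by (simp add: dig_mem dig_vdash_def rho_grp_def)

lemma rg_inv:
  assumes "g \<in> carrier G" "v \<in> carrier V"
  shows "rg V (inv\<^bsub>G\<^esub> g) (rg V g v) = v" "rg V g (rg V (inv\<^bsub>G\<^esub> g) v) = v"
  using assms rg_one by (simp_all flip: rg_mult)

lemma rg_bij: "g \<in> carrier G \<Longrightarrow> bij_betw (rg V g) (carrier V) (carrier V)"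
  by (rule bij_betw_byWitness[where f' = "rg V (inv\<^bsub>G\<^esub> g)"]) (auto simp: rg_inv rg_closed)

lemma lam_eq:
  assumes "g \<in> carrier G" "\<alpha> \<in> E" "v \<in> carrier V"
  shows "lam V (g, \<alpha>) v = eps V \<alpha> (rg V g v)"
  using repD(7)[OF V, of "(\<one>\<^bsub>G\<^esub>, \<alpha>)" "(g, \<alpha>)" v] assms rho_eq_rg
  by (simp add: dig_mem dig_dashv_def eps_def)

lemma eps_eps:
  assumes "\<alpha> \<in> E" "\<beta> \<in> E" "v \<in> carrier V"
  shows "eps V \<alpha> (eps V \<beta> v) = eps V \<alpha> v"
  using repD(4)[OF V, of "(\<one>\<^bsub>G\<^esub>, \<alpha>)" "(\<one>\<^bsub>G\<^esub>, \<beta>)" v] assms by (simp add: dig_mem dig_dashv_def eps_def)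

lemma rg_eps:
  assumes "g \<in> carrier G" "\<alpha> \<in> E" "v \<in> carrier V"
  shows "rg V g (eps V \<alpha> v) = eps V (\<phi> g \<alpha>) (rg V g v)"
  using repD(6)[OF V, of "(g, \<alpha>)" "(\<one>\<^bsub>G\<^esub>, \<alpha>)" v] assms action_closed[OF assms(1,2)]
    rho_eq_rg[OF assms(1,2) eps_closed[OF assms(2,3)]] lam_eq[of g "\<phi> g \<alpha>" v]
  by (simp add: dig_mem dig_vdash_def eps_def)

end

text \<open>A representation amounts to the operators \<open>\<epsilon>\<^bsub>\<alpha>\<^esub>\<close> and \<open>\<rho>\<^bsub>g\<^esub>\<close>, i.e. it is a module over the
  skew group algebra of \<open>G\<close> over the halo algebra.\<close>

lemma rep_homI:
  assumes V: "is_rep K G E \<phi> V" and W: "is_rep K G E \<phi> W" and f: "f \<in> linear_maps K V W"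
    and "\<And>\<alpha> v. \<alpha> \<in> E \<Longrightarrow> v \<in> carrier V \<Longrightarrow> f (eps V \<alpha> v) = eps W \<alpha> (f v)"
    and "\<And>g v. g \<in> carrier G \<Longrightarrow> v \<in> carrier V \<Longrightarrow> f (rg V g v) = rg W g (f v)"
  shows "f \<in> op_hom K (rep_ops G E) V W"
proof (rule op_homI[OF f])
  fix s v assume "s \<in> rep_ops G E" and v: "v \<in> carrier V"
  then obtain g \<alpha> where g: "g \<in> carrier G" "\<alpha> \<in> E" and s: "s = Inl (g, \<alpha>) \<or> s = Inr (g, \<alpha>)"
    by (auto simp: rep_ops_def dig_def)
  have fv: "f v \<in> carrier W" using linear_mapsD(1)[OF f v] .
  have "f (lam V (g, \<alpha>) v) = lam W (g, \<alpha>) (f v)" "f (rho V (g, \<alpha>) v) = rho W (g, \<alpha>) (f v)"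
    using assms(4,5) g v fv rg_closed[OF V g(1) v]
    by (simp_all add: lam_eq[OF V] lam_eq[OF W] rho_eq_rg[OF V] rho_eq_rg[OF W])
  then show "f (act V s v) = act W s (f v)" using s by (auto simp: lam_def rho_def)
qed

lemma rep_homD:
  assumes "f \<in> op_hom K (rep_ops G E) V W"
  shows "\<alpha> \<in> E \<Longrightarrow> v \<in> carrier V \<Longrightarrow> f (eps V \<alpha> v) = eps W \<alpha> (f v)"
    and "g \<in> carrier G \<Longrightarrow> v \<in> carrier V \<Longrightarrow> f (rg V g v) = rg W g (f v)"
  using op_homD(3)[OF assms, of "Inl (\<one>\<^bsub>G\<^esub>, \<alpha>)" v] op_homD(3)[OF assms, of "Inr (g, SOME \<alpha>. \<alpha> \<in> E)" v]
    some_point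
  by (auto simp: rep_ops_def dig_mem eps_def rho_grp_def lam_def rho_def)

lemma rep_of_operators:
  assumes M: "module K M"
    and e: "\<And>\<alpha>. \<alpha> \<in> E \<Longrightarrow> e \<alpha> \<in> linear_maps K M M" and r: "\<And>g. g \<in> carrier G \<Longrightarrow> r g \<in> linear_maps K M M"
    and ee: "\<And>\<alpha> \<beta> v. \<alpha> \<in> E \<Longrightarrow> \<beta> \<in> E \<Longrightarrow> v \<in> carrier M \<Longrightarrow> e \<alpha> (e \<beta> v) = e \<alpha> v"
    and r1: "\<And>v. v \<in> carrier M \<Longrightarrow> r \<one>\<^bsub>G\<^esub> v = v"
    and rr: "\<And>g h v. g \<in> carrier G \<Longrightarrow> h \<in> carrier G \<Longrightarrow> v \<in> carrier M \<Longrightarrow> r (g \<otimes>\<^bsub>G\<^esub> h) v = r g (r h v)"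
    and re: "\<And>g \<alpha> v. g \<in> carrier G \<Longrightarrow> \<alpha> \<in> E \<Longrightarrow> v \<in> carrier M \<Longrightarrow> r g (e \<alpha> v) = e (\<phi> g \<alpha>) (r g v)"
  defines "V \<equiv> with_act M (case_sum (\<lambda>(g, \<alpha>) v. e \<alpha> (r g v)) (\<lambda>(g, \<alpha>). r g))"
  shows "is_rep K G E \<phi> V" and "\<And>\<alpha> v. \<alpha> \<in> E \<Longrightarrow> v \<in> carrier M \<Longrightarrow> eps V \<alpha> v = e \<alpha> v"
    and "\<And>g v. rg V g v = r g v"
proof -
  have lam: "lam V (g, \<alpha>) v = e \<alpha> (r g v)" and rho: "rho V (g, \<alpha>) = r g" for g \<alpha> v
    by (simp_all add: V_def lam_def rho_def)
  have lam': "lam V (g, \<alpha>) = (\<lambda>v. e \<alpha> (r g v))" for g \<alpha> by (simp add: fun_eq_iff lam)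
  have car: "carrier V = carrier M" by (simp add: V_def)
  have lin: "linear_maps K V V = linear_maps K M M" by (rule linear_maps_cong) (simp_all add: V_def)
  note ec = linear_mapsD(1)[OF e] and rc = linear_mapsD(1)[OF r]
  show "eps V \<alpha> v = e \<alpha> v" if "\<alpha> \<in> E" "v \<in> carrier M" for \<alpha> v
    using that by (simp add: eps_def lam r1)
  show "rg V g v = r g v" for g v by (simp add: rho_grp_def rho)
  have rbij: "bij_betw (r g) (carrier M) (carrier M)" if g: "g \<in> carrier G" for g
  proof (rule bij_betw_byWitness[where f' = "r (inv\<^bsub>G\<^esub> g)"])
    show "\<forall>v\<in>carrier M. r (inv\<^bsub>G\<^esub> g) (r g v) = v" "\<forall>v\<in>carrier M. r g (r (inv\<^bsub>G\<^esub> g) v) = v"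
      using g r1 by (simp_all flip: rr)
  qed (use rc g in auto)
  show "is_rep K G E \<phi> V"
    unfolding is_rep_def
  proof (intro conjI ballI)
    show "module K V" unfolding V_def by (rule module_with_act[OF M])
    fix x assume "x \<in> dig G E"
    then obtain g \<alpha> where x: "x = (g, \<alpha>)" "g \<in> carrier G" "\<alpha> \<in> E" by (auto simp: dig_def)
    show "lam V x \<in> linear_maps K V V" unfolding lin x lam' by (rule linear_comp[OF r[OF x(2)] e[OF x(3)]])
    show "rho V x \<in> linear_maps K V V" unfolding lin x rho by (rule r[OF x(2)])
    show "bij_betw (rho V x) (carrier V) (carrier V)" unfolding car x rho by (rule rbij[OF x(2)])
    fix y v assume "y \<in> dig G E" and v: "v \<in> carrier V"
    then obtain h \<beta> where y: "y = (h, \<beta>)" "h \<in> carrier G" "\<beta> \<in> E" by (auto simp: dig_def)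
    note * = x y v[unfolded car] action_closed[OF x(2) y(3)]
    show "lam V (dig_dashv G x y) v = lam V x (lam V y v)" "rho V (dig_vdash G \<phi> x y) v = rho V x (rho V y v)"
      "rho V x (lam V y v) = lam V (dig_vdash G \<phi> x y) v" "lam V x (rho V y v) = lam V (dig_dashv G x y) v"
      using * by (simp_all add: dig_dashv_def dig_vdash_def lam rho rr re ee rc ec)
  next
    fix x v assume "x \<in> dig_halo G E" "v \<in> carrier V"
    then show "rho V x v = v" by (auto simp: dig_halo_def rho r1 car)
  qed
qed

lemma rep_category: "operator_category K (rep_ops G E) (is_rep K G E \<phi>)"
proof
  fix V :: "('k, 'g, 'e, 'v) dig_rep" and N
  assume V: "is_rep K G E \<phi> V"
  then show "operator_module K (rep_ops G E) V" by (rule rep_operator)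
  assume N: "submodule N K V" and "\<And>s x. s \<in> rep_ops G E \<Longrightarrow> x \<in> N \<Longrightarrow> act V s x \<in> N"
  then have cl: "lam V x v \<in> N" "rho V x v \<in> N" if "x \<in> dig G E" "v \<in> N" for x v
    using that by (auto simp: rep_ops_def lam_def rho_def)
  note c = submodule_carrierD[OF N]
  have [simp]: "lam (V\<lparr>carrier := N\<rparr>) = lam V" "rho (V\<lparr>carrier := N\<rparr>) = rho V"
    by (simp_all add: fun_eq_iff lam_def rho_def)
  have rbij: "bij_betw (rho V (g, \<alpha>)) N N" if x: "g \<in> carrier G" "\<alpha> \<in> E" for g \<alpha>
  proof (rule bij_betw_byWitness[where f' = "rho V (inv\<^bsub>G\<^esub> g, \<alpha>)"])
    show "\<forall>v\<in>N. rho V (inv\<^bsub>G\<^esub> g, \<alpha>) (rho V (g, \<alpha>) v) = v" "\<forall>v\<in>N. rho V (g, \<alpha>) (rho V (inv\<^bsub>G\<^esub> g, \<alpha>) v) = v"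
      using x c by (simp_all add: rho_eq_rg[OF V] rg_inv[OF V] rg_closed[OF V])
  qed (use cl x in \<open>auto simp: dig_mem\<close>)
  have lin: "f \<in> linear_maps K (V\<lparr>carrier := N\<rparr>) (V\<lparr>carrier := N\<rparr>)"
    if "f \<in> linear_maps K V V" "\<And>v. v \<in> N \<Longrightarrow> f v \<in> N" for f
    using that c by (auto simp: linear_maps_def)
  show "is_rep K G E \<phi> (V\<lparr>carrier := N\<rparr>)"
    unfolding is_rep_def
  proof (intro conjI ballI)
    show "module K (V\<lparr>carrier := N\<rparr>)" by (rule submodule.submodule_is_module[OF N repD(1)[OF V]])
  qed (use repD[OF V] c cl rbij in \<open>auto intro!: lin simp: dig_def dig_halo_def\<close>)
qed

lemma halo_category: "operator_category K (carrier (halo_algebra K E)) (is_halo_module K E)"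
proof
  fix M :: "('k, 'v, ('e list \<Rightarrow> 'k) set) opmod" and N
  assume M: "is_halo_module K E M"
  then show "operator_module K (carrier (halo_algebra K E)) M" by (rule halo_moduleD)
  assume N: "submodule N K M" and cl: "\<And>s x. s \<in> carrier (halo_algebra K E) \<Longrightarrow> x \<in> N \<Longrightarrow> act M s x \<in> N"
  note c = submodule_carrierD[OF N]
  show "is_halo_module K E (M\<lparr>carrier := N\<rparr>)"
    unfolding is_halo_module_def
  proof (intro conjI ballI)
    show "module K (M\<lparr>carrier := N\<rparr>)" by (rule submodule.submodule_is_module[OF N halo_moduleD(2)[OF M]])
  qed (use M c cl in \<open>auto simp: is_halo_module_def linear_maps_def\<close>)
qed

lemma halo_restrict_words: "halo_restrict K G V = words_module K V (eps V)"
proof -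
  have "eps V = (\<lambda>\<alpha>. lam V (\<one>\<^bsub>G\<^esub>, \<alpha>))" by (simp add: fun_eq_iff eps_def)
  moreover have "word_sum K V T f = (\<lambda>v. \<Oplus>\<^bsub>V\<^esub>w \<in> {w. f w \<noteq> \<zero>\<^bsub>K\<^esub>}. f w \<odot>\<^bsub>V\<^esub> foldr T w v)" for T :: "'e \<Rightarrow> _" and f
    by (simp add: fun_eq_iff word_sum_def)
  ultimately show ?thesis by (simp add: halo_restrict_def words_module_def Let_def)
qed

lemma halo_restrict_simps [simp]:
  "carrier (halo_restrict K G V) = carrier V" "zero (halo_restrict K G V) = zero V"
  "add (halo_restrict K G V) = add V" "smult (halo_restrict K G V) = smult V"
  by (simp_all add: halo_restrict_def)

lemma halo_restrict_module:
  assumes V: "is_rep K G E \<phi> V"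
  shows "is_halo_module K E (halo_restrict K G V)"
    and "\<alpha> \<in> E \<Longrightarrow> v \<in> carrier V \<Longrightarrow> act (halo_restrict K G V) (halo_gen K E \<alpha>) v = eps V \<alpha> v"
proof -
  interpret W: word_operators K V E "eps V"
    using repD(1)[OF V] eps_linear[OF V] by (intro word_operators.intro word_operators_axioms.intro)
  show "is_halo_module K E (halo_restrict K G V)" unfolding halo_restrict_words
    by (rule W.halo_module_of_operators(1)) (rule eps_eps[OF V])
  show "act (halo_restrict K G V) (halo_gen K E \<alpha>) v = eps V \<alpha> v" if "\<alpha> \<in> E" "v \<in> carrier V"
    unfolding halo_restrict_words
    by (rule W.halo_module_of_operators(2)) (use eps_eps[OF V] that in auto)
qed

lemma linear_halo_restrict [simp]:
  "linear_maps K (halo_restrict K G V) (halo_restrict K G W) = linear_maps K V W"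
  "linear_maps K M (halo_restrict K G W) = linear_maps K M W"
  "linear_maps K (halo_restrict K G V) N = linear_maps K V N"
  by (simp_all add: linear_maps_def)

lemma halo_restrict_homI:
  assumes V: "is_rep K G E \<phi> V" and W: "is_rep K G E \<phi> W" and f: "f \<in> linear_maps K V W"
    and "\<And>\<alpha> v. \<alpha> \<in> E \<Longrightarrow> v \<in> carrier V \<Longrightarrow> f (eps V \<alpha> v) = eps W \<alpha> (f v)"
  shows "f \<in> op_hom K (carrier (halo_algebra K E)) (halo_restrict K G V) (halo_restrict K G W)"
  by (rule K.halo_homI[OF halo_restrict_module(1)[OF V] halo_restrict_module(1)[OF W]])
    (use assms halo_restrict_module(2)[OF V] halo_restrict_module(2)[OF W] linear_mapsD(1)[OF f] in auto)

lemma halo_restrict_homD: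
  assumes V: "is_rep K G E \<phi> V" and W: "is_rep K G E \<phi> W"
    and f: "f \<in> op_hom K (carrier (halo_algebra K E)) (halo_restrict K G V) (halo_restrict K G W)"
  shows "f \<in> linear_maps K V W"
    and "\<alpha> \<in> E \<Longrightarrow> v \<in> carrier V \<Longrightarrow> f (eps V \<alpha> v) = eps W \<alpha> (f v)"
proof -
  show l: "f \<in> linear_maps K V W" using op_homD(1)[OF f] by simp
  show "f (eps V \<alpha> v) = eps W \<alpha> (f v)" if "\<alpha> \<in> E" "v \<in> carrier V"
    using op_homD(3)[OF f K.halo_gen_carrier[OF that(1)], of v] that
      halo_restrict_module(2)[OF V] halo_restrict_module(2)[OF W] linear_mapsD(1)[OF l] by simp
qed

lemma rep_hom_halo_hom:
  assumes V: "is_rep K G E \<phi> V" and W: "is_rep K G E \<phi> W" and f: "f \<in> op_hom K (rep_ops G E) V W"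
  shows "f \<in> op_hom K (carrier (halo_algebra K E)) (halo_restrict K G V) (halo_restrict K G W)"
  using rep_homD(1)[OF f] by (intro halo_restrict_homI[OF V W op_homD(1)[OF f]])


section \<open>Test objects for injectivity\<close>

text \<open>Transport of structure along an injection of the underlying set, which moves a test object
  into the type in which injectivity is tested.\<close>

definition transport :: "('a \<Rightarrow> 'b) \<Rightarrow> ('k, 'a, 's) opmod \<Rightarrow> ('k, 'b, 's) opmod" where
  "transport enc M = (let dec = inv_into (carrier M) enc in
    \<lparr>carrier = enc ` carrier M, monoid.mult = undefined, one = undefined, zero = enc \<zero>\<^bsub>M\<^esub>,
     add = (\<lambda>x y. enc (dec x \<oplus>\<^bsub>M\<^esub> dec y)), smult = (\<lambda>k x. enc (k \<odot>\<^bsub>M\<^esub> dec x)),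
     act = (\<lambda>s x. enc (act M s (dec x)))\<rparr>)"

lemma transport_rep:
  assumes V: "is_rep K G E \<phi> V" and inj: "inj_on enc (carrier V)"
  shows "is_rep K G E \<phi> (transport enc V)"
proof -
  interpret V: module K V by (rule repD(1)[OF V])
  let ?dec = "inv_into (carrier V) enc" and ?T = "transport enc V"
  have [simp]: "?dec (enc v) = v" if "v \<in> carrier V" for v using inj that by simp
  have car: "carrier ?T = enc ` carrier V" and ops: "zero ?T = enc \<zero>\<^bsub>V\<^esub>"
    "x \<oplus>\<^bsub>?T\<^esub> y = enc (?dec x \<oplus>\<^bsub>V\<^esub> ?dec y)" "k \<odot>\<^bsub>?T\<^esub> x = enc (k \<odot>\<^bsub>V\<^esub> ?dec x)" for x y k
    by (simp_all add: transport_def Let_def)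
  have lr: "lam ?T x = (\<lambda>v. enc (lam V x (?dec v)))" "rho ?T x = (\<lambda>v. enc (rho V x (?dec v)))" for x
    by (simp_all add: transport_def Let_def lam_def rho_def)
  have mod: "module K ?T"
  proof (rule moduleI)
    show "cring K" by (rule cring)
    show "abelian_group ?T"
    proof (rule abelian_groupI)
      fix x assume "x \<in> carrier ?T"
      then obtain v where v: "v \<in> carrier V" "x = enc v" unfolding car by blast
      then show "\<exists>y\<in>carrier ?T. y \<oplus>\<^bsub>?T\<^esub> x = \<zero>\<^bsub>?T\<^esub>"
        unfolding car by (intro bexI[of _ "enc (\<ominus>\<^bsub>V\<^esub> v)"]) (auto simp: ops V.l_neg)
    qed (auto simp: car ops V.M.a_ac)
  qed (auto simp: car ops V.smult_l_distr V.smult_r_distr V.smult_assoc1)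
  note r = repD[OF V]
  have lin: "(\<lambda>v. enc (f (?dec v))) \<in> linear_maps K ?T ?T" if "f \<in> linear_maps K V V" for f
    by (rule linear_mapsI) (use linear_mapsD[OF that] in \<open>auto simp: car ops\<close>)
  have bij: "bij_betw (\<lambda>v. enc (f (?dec v))) (carrier ?T) (carrier ?T)"
    if f: "bij_betw f (carrier V) (carrier V)" for f
  proof -
    have "bij_betw ?dec (enc ` carrier V) (carrier V)"
      by (rule bij_betw_inv_into) (simp add: bij_betw_def inj)
    then have "bij_betw (enc \<circ> (f \<circ> ?dec)) (enc ` carrier V) (enc ` carrier V)"
      using f inj by (intro bij_betw_trans) (auto simp: bij_betw_def)
    then show ?thesis by (simp add: car comp_def)
  qed
  note cl = linear_mapsD(1)[OF r(2)] linear_mapsD(1)[OF r(3)]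
  show ?thesis
    unfolding is_rep_def lr
  proof (intro conjI ballI)
    fix x assume x: "x \<in> dig G E"
    show "(\<lambda>v. enc (lam V x (?dec v))) \<in> linear_maps K ?T ?T" "(\<lambda>v. enc (rho V x (?dec v))) \<in> linear_maps K ?T ?T"
      using r(2,3)[OF x] lin by auto
    show "bij_betw (\<lambda>v. enc (rho V x (?dec v))) (carrier ?T) (carrier ?T)"
      using V x unfolding is_rep_def by (intro bij) blast
    fix y v assume y: "y \<in> dig G E" and "v \<in> carrier ?T"
    then obtain w where w: "w \<in> carrier V" "v = enc w" unfolding car by blast
    then show "enc (lam V (dig_dashv G x y) (?dec v)) = enc (lam V x (?dec (enc (lam V y (?dec v)))))"
      "enc (rho V (dig_vdash G \<phi> x y) (?dec v)) = enc (rho V x (?dec (enc (rho V y (?dec v)))))"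
      "enc (rho V x (?dec (enc (lam V y (?dec v))))) = enc (lam V (dig_vdash G \<phi> x y) (?dec v))"
      "enc (lam V x (?dec (enc (rho V y (?dec v))))) = enc (lam V (dig_dashv G x y) (?dec v))"
      using r(4)[OF x y w(1)] r(5)[OF x y w(1)] r(6)[OF x y w(1)] r(7)[OF x y w(1)] cl[OF y w(1)] by simp_all
  next
    fix x v assume "x \<in> dig_halo G E" "v \<in> carrier ?T"
    then show "enc (rho V x (?dec v)) = v" using r(8) by (auto simp: car dig_halo_def)
  qed (rule mod)
qed

lemma transport_hom:
  assumes inj: "inj_on enc (carrier M)" and M: "operator_module K S M" and f: "f \<in> op_hom K S M N"
  shows "(\<lambda>x. f (inv_into (carrier M) enc x)) \<in> op_hom K S (transport enc M) N"
  and "enc \<in> op_hom K S M (transport enc M)"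
proof -
  interpret M: module K M by (rule operator_moduleD(1)[OF M])
  show "(\<lambda>x. f (inv_into (carrier M) enc x)) \<in> op_hom K S (transport enc M) N"
    by (intro op_homI linear_mapsI)
      (use inj op_homD(2,3)[OF f] linear_mapsD[OF op_homD(1)[OF f]] operator_moduleD(3)[OF M]
        in \<open>auto simp: transport_def Let_def\<close>)
  show "enc \<in> op_hom K S M (transport enc M)"
    by (intro op_homI linear_mapsI) (use inj in \<open>auto simp: transport_def Let_def\<close>)
qed

lemma injective_objectD:
  assumes "injective_object K S Obj I" "Obj A" "Obj B" "i \<in> op_hom K S A B" "inj_on i (carrier A)"
    "f \<in> op_hom K S A I"
  shows "\<exists>h \<in> op_hom K S B I. \<forall>a \<in> carrier A. h (i a) = f a"
  using assms unfolding injective_object_def by blast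

text \<open>Test objects may come from any type, as long as the larger object can be coded in the type of \<open>V\<close>;
  the smaller one is coded through its image.\<close>

lemma injective_object_large_test:
  fixes A B :: "('k, 'g, 'e, 'x) dig_rep" and V :: "('k, 'g, 'e, 'v) dig_rep"
  assumes V: "injective_object K (rep_ops G E) (is_rep K G E \<phi>) V"
    and A: "is_rep K G E \<phi> A" and B: "is_rep K G E \<phi> B"
    and i: "i \<in> op_hom K (rep_ops G E) A B" "inj_on i (carrier A)"
    and f: "f \<in> op_hom K (rep_ops G E) A V"
    and enc: "inj_on (enc :: 'x \<Rightarrow> 'v) (carrier B)"
  shows "\<exists>h \<in> op_hom K (rep_ops G E) B V. \<forall>a \<in> carrier A. h (i a) = f a"
proof -
  let ?encA = "\<lambda>a. enc (i a)"
  have encA: "inj_on ?encA (carrier A)"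
    using i enc op_homD(2)[OF i(1)] by (auto simp: inj_on_def)
  let ?A = "transport ?encA A" and ?B = "transport enc B"
  have reps: "is_rep K G E \<phi> ?A" "is_rep K G E \<phi> ?B" by (rule transport_rep A B encA enc)+
  let ?f = "\<lambda>x. f (inv_into (carrier A) ?encA x)"
  have f': "?f \<in> op_hom K (rep_ops G E) ?A V" by (rule transport_hom(1)[OF encA rep_operator[OF A] f])
  let ?i = "\<lambda>x. enc (i (inv_into (carrier A) ?encA x))"
  have i': "?i \<in> op_hom K (rep_ops G E) ?A ?B"
    by (rule transport_hom(1)[OF encA rep_operator[OF A] op_hom_comp[OF i(1) transport_hom(2)[OF enc rep_operator[OF B] op_hom_id]]])
  have car: "carrier ?A = ?encA ` carrier A" by (simp add: transport_def Let_def)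
  have "?i y = y" if "y \<in> carrier ?A" for y
    using f_inv_into_f[of y ?encA "carrier A"] that by (simp add: car)
  then have inj: "inj_on ?i (carrier ?A)" by (auto simp: inj_on_def)
  obtain h where h: "h \<in> op_hom K (rep_ops G E) ?B V" "\<And>a. a \<in> carrier ?A \<Longrightarrow> h (?i a) = ?f a"
    using injective_objectD[OF V reps i' inj f'] by (rule bexE) blast
  define k where "k = (\<lambda>b. h (enc b))"
  have 1: "k (i a) = f a" if "a \<in> carrier A" for a
    using h(2)[of "?encA a"] that inv_into_f_f[OF encA that] by (simp add: car k_def)
  have 2: "k \<in> op_hom K (rep_ops G E) B V"
    using op_hom_comp[OF transport_hom(2)[OF enc rep_operator[OF B] op_hom_id] h(1)] by (simp add: k_def)
  show ?thesis by (rule bexI[OF _ 2]) (simp add: 1)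
qed

end

section \<open>Induced representations and injectivity over the halo algebra\<close>

text \<open>An injective pairing, iterated along the list, codes lists of a given length; the length is
  recorded separately.\<close>

lemma infinite_list_code:
  assumes "infinite (UNIV :: 'u set)"
  shows "\<exists>c :: 'u list \<Rightarrow> 'u. inj c"
proof -
  from card_of_Times_same_infinite[OF assms] obtain p :: "'u \<times> 'u \<Rightarrow> 'u" where p: "inj p"
    unfolding card_of_ordIso[symmetric] bij_betw_def by auto
  from assms obtain v :: "nat \<Rightarrow> 'u" where v: "inj v" using infinite_countable_subset by blast
  define t where "t = (\<lambda>xs. foldr (\<lambda>x y. p (x, y)) xs (v 0))"
  have t: "xs = ys" if "length xs = length ys" "t xs = t ys" for xs ys
    using that
  proof (induction xs ys rule: list_induct2)
    case (Cons x xs y ys)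
    have "p (x, t xs) = p (y, t ys)" using Cons.prems by (simp add: t_def)
    from injD[OF p this] Cons.IH show ?case by simp
  qed simp
  have "inj (\<lambda>xs. p (v (length xs), t xs))"
  proof (rule injI)
    fix xs ys assume "p (v (length xs), t xs) = p (v (length ys), t ys)"
    from injD[OF p this] have "v (length xs) = v (length ys)" "t xs = t ys" by auto
    then show "xs = ys" using injD[OF v] t by blast
  qed
  then show ?thesis by blast
qed

text \<open>A function of finite support is coded by an enumeration of its graph over the support.\<close>

lemma finite_support_code:
  fixes \<gamma> :: "'g \<Rightarrow> 'u"
  assumes "infinite (UNIV :: 'u set)" "inj_on \<gamma> X"
  shows "\<exists>enc :: ('g \<Rightarrow> 'u) \<Rightarrow> 'u. inj_on enc {F. finite {g. F g \<noteq> z} \<and> {g. F g \<noteq> z} \<subseteq> X}"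
proof -
  obtain c :: "'u list \<Rightarrow> 'u" where c: "inj c" using infinite_list_code[OF assms(1)] by blast
  \<comment> \<open>a point of the graph, written as a list of length two\<close>
  define pairs where "pairs F = (\<lambda>g. [\<gamma> g, F g]) ` {g. F g \<noteq> z}" for F :: "'g \<Rightarrow> 'u"
  define code where "code F = c (map c (SOME xs. set xs = pairs F))" for F :: "'g \<Rightarrow> 'u"
  have "inj_on code {F. finite {g. F g \<noteq> z} \<and> {g. F g \<noteq> z} \<subseteq> X}"
  proof (rule inj_onI, clarify)
    fix F F' :: "'g \<Rightarrow> 'u"
    assume F: "finite {g. F g \<noteq> z}" "{g. F g \<noteq> z} \<subseteq> X" and F': "finite {g. F' g \<noteq> z}" "{g. F' g \<noteq> z} \<subseteq> X"
      and eq: "code F = code F'"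
    have s: "set (SOME xs. set xs = pairs F) = pairs F" "set (SOME xs. set xs = pairs F') = pairs F'"
      using F(1) F'(1) by (auto intro!: someI_ex[OF finite_list] simp: pairs_def)
    have "(SOME xs. set xs = pairs F) = (SOME xs. set xs = pairs F')"
      using eq c unfolding code_def by (simp add: inj_eq)
    then have p: "pairs F = pairs F'" using s by metis
    show "F = F'"
    proof
      fix g
      have *: "F' g = F g" if "F g \<noteq> z" "pairs F = pairs F'" "{g. F g \<noteq> z} \<subseteq> X" "{g. F' g \<noteq> z} \<subseteq> X"
        for F F' :: "'g \<Rightarrow> 'u"
      proof -
        have "[\<gamma> g, F g] \<in> pairs F'" using that by (auto simp: pairs_def)
        then obtain g' where "F' g' \<noteq> z" "\<gamma> g = \<gamma> g'" "F g = F' g'" by (auto simp: pairs_def)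
        moreover from this have "g = g'" using that by (intro inj_onD[OF assms(2)]) auto
        ultimately show ?thesis by simp
      qed
      from *[of F F'] *[of F' F] p F F' show "F g = F' g" by fastforce
    qed
  qed
  then show ?thesis by blast
qed

context digroup_setting
begin

definition ind_space :: "('k, 'v, ('e list \<Rightarrow> 'k) set) opmod \<Rightarrow> ('k, 'g \<Rightarrow> 'v) module" where
  "ind_space A = \<lparr>carrier = {F. (\<forall>g. F g \<in> carrier A) \<and> (\<forall>g. g \<notin> carrier G \<longrightarrow> F g = \<zero>\<^bsub>A\<^esub>) \<and>
       finite {g. F g \<noteq> \<zero>\<^bsub>A\<^esub>}},
     monoid.mult = undefined, one = undefined, zero = (\<lambda>g. \<zero>\<^bsub>A\<^esub>),
     add = (\<lambda>F F' g. F g \<oplus>\<^bsub>A\<^esub> F' g), smult = (\<lambda>k F g. k \<odot>\<^bsub>A\<^esub> F g)\<rparr>"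

definition ind_eps :: "('k, 'v, ('e list \<Rightarrow> 'k) set) opmod \<Rightarrow> 'e \<Rightarrow> ('g \<Rightarrow> 'v) \<Rightarrow> 'g \<Rightarrow> 'v" where
  "ind_eps A \<alpha> F g = (if g \<in> carrier G then act A (halo_gen K E (\<phi> (inv\<^bsub>G\<^esub> g) \<alpha>)) (F g) else \<zero>\<^bsub>A\<^esub>)"

definition ind_rho :: "('k, 'v, ('e list \<Rightarrow> 'k) set) opmod \<Rightarrow> 'g \<Rightarrow> ('g \<Rightarrow> 'v) \<Rightarrow> 'g \<Rightarrow> 'v" where
  "ind_rho A h F g = (if g \<in> carrier G then F (inv\<^bsub>G\<^esub> h \<otimes>\<^bsub>G\<^esub> g) else \<zero>\<^bsub>A\<^esub>)"

text \<open>The representation induced from a module \<open>A\<close> over the halo algebra: \<open>F\<close> stands for the sum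
  of the \<open>\<rho>\<^bsub>g\<^esub> \<otimes> F g\<close>, and \<open>\<epsilon>\<^bsub>\<alpha>\<^esub> \<rho>\<^bsub>g\<^esub> = \<rho>\<^bsub>g\<^esub> \<epsilon>\<^bsub>\<beta>\<^esub>\<close> with \<open>\<beta>\<close> the translate of \<open>\<alpha>\<close> by the
  inverse of \<open>g\<close>.\<close>

definition induced :: "('k, 'v, ('e list \<Rightarrow> 'k) set) opmod \<Rightarrow> ('k, 'g, 'e, 'g \<Rightarrow> 'v) dig_rep" where
  "induced A = with_act (ind_space A)
     (case_sum (\<lambda>(g, \<alpha>) F. ind_eps A \<alpha> (ind_rho A g F)) (\<lambda>(g, \<alpha>). ind_rho A g))"

lemma ind_space_simps [simp]:
  "carrier (ind_space A) = {F. (\<forall>g. F g \<in> carrier A) \<and> (\<forall>g. g \<notin> carrier G \<longrightarrow> F g = \<zero>\<^bsub>A\<^esub>) \<and>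
       finite {g. F g \<noteq> \<zero>\<^bsub>A\<^esub>}}"
  "zero (ind_space A) = (\<lambda>g. \<zero>\<^bsub>A\<^esub>)" "add (ind_space A) = (\<lambda>F F' g. F g \<oplus>\<^bsub>A\<^esub> F' g)"
  "smult (ind_space A) = (\<lambda>k F g. k \<odot>\<^bsub>A\<^esub> F g)"
  by (simp_all add: ind_space_def)

lemma induced_simps:
  "carrier (induced A) = carrier (ind_space A)" "add (induced A) = add (ind_space A)"
  "smult (induced A) = smult (ind_space A)" "zero (induced A) = zero (ind_space A)"
  by (simp_all add: induced_def)

text \<open>Induction is left adjoint to restriction, with unit \<open>ind_unit\<close>.\<close>

definition ind_extend :: "('k, 'v, ('e list \<Rightarrow> 'k) set) opmod \<Rightarrow> ('k, 'g, 'e, 'w) dig_rep \<Rightarrow> ('v \<Rightarrow> 'w)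
    \<Rightarrow> ('g \<Rightarrow> 'v) \<Rightarrow> 'w" where
  "ind_extend A V f F = (\<Oplus>\<^bsub>V\<^esub>g \<in> {g. F g \<noteq> \<zero>\<^bsub>A\<^esub>}. rg V g (f (F g)))"

definition ind_unit :: "('k, 'v, ('e list \<Rightarrow> 'k) set) opmod \<Rightarrow> 'v \<Rightarrow> 'g \<Rightarrow> 'v" where
  "ind_unit A a g = (if g = \<one>\<^bsub>G\<^esub> then a else \<zero>\<^bsub>A\<^esub>)"

context
  fixes A :: "('k, 'v, ('e list \<Rightarrow> 'k) set) opmod"
  assumes A: "is_halo_module K E A"
begin

interpretation A: module K A by (rule halo_moduleD(2)[OF A])

lemma gen_linear: "\<alpha> \<in> E \<Longrightarrow> act A (halo_gen K E \<alpha>) \<in> linear_maps K A A"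
  by (rule operator_moduleD(2)[OF halo_moduleD(1)[OF A] K.halo_gen_carrier])

lemmas gen_simps = linear_mapsD[OF gen_linear] linear_zero[OF A.module_axioms A.module_axioms gen_linear]

lemma ind_space_module: "module K (ind_space A)"
proof (rule moduleI)
  show "cring K" by (rule cring)
  show "abelian_group (ind_space A)"
  proof (rule abelian_groupI)
    fix F F' assume "F \<in> carrier (ind_space A)" "F' \<in> carrier (ind_space A)"
    then show "F \<oplus>\<^bsub>ind_space A\<^esub> F' \<in> carrier (ind_space A)"
      by (auto intro: finite_subset[of _ "{g. F g \<noteq> \<zero>\<^bsub>A\<^esub>} \<union> {g. F' g \<noteq> \<zero>\<^bsub>A\<^esub>}"])
  next
    fix F assume "F \<in> carrier (ind_space A)"
    then show "\<exists>F'\<in>carrier (ind_space A). F' \<oplus>\<^bsub>ind_space A\<^esub> F = \<zero>\<^bsub>ind_space A\<^esub>"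
      by (intro bexI[of _ "\<lambda>g. \<ominus>\<^bsub>A\<^esub> F g"])
        (auto simp: A.l_neg intro: finite_subset[of _ "{g. F g \<noteq> \<zero>\<^bsub>A\<^esub>}"])
  qed (auto simp: A.M.a_ac)
next
  fix k F assume "k \<in> carrier K" "F \<in> carrier (ind_space A)"
  then show "k \<odot>\<^bsub>ind_space A\<^esub> F \<in> carrier (ind_space A)"
    by (auto intro: finite_subset[of _ "{g. F g \<noteq> \<zero>\<^bsub>A\<^esub>}"])
qed (auto simp: A.smult_l_distr A.smult_r_distr A.smult_assoc1)

lemma ind_eps_linear: "\<alpha> \<in> E \<Longrightarrow> ind_eps A \<alpha> \<in> linear_maps K (ind_space A) (ind_space A)"
proof (rule linear_mapsI)
  fix F assume a: "\<alpha> \<in> E" "F \<in> carrier (ind_space A)"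
  have "finite {g. ind_eps A \<alpha> F g \<noteq> \<zero>\<^bsub>A\<^esub>}"
    by (rule finite_subset[of _ "{g. F g \<noteq> \<zero>\<^bsub>A\<^esub>}"]) (use a in \<open>auto simp: ind_eps_def gen_simps action_closed\<close>)
  then show "ind_eps A \<alpha> F \<in> carrier (ind_space A)"
    using a by (auto simp: ind_eps_def gen_simps action_closed)
qed (auto simp: fun_eq_iff ind_eps_def gen_simps action_closed)

lemma ind_rho_support:
  assumes "h \<in> carrier G" "F \<in> carrier (ind_space A)"
  shows "{g. ind_rho A h F g \<noteq> \<zero>\<^bsub>A\<^esub>} = (\<lambda>g. h \<otimes>\<^bsub>G\<^esub> g) ` {g. F g \<noteq> \<zero>\<^bsub>A\<^esub>}"
proof (intro equalityI subsetI)
  fix g assume "g \<in> {g. ind_rho A h F g \<noteq> \<zero>\<^bsub>A\<^esub>}"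
  then have "g \<in> carrier G" "F (inv\<^bsub>G\<^esub> h \<otimes>\<^bsub>G\<^esub> g) \<noteq> \<zero>\<^bsub>A\<^esub>" by (auto simp: ind_rho_def split: if_splits)
  then show "g \<in> (\<lambda>g. h \<otimes>\<^bsub>G\<^esub> g) ` {g. F g \<noteq> \<zero>\<^bsub>A\<^esub>}"
    using assms by (intro image_eqI[of _ _ "inv\<^bsub>G\<^esub> h \<otimes>\<^bsub>G\<^esub> g"]) (auto simp flip: G.m_assoc)
next
  fix g assume "g \<in> (\<lambda>g. h \<otimes>\<^bsub>G\<^esub> g) ` {g. F g \<noteq> \<zero>\<^bsub>A\<^esub>}"
  then obtain g' where "F g' \<noteq> \<zero>\<^bsub>A\<^esub>" "g = h \<otimes>\<^bsub>G\<^esub> g'" by auto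
  moreover from this have "g' \<in> carrier G" using assms by auto
  ultimately show "g \<in> {g. ind_rho A h F g \<noteq> \<zero>\<^bsub>A\<^esub>}"
    using assms(1) by (auto simp: ind_rho_def simp flip: G.m_assoc)
qed

lemma ind_rho_linear: "h \<in> carrier G \<Longrightarrow> ind_rho A h \<in> linear_maps K (ind_space A) (ind_space A)"
proof (rule linear_mapsI)
  fix F assume a: "h \<in> carrier G" "F \<in> carrier (ind_space A)"
  have "finite {g. ind_rho A h F g \<noteq> \<zero>\<^bsub>A\<^esub>}"
    unfolding ind_rho_support[OF a] using a by auto
  then show "ind_rho A h F \<in> carrier (ind_space A)"
    using a by (auto simp: ind_rho_def)
qed (auto simp: fun_eq_iff ind_rho_def)

lemma ind_rep:
  shows "is_rep K G E \<phi> (induced A)"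
    and "\<alpha> \<in> E \<Longrightarrow> F \<in> carrier (ind_space A) \<Longrightarrow> eps (induced A) \<alpha> F = ind_eps A \<alpha> F"
    and "rg (induced A) g F = ind_rho A g F"
proof -
  have ee: "ind_eps A \<alpha> (ind_eps A \<beta> F) = ind_eps A \<alpha> F"
    if "\<alpha> \<in> E" "\<beta> \<in> E" "F \<in> carrier (ind_space A)" for \<alpha> \<beta> F
    using that K.halo_module_relation[OF A] by (auto simp: fun_eq_iff ind_eps_def action_closed)
  have r1: "ind_rho A \<one>\<^bsub>G\<^esub> F = F" if "F \<in> carrier (ind_space A)" for F
    using that by (auto simp: fun_eq_iff ind_rho_def)
  have rr: "ind_rho A (g \<otimes>\<^bsub>G\<^esub> h) F = ind_rho A g (ind_rho A h F)"
    if "g \<in> carrier G" "h \<in> carrier G" "F \<in> carrier (ind_space A)" for g h F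
    using that by (auto simp: fun_eq_iff ind_rho_def G.inv_mult_group G.m_assoc)
  have re: "ind_rho A g (ind_eps A \<alpha> F) = ind_eps A (\<phi> g \<alpha>) (ind_rho A g F)"
    if "g \<in> carrier G" "\<alpha> \<in> E" "F \<in> carrier (ind_space A)" for g \<alpha> F
    using that by (auto simp: fun_eq_iff ind_rho_def ind_eps_def G.inv_mult_group action_mult)
  note * = rep_of_operators[OF ind_space_module ind_eps_linear ind_rho_linear ee r1 rr re, folded induced_def]
  show "is_rep K G E \<phi> (induced A)"
    and "\<alpha> \<in> E \<Longrightarrow> F \<in> carrier (ind_space A) \<Longrightarrow> eps (induced A) \<alpha> F = ind_eps A \<alpha> F"
    and "rg (induced A) g F = ind_rho A g F"
    by (rule *; assumption)+
qed

context
  fixes V :: "('k, 'g, 'e, 'w) dig_rep" and f :: "'v \<Rightarrow> 'w"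
  assumes V: "is_rep K G E \<phi> V"
    and f: "f \<in> op_hom K (carrier (halo_algebra K E)) A (halo_restrict K G V)"
begin

interpretation V: module K V by (rule repD(1)[OF V])

lemma f_linear: "f \<in> linear_maps K A V"
  using op_homD(1)[OF f] by simp

lemmas f_simps = linear_mapsD[OF f_linear] linear_zero[OF A.module_axioms V.module_axioms f_linear]
lemmas rg_simps = linear_mapsD[OF rg_linear[OF V]] linear_zero[OF V.module_axioms V.module_axioms rg_linear[OF V]]

lemma f_gen: "\<alpha> \<in> E \<Longrightarrow> a \<in> carrier A \<Longrightarrow> f (act A (halo_gen K E \<alpha>) a) = eps V \<alpha> (f a)"
  using op_homD(3)[OF f K.halo_gen_carrier] halo_restrict_module(2)[OF V] f_simps(1) by simp

lemma ind_extend_superset: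
  assumes "F \<in> carrier (ind_space A)" "finite X" "{g. F g \<noteq> \<zero>\<^bsub>A\<^esub>} \<subseteq> X" "X \<subseteq> carrier G"
  shows "ind_extend A V f F = (\<Oplus>\<^bsub>V\<^esub>g \<in> X. rg V g (f (F g)))"
  unfolding ind_extend_def
  by (rule V.M.add.finprod_mono_neutral_cong_left)
    (use assms f_simps rg_simps in \<open>auto simp: subset_iff\<close>)

text \<open>\<open>G\<close> permutes the summands \<open>\<rho>\<^bsub>g\<^esub> (f (F g))\<close> by translation of the index, and \<open>\<epsilon>\<^bsub>\<alpha>\<^esub>\<close> preserves each of
  them because it becomes \<open>\<epsilon>\<close> at the translate of \<open>\<alpha>\<close> when it is moved past \<open>\<rho>\<^bsub>g\<^esub>\<close>.\<close>

lemma ind_extend_hom: "ind_extend A V f \<in> op_hom K (rep_ops G E) (induced A) V"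
proof (rule rep_homI[OF ind_rep(1) V])
  have sub: "{g. F g \<noteq> \<zero>\<^bsub>A\<^esub>} \<subseteq> carrier G" if "F \<in> carrier (ind_space A)" for F
    using that by auto
  have summand: "rg V g (f (F g)) \<in> carrier V" if "F \<in> carrier (ind_space A)" "g \<in> carrier G" for F g
    using that f_simps rg_simps by auto
  show "ind_extend A V f \<in> linear_maps K (induced A) V"
  proof (rule linear_mapsI)
    fix F F' assume F: "F \<in> carrier (induced A)" "F' \<in> carrier (induced A)"
    let ?X = "{g. F g \<noteq> \<zero>\<^bsub>A\<^esub>} \<union> {g. F' g \<noteq> \<zero>\<^bsub>A\<^esub>}"
    have X: "finite ?X" "?X \<subseteq> carrier G" and F'': "F \<in> carrier (ind_space A)" "F' \<in> carrier (ind_space A)"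
      using F by (auto simp: induced_simps)
    then have s: "F \<oplus>\<^bsub>ind_space A\<^esub> F' \<in> carrier (ind_space A)"
      using ind_space_module abelian_monoid.a_closed abelian_group.axioms(1) module_abelian by metis
    have "ind_extend A V f (F \<oplus>\<^bsub>induced A\<^esub> F') = (\<Oplus>\<^bsub>V\<^esub>g \<in> ?X. rg V g (f ((F \<oplus>\<^bsub>ind_space A\<^esub> F') g)))"
      unfolding induced_simps by (rule ind_extend_superset[OF s X(1) _ X(2)]) (use F'' in auto)
    also have "\<dots> = (\<Oplus>\<^bsub>V\<^esub>g \<in> ?X. rg V g (f (F g)) \<oplus>\<^bsub>V\<^esub> rg V g (f (F' g)))"
    proof (rule V.M.finsum_cong')
      have FA: "F g \<in> carrier A" "F' g \<in> carrier A" for g using F'' by auto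
      show "rg V g (f ((F \<oplus>\<^bsub>ind_space A\<^esub> F') g)) = rg V g (f (F g)) \<oplus>\<^bsub>V\<^esub> rg V g (f (F' g))"
        if "g \<in> ?X" for g
        using subsetD[OF X(2) that] FA by (simp add: f_simps rg_simps)
      show "(\<lambda>g. rg V g (f (F g)) \<oplus>\<^bsub>V\<^esub> rg V g (f (F' g))) \<in> ?X \<rightarrow> carrier V"
        using summand[OF F''(1)] summand[OF F''(2)] X(2) by blast
    qed simp
    also have "\<dots> = (\<Oplus>\<^bsub>V\<^esub>g \<in> ?X. rg V g (f (F g))) \<oplus>\<^bsub>V\<^esub> (\<Oplus>\<^bsub>V\<^esub>g \<in> ?X. rg V g (f (F' g)))"
      by (rule V.M.finsum_addf) (use F'' X summand in \<open>auto simp del: ind_space_simps\<close>)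
    also have "\<dots> = ind_extend A V f F \<oplus>\<^bsub>V\<^esub> ind_extend A V f F'"
      using ind_extend_superset[OF F''(1) X(1) _ X(2)] ind_extend_superset[OF F''(2) X(1) _ X(2)] by simp
    finally show "ind_extend A V f (F \<oplus>\<^bsub>induced A\<^esub> F') = ind_extend A V f F \<oplus>\<^bsub>V\<^esub> ind_extend A V f F'" .
  next
    fix k F assume k: "k \<in> carrier K" and "F \<in> carrier (induced A)"
    then have F: "F \<in> carrier (ind_space A)" and fin: "finite {g. F g \<noteq> \<zero>\<^bsub>A\<^esub>}" by (auto simp: induced_simps)
    have s: "k \<odot>\<^bsub>ind_space A\<^esub> F \<in> carrier (ind_space A)"
      using module.smult_closed[OF ind_space_module k F] .
    have "ind_extend A V f (k \<odot>\<^bsub>induced A\<^esub> F) = (\<Oplus>\<^bsub>V\<^esub>g \<in> {g. F g \<noteq> \<zero>\<^bsub>A\<^esub>}. rg V g (f ((k \<odot>\<^bsub>ind_space A\<^esub> F) g)))"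
      unfolding induced_simps by (rule ind_extend_superset[OF s fin _ sub[OF F]]) (use F k in auto)
    also have "\<dots> = (\<Oplus>\<^bsub>V\<^esub>g \<in> {g. F g \<noteq> \<zero>\<^bsub>A\<^esub>}. k \<odot>\<^bsub>V\<^esub> rg V g (f (F g)))"
      by (rule V.M.finsum_cong') (use F k summand sub[OF F] f_simps rg_simps in \<open>auto simp: subset_iff\<close>)
    also have "\<dots> = k \<odot>\<^bsub>V\<^esub> ind_extend A V f F"
      unfolding ind_extend_def
      by (rule V.finsum_smult_ldistr[symmetric, OF fin k]) (use summand[OF F] sub[OF F] in auto)
    finally show "ind_extend A V f (k \<odot>\<^bsub>induced A\<^esub> F) = k \<odot>\<^bsub>V\<^esub> ind_extend A V f F" .
  next
    fix F assume "F \<in> carrier (induced A)"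
    then have F: "F \<in> carrier (ind_space A)" by (simp add: induced_simps)
    show "ind_extend A V f F \<in> carrier V"
      unfolding ind_extend_def by (rule V.M.finsum_closed) (use summand[OF F] sub[OF F] in auto)
  qed
next
  fix \<alpha> F assume \<alpha>: "\<alpha> \<in> E" and "F \<in> carrier (induced A)"
  then have F: "F \<in> carrier (ind_space A)" and fin: "finite {g. F g \<noteq> \<zero>\<^bsub>A\<^esub>}" by (auto simp: induced_simps)
  have sub: "{g. F g \<noteq> \<zero>\<^bsub>A\<^esub>} \<subseteq> carrier G" using F by auto
  have summand: "rg V g (f (F g)) \<in> carrier V" if "g \<in> carrier G" for g
    using that F f_simps rg_simps by auto
  have FA: "F g \<in> carrier A" for g using F by simp
  have "ind_extend A V f (ind_eps A \<alpha> F) = (\<Oplus>\<^bsub>V\<^esub>g \<in> {g. F g \<noteq> \<zero>\<^bsub>A\<^esub>}. rg V g (f (ind_eps A \<alpha> F g)))"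
    by (rule ind_extend_superset[OF linear_mapsD(1)[OF ind_eps_linear[OF \<alpha>] F] fin _ sub])
      (use \<alpha> in \<open>auto simp: ind_eps_def gen_simps action_closed\<close>)
  also have "\<dots> = (\<Oplus>\<^bsub>V\<^esub>g \<in> {g. F g \<noteq> \<zero>\<^bsub>A\<^esub>}. eps V \<alpha> (rg V g (f (F g))))"
  proof (rule V.M.finsum_cong')
    fix g assume g: "g \<in> {g. F g \<noteq> \<zero>\<^bsub>A\<^esub>}"
    then have "g \<in> carrier G" using sub by blast
    moreover from this have "\<phi> g (\<phi> (inv\<^bsub>G\<^esub> g) \<alpha>) = \<alpha>" "\<phi> (inv\<^bsub>G\<^esub> g) \<alpha> \<in> E"
      using \<alpha> action_mult[of \<alpha> g "inv\<^bsub>G\<^esub> g"] action_one action_closed by auto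
    ultimately show "rg V g (f (ind_eps A \<alpha> F g)) = eps V \<alpha> (rg V g (f (F g)))"
      using FA f_simps(1) by (simp add: ind_eps_def f_gen rg_eps[OF V])
  qed (use summand sub \<alpha> in \<open>auto simp: eps_closed[OF V]\<close>)
  also have "\<dots> = eps V \<alpha> (ind_extend A V f F)"
    unfolding ind_extend_def
    by (rule linear_finsum[symmetric, OF V.module_axioms V.module_axioms eps_linear[OF V \<alpha>]]) (use summand sub in auto)
  finally show "ind_extend A V f (eps (induced A) \<alpha> F) = eps V \<alpha> (ind_extend A V f F)"
    using \<alpha> F by (simp add: ind_rep(2))
next
  fix h F assume h: "h \<in> carrier G" and "F \<in> carrier (induced A)"
  then have F: "F \<in> carrier (ind_space A)" by (auto simp: induced_simps)
  have sub: "{g. F g \<noteq> \<zero>\<^bsub>A\<^esub>} \<subseteq> carrier G" using F by auto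
  have FA: "F g \<in> carrier A" for g using F by simp
  have summand: "rg V g (f (F g)) \<in> carrier V" if "g \<in> carrier G" for g
    using that F f_simps rg_simps by auto
  have "ind_extend A V f (ind_rho A h F)
    = (\<Oplus>\<^bsub>V\<^esub>g \<in> (\<lambda>g. h \<otimes>\<^bsub>G\<^esub> g) ` {g. F g \<noteq> \<zero>\<^bsub>A\<^esub>}. rg V g (f (ind_rho A h F g)))"
    unfolding ind_extend_def ind_rho_support[OF h F] ..
  also have "\<dots> = (\<Oplus>\<^bsub>V\<^esub>g \<in> {g. F g \<noteq> \<zero>\<^bsub>A\<^esub>}. rg V (h \<otimes>\<^bsub>G\<^esub> g) (f (ind_rho A h F (h \<otimes>\<^bsub>G\<^esub> g))))"
    by (rule V.M.add.finprod_reindex)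
      (use sub h FA in \<open>auto simp: subset_iff inj_on_def ind_rho_def f_simps rg_simps\<close>)
  also have "\<dots> = (\<Oplus>\<^bsub>V\<^esub>g \<in> {g. F g \<noteq> \<zero>\<^bsub>A\<^esub>}. rg V h (rg V g (f (F g))))"
  proof (rule V.M.finsum_cong')
    fix g assume "g \<in> {g. F g \<noteq> \<zero>\<^bsub>A\<^esub>}"
    then have g: "g \<in> carrier G" using sub by blast
    then have "ind_rho A h F (h \<otimes>\<^bsub>G\<^esub> g) = F g" using h by (simp add: ind_rho_def flip: G.m_assoc)
    then show "rg V (h \<otimes>\<^bsub>G\<^esub> g) (f (ind_rho A h F (h \<otimes>\<^bsub>G\<^esub> g))) = rg V h (rg V g (f (F g)))"
      using rg_mult[OF V h g] f_simps(1) FA by simp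
  qed (use summand sub h in \<open>auto simp: rg_simps\<close>)
  also have "\<dots> = rg V h (ind_extend A V f F)"
    unfolding ind_extend_def
    by (rule linear_finsum[symmetric, OF V.module_axioms V.module_axioms rg_linear[OF V h]]) (use summand sub in auto)
  finally show "ind_extend A V f (rg (induced A) h F) = rg V h (ind_extend A V f F)"
    by (simp add: ind_rep(3))
qed

end

lemma ind_unit_carrier: "a \<in> carrier A \<Longrightarrow> ind_unit A a \<in> carrier (ind_space A)"
  by (auto simp: ind_unit_def intro: finite_subset[of _ "{\<one>\<^bsub>G\<^esub>}"])

lemma ind_unit_linear: "ind_unit A \<in> linear_maps K A (ind_space A)"
proof (rule linear_mapsI)
  show "ind_unit A a \<in> carrier (ind_space A)" if "a \<in> carrier A" for a using that by (rule ind_unit_carrier)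
qed (auto simp: fun_eq_iff ind_unit_def)

lemma ind_unit_gen:
  "\<alpha> \<in> E \<Longrightarrow> a \<in> carrier A \<Longrightarrow> ind_unit A (act A (halo_gen K E \<alpha>) a) = ind_eps A \<alpha> (ind_unit A a)"
  by (auto simp: fun_eq_iff ind_unit_def ind_eps_def gen_simps action_one action_closed)

lemma ind_extend_unit:
  fixes V :: "('k, 'g, 'e, 'w) dig_rep"
  assumes V: "is_rep K G E \<phi> V"
    and f: "f \<in> op_hom K (carrier (halo_algebra K E)) A (halo_restrict K G V)" and a: "a \<in> carrier A"
  shows "ind_extend A V f (ind_unit A a) = f a"
proof -
  interpret V: module K V by (rule repD(1)[OF V])
  have "f a \<in> carrier V" using f_simps(1)[OF V f a] .
  then show ?thesis
    by (subst ind_extend_superset[OF V f ind_unit_carrier[OF a], of "{\<one>\<^bsub>G\<^esub>}"])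
      (auto simp: ind_unit_def rg_one[OF V])
qed

end

lemma ind_map_hom:
  fixes A :: "('k, 'a, ('e list \<Rightarrow> 'k) set) opmod" and B :: "('k, 'b, ('e list \<Rightarrow> 'k) set) opmod"
  assumes A: "is_halo_module K E A" and B: "is_halo_module K E B"
    and i: "i \<in> op_hom K (carrier (halo_algebra K E)) A B"
  shows "(\<lambda>F g. i (F g)) \<in> op_hom K (rep_ops G E) (induced A) (induced B)"
proof (rule rep_homI[OF ind_rep(1)[OF A] ind_rep(1)[OF B]])
  note l = op_homD(1)[OF i]
  note s = linear_mapsD[OF l] linear_zero[OF halo_moduleD(2)[OF A] halo_moduleD(2)[OF B] l]
  have mem: "(\<lambda>g. i (F g)) \<in> carrier (ind_space B)" if "F \<in> carrier (ind_space A)" for F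
    using that s by (auto intro: finite_subset[of _ "{g. F g \<noteq> \<zero>\<^bsub>A\<^esub>}"])
  show "(\<lambda>F g. i (F g)) \<in> linear_maps K (induced A) (induced B)"
    unfolding linear_maps_def induced_simps using mem s by (auto simp: fun_eq_iff)
  show "(\<lambda>g. i (eps (induced A) \<alpha> F g)) = eps (induced B) \<alpha> (\<lambda>g. i (F g))"
    if "\<alpha> \<in> E" "F \<in> carrier (induced A)" for \<alpha> F
    using that mem[of F] s op_homD(3)[OF i K.halo_gen_carrier]
    by (auto simp: induced_simps ind_rep(2)[OF A] ind_rep(2)[OF B] ind_eps_def fun_eq_iff action_closed)
  show "(\<lambda>g. i (rg (induced A) h F g)) = rg (induced B) h (\<lambda>g. i (F g))"
    if "h \<in> carrier G" "F \<in> carrier (induced A)" for h F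
    using s by (auto simp: ind_rep(3)[OF A] ind_rep(3)[OF B] ind_rho_def fun_eq_iff)
qed

text \<open>Restriction has an exact left adjoint: a morphism to extend is turned into a morphism of induced
  representations, extended there, and pulled back along the unit.  The hypothesis on cardinalities
  makes the induced representations available as test objects.\<close>

lemma halo_restrict_injective:
  fixes V :: "('k, 'g, 'e, 'v) dig_rep" and \<gamma> :: "'g \<Rightarrow> 'v"
  assumes V: "injective_object K (rep_ops G E) (is_rep K G E \<phi>) V"
    and large: "infinite (UNIV :: 'v set)" "inj_on \<gamma> (carrier G)"
  shows "injective_object K (carrier (halo_algebra K E)) (is_halo_module K E) (halo_restrict K G V)"
proof -
  have Vr: "is_rep K G E \<phi> V" using V by (simp add: injective_object_def)
  have "\<exists>h \<in> op_hom K (carrier (halo_algebra K E)) B (halo_restrict K G V). \<forall>a \<in> carrier A. h (i a) = f a"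
    if A: "is_halo_module K E A" and B: "is_halo_module K E B"
      and i: "i \<in> op_hom K (carrier (halo_algebra K E)) A B" "inj_on i (carrier A)"
      and f: "f \<in> op_hom K (carrier (halo_algebra K E)) A (halo_restrict K G V)"
    for A B :: "('k, 'v, ('e list \<Rightarrow> 'k) set) opmod" and i f
  proof -
  obtain enc :: "('g \<Rightarrow> 'v) \<Rightarrow> 'v"
    where "inj_on enc {F. finite {g. F g \<noteq> \<zero>\<^bsub>B\<^esub>} \<and> {g. F g \<noteq> \<zero>\<^bsub>B\<^esub>} \<subseteq> carrier G}"
    using finite_support_code[OF large] by blast
  then have enc: "inj_on enc (carrier (induced B))"
    by (rule inj_on_subset) (auto simp: induced_simps)
  have inj: "inj_on (\<lambda>F g. i (F g)) (carrier (induced A))"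
    using i(2) by (auto simp: induced_simps inj_on_def fun_eq_iff)
  obtain h where h: "h \<in> op_hom K (rep_ops G E) (induced B) V"
    "\<And>F. F \<in> carrier (induced A) \<Longrightarrow> h (\<lambda>g. i (F g)) = ind_extend A V f F"
    using injective_object_large_test[OF V ind_rep(1)[OF A] ind_rep(1)[OF B] ind_map_hom[OF A B i(1)] inj
        ind_extend_hom[OF A Vr f] enc] by (rule bexE) blast
  define k where "k = (\<lambda>b. h (ind_unit B b))"
  have lin: "k \<in> linear_maps K B V"
    unfolding k_def
    by (rule linear_comp[OF ind_unit_linear[OF B]])
      (use op_homD(1)[OF h(1)] in \<open>simp add: linear_maps_def induced_simps\<close>)
  have "k \<in> op_hom K (carrier (halo_algebra K E)) B (halo_restrict K G V)"
  proof (rule K.halo_homI[OF B halo_restrict_module(1)[OF Vr]])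
    show "k \<in> linear_maps K B (halo_restrict K G V)" using lin by simp
    fix \<alpha> b assume "\<alpha> \<in> E" "b \<in> carrier B"
    then show "k (act B (halo_gen K E \<alpha>) b) = act (halo_restrict K G V) (halo_gen K E \<alpha>) (k b)"
      using linear_mapsD(1)[OF lin, of b] rep_homD(1)[OF h(1), of \<alpha> "ind_unit B b"]
        ind_unit_carrier[OF B, of b]
      by (simp add: halo_restrict_module(2)[OF Vr] k_def ind_unit_gen[OF B] ind_rep(2)[OF B]
          induced_simps del: ind_space_simps)
  qed
  moreover have "k (i a) = f a" if a: "a \<in> carrier A" for a
  proof -
    have "ind_unit B (i a) = (\<lambda>g. i (ind_unit A a g))"
      using linear_zero[OF halo_moduleD(2)[OF A] halo_moduleD(2)[OF B] op_homD(1)[OF i(1)]]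
      by (auto simp: ind_unit_def)
    then show ?thesis
      using h(2)[of "ind_unit A a"] ind_unit_carrier[OF A a] ind_extend_unit[OF A Vr f a]
      by (simp add: k_def induced_simps)
  qed
  ultimately show ?thesis by blast
  qed
  then show ?thesis using halo_restrict_module(1)[OF Vr] unfolding injective_object_def by blast
qed

end

section \<open>The derived functors of Hom over the halo algebra\<close>

locale operator_complex =
  fixes K :: "('k, 'm) ring_scheme" and S :: "'s set" and A :: "nat \<Rightarrow> ('k, 'v, 's) opmod"
    and \<delta> :: "nat \<Rightarrow> 'v \<Rightarrow> 'v"
  assumes operator: "operator_module K S (A n)"
    and diff_hom: "\<delta> n \<in> op_hom K S (A n) (A (Suc n))"
    and diff_diff': "x \<in> carrier (A n) \<Longrightarrow> \<delta> (Suc n) (\<delta> n x) = \<zero>\<^bsub>A (Suc (Suc n))\<^esub>"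
begin

sublocale cochain_complex K A \<delta>
  by (rule cochain_complex.intro)
    (use operator_moduleD(1)[OF operator] op_homD(1)[OF diff_hom] diff_diff' in auto)

lemma act_coboundaries: "s \<in> S \<Longrightarrow> x \<in> coboundaries A \<delta> q \<Longrightarrow> act (A q) s x \<in> coboundaries A \<delta> q"
  using linear_zero[OF mod mod operator_moduleD(2)[OF operator]]
  by (auto simp: coboundaries_def op_homD(3)[OF diff_hom, symmetric] operator_moduleD(3)[OF operator]
      split: nat.splits)

lemma act_cocycles: "s \<in> S \<Longrightarrow> x \<in> cocycles A \<delta> q \<Longrightarrow> act (A q) s x \<in> cocycles A \<delta> q"
  using linear_zero[OF mod mod operator_moduleD(2)[OF operator]]
  by (auto simp: cocycles_def op_homD(3)[OF diff_hom] operator_moduleD(3)[OF operator])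

lemma op_cohomology_simps:
  "carrier (op_cohomology A \<delta> q) = (\<lambda>x. coboundaries A \<delta> q +>\<^bsub>A q\<^esub> x) ` cocycles A \<delta> q"
  "zero (op_cohomology A \<delta> q) = coboundaries A \<delta> q"
  "add (op_cohomology A \<delta> q) = add (cohomology A \<delta> q)"
  "smult (op_cohomology A \<delta> q) = smult (cohomology A \<delta> q)"
  by (simp_all add: op_cohomology_def cohomology_simps)

lemma act_class:
  assumes "s \<in> S" "x \<in> carrier (A q)"
  shows "act (op_cohomology A \<delta> q) s (coboundaries A \<delta> q +>\<^bsub>A q\<^esub> x) = coboundaries A \<delta> q +>\<^bsub>A q\<^esub> act (A q) s x"
  unfolding op_cohomology_def cohomology_map_def with_act_simps
  by (rule coset_map_coset[OF mod mod operator_moduleD(2)[OF operator assms(1)]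
        coboundaries_submodule coboundaries_submodule act_coboundaries[OF assms(1)] assms(2)])

end

lemma cohomology_map_act:
  assumes "operator_complex K S A \<delta>" "operator_complex K S A' \<delta>'"
    and u: "\<And>n. u n \<in> op_hom K S (A n) (A' n)"
    and chain: "\<And>n x. x \<in> carrier (A n) \<Longrightarrow> u (Suc n) (\<delta> n x) = \<delta>' n (u n x)"
    and s: "s \<in> S" and X: "X \<in> carrier (op_cohomology A \<delta> q)"
  shows "cohomology_map A' \<delta>' q (u q) (act (op_cohomology A \<delta> q) s X)
    = act (op_cohomology A' \<delta>' q) s (cohomology_map A' \<delta>' q (u q) X)"
proof -
  interpret A: operator_complex K S A \<delta> by fact
  interpret A': operator_complex K S A' \<delta>' by fact
  interpret u: cochain_map K A \<delta> A' \<delta>' u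
    by (intro cochain_map.intro A.cochain_complex_axioms A'.cochain_complex_axioms cochain_map_axioms.intro)
      (use op_homD(1)[OF u] chain in auto)
  from X obtain x where x: "x \<in> cocycles A \<delta> q" "X = coboundaries A \<delta> q +>\<^bsub>A q\<^esub> x"
    unfolding A.op_cohomology_simps by blast
  note c = A.cocycles_carrier[OF x(1)]
  show ?thesis
    using c s by (simp add: x(2) A.act_class A'.act_class u.map_class op_homD[OF u]
        operator_moduleD(3)[OF A.operator])
qed

lemma is_gmodD:
  assumes "is_gmod K G M"
  shows "module K M" "operator_module K (carrier G) M"
    and "g \<in> carrier G \<Longrightarrow> act M g \<in> linear_maps K M M"
    and "g \<in> carrier G \<Longrightarrow> x \<in> carrier M \<Longrightarrow> act M g x \<in> carrier M"
    and "x \<in> carrier M \<Longrightarrow> act M \<one>\<^bsub>G\<^esub> x = x"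
    and "g \<in> carrier G \<Longrightarrow> h \<in> carrier G \<Longrightarrow> x \<in> carrier M \<Longrightarrow> act M (g \<otimes>\<^bsub>G\<^esub> h) x = act M g (act M h x)"
  using assms by (auto simp: is_gmod_def operator_module_def linear_maps_def)

lemma post_halo_restrict [simp]: "post (halo_restrict K G Q) = post Q"
  by (simp add: post_def halo_restrict_def fun_eq_iff)

lemma F_obj_simps [simp]:
  "carrier (F_obj K G E Q W) = carrier (halo_hom K E (halo_restrict K G Q) (halo_restrict K G W))"
  "add (F_obj K G E Q W) = add (halo_hom K E (halo_restrict K G Q) (halo_restrict K G W))"
  "zero (F_obj K G E Q W) = zero (halo_hom K E (halo_restrict K G Q) (halo_restrict K G W))"
  "smult (F_obj K G E Q W) = smult (halo_hom K E (halo_restrict K G Q) (halo_restrict K G W))"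
  by (simp_all add: F_obj_def)

context digroup_setting
begin

abbreviation halo_ops :: "('e list \<Rightarrow> 'k) set set" where
  "halo_ops \<equiv> carrier (halo_algebra K E)"

lemma F_act:
  assumes "is_rep K G E \<phi> Q" "g \<in> carrier G" "x \<in> carrier Q"
  shows "act (F_obj K G E Q W) g f x = rg W g (f (rg Q (inv\<^bsub>G\<^esub> g) x))"
proof -
  have "inv_into (carrier Q) (rg Q g) x = rg Q (inv\<^bsub>G\<^esub> g) x"
    using assms rg_bij[OF assms(1,2)] rg_closed[OF assms(1)] rg_inv(2)[OF assms]
    by (intro inv_into_f_eq) (auto simp: bij_betw_def)
  then show ?thesis using assms by (simp add: F_obj_def)
qed

text \<open>Conjugation by \<open>\<rho>\<close> preserves maps over the halo algebra, because it permutes the operators \<open>\<epsilon>\<^bsub>\<alpha>\<^esub>\<close> in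
  the same way in \<open>Q\<close> and in \<open>W\<close>.\<close>

lemma F_gmod:
  assumes Q: "is_rep K G E \<phi> Q" and W: "is_rep K G E \<phi> W"
  shows "is_gmod K G (F_obj K G E Q W)"
  unfolding is_gmod_def
proof (intro conjI ballI)
  let ?F = "F_obj K G E Q W"
  note Qh = halo_moduleD(1)[OF halo_restrict_module(1)[OF Q]] and Wh = halo_moduleD(1)[OF halo_restrict_module(1)[OF W]]
  interpret Q: module K Q by (rule repD(1)[OF Q])
  show "module K ?F" by (rule module_cong[OF hom_space_module[OF Qh Wh]]) (simp_all add: F_obj_def)
  note fD = halo_restrict_homD[OF Q W]
  note rq = rg_closed[OF Q] linear_mapsD[OF rg_linear[OF Q]] and rw = rg_closed[OF W] linear_mapsD[OF rg_linear[OF W]]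
  have ext: "act ?F g f \<in> extensional (carrier Q)" for g f by (simp add: F_obj_def)
  have hom: "act ?F g f \<in> op_hom K halo_ops (halo_restrict K G Q) (halo_restrict K G W)"
    if g: "g \<in> carrier G" and f: "f \<in> op_hom K halo_ops (halo_restrict K G Q) (halo_restrict K G W)" for g f
  proof (rule halo_restrict_homI[OF Q W])
    note ig = G.inv_closed[OF g]
    note fl = linear_mapsD[OF fD(1)[OF f]]
    show "act ?F g f \<in> linear_maps K Q W"
      by (rule linear_mapsI) (use g ig fl rq rw in \<open>simp_all add: F_act[OF Q]\<close>)
    fix \<alpha> v assume \<alpha>: "\<alpha> \<in> E" and v: "v \<in> carrier Q"
    have "\<phi> g (\<phi> (inv\<^bsub>G\<^esub> g) \<alpha>) = \<alpha>"
      using \<alpha> g action_mult[of \<alpha> g "inv\<^bsub>G\<^esub> g"] action_one by auto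
    then show "act ?F g f (eps Q \<alpha> v) = eps W \<alpha> (act ?F g f v)"
      using g ig \<alpha> v fl rq
      by (simp add: F_act[OF Q] eps_closed[OF Q] rg_eps[OF Q] rg_eps[OF W] fD(2)[OF f] action_closed)
  qed
  have mem: "act ?F g f \<in> carrier ?F" if "g \<in> carrier G" "f \<in> carrier ?F" for g f
    using hom that ext by simp
  have eqI: "f = f'" if "f \<in> extensional (carrier Q)" "f' \<in> extensional (carrier Q)"
    "\<And>x. x \<in> carrier Q \<Longrightarrow> f x = f' x" for f f' using that by (rule extensionalityI)
  fix g assume g: "g \<in> carrier G"
  note ig = G.inv_closed[OF g]
  show "act ?F g \<in> linear_maps K ?F ?F"
  proof (rule linear_mapsI)
    fix f f' assume f: "f \<in> carrier ?F" "f' \<in> carrier ?F"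
    then have fl: "f \<in> linear_maps K Q W" "f' \<in> linear_maps K Q W" using fD(1) by auto
    show "act ?F g (f \<oplus>\<^bsub>?F\<^esub> f') = act ?F g f \<oplus>\<^bsub>?F\<^esub> act ?F g f'"
      by (rule eqI[OF ext])
        (use f g ig rw rq linear_mapsD[OF fl(1)] linear_mapsD[OF fl(2)] in \<open>simp_all add: F_act[OF Q]\<close>)
  next
    fix k f assume k: "k \<in> carrier K" and f: "f \<in> carrier ?F"
    then have fl: "f \<in> linear_maps K Q W" using fD(1) by auto
    show "act ?F g (k \<odot>\<^bsub>?F\<^esub> f) = k \<odot>\<^bsub>?F\<^esub> act ?F g f"
      by (rule eqI[OF ext])
        (use f g k ig rw rq linear_mapsD[OF fl(1)] in \<open>simp_all add: F_act[OF Q]\<close>)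
  qed (use mem g in auto)
  fix h f assume h: "h \<in> carrier G" and f: "f \<in> carrier ?F"
  then have fl: "f \<in> linear_maps K Q W" using fD(1) by auto
  show "act ?F (g \<otimes>\<^bsub>G\<^esub> h) f = act ?F g (act ?F h f)"
    by (rule eqI[OF ext ext])
      (use g h ig rq linear_mapsD[OF fl] in
        \<open>simp_all add: F_act[OF Q] G.inv_mult_group rg_mult[OF Q] rg_mult[OF W]\<close>)
next
  let ?F = "F_obj K G E Q W"
  fix f assume f: "f \<in> carrier ?F"
  then have fl: "f \<in> linear_maps K Q W" using halo_restrict_homD(1)[OF Q W] by auto
  have "act ?F \<one>\<^bsub>G\<^esub> f x = f x" if "x \<in> carrier Q" for x
    using that linear_mapsD(1)[OF fl that] by (simp add: F_act[OF Q] rg_one[OF Q] rg_one[OF W])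
  moreover have "act ?F \<one>\<^bsub>G\<^esub> f \<in> extensional (carrier Q)" by (simp add: F_obj_def)
  ultimately show "act ?F \<one>\<^bsub>G\<^esub> f = f" using f by (intro extensionalityI[of _ "carrier Q"]) auto
qed

lemma F_post:
  assumes Q: "is_rep K G E \<phi> Q" and W: "is_rep K G E \<phi> W" and W': "is_rep K G E \<phi> W'"
    and u: "u \<in> op_hom K (rep_ops G E) W W'"
  shows "post Q u \<in> op_hom K (carrier G) (F_obj K G E Q W) (F_obj K G E Q W')"
proof (rule op_homI)
  note Qh = halo_moduleD(1)[OF halo_restrict_module(1)[OF Q]]
  note uh = rep_hom_halo_hom[OF W W' u]
  show "post Q u \<in> linear_maps K (F_obj K G E Q W) (F_obj K G E Q W')"
    using post_linear[OF Qh uh] by (simp add: linear_maps_def)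
  fix g f assume g: "g \<in> carrier G" and "f \<in> carrier (F_obj K G E Q W)"
  then have f: "f \<in> op_hom K halo_ops (halo_restrict K G Q) (halo_restrict K G W)" by simp
  note fl = halo_restrict_homD(1)[OF Q W f]
  show "post Q u (act (F_obj K G E Q W) g f) = act (F_obj K G E Q W') g (post Q u f)"
  proof (rule extensionalityI[of _ "carrier Q"])
    fix x assume x: "x \<in> carrier Q"
    then have "rg Q (inv\<^bsub>G\<^esub> g) x \<in> carrier Q" using rg_closed[OF Q] g by simp
    then show "post Q u (act (F_obj K G E Q W) g f) x = act (F_obj K G E Q W') g (post Q u f) x"
      using x g linear_mapsD(1)[OF fl] by (simp add: F_act[OF Q] rep_homD(2)[OF u])
  qed (auto simp: F_obj_def)
qed

text \<open>A map over the halo algebra is fixed by conjugation with \<open>\<rho>\<^bsub>g\<^esub>\<close> iff it commutes with \<open>\<rho>\<^bsub>g\<^esub>\<close>, and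
  the operators \<open>\<epsilon>\<^bsub>\<alpha>\<^esub>\<close> and \<open>\<rho>\<^bsub>g\<^esub>\<close> generate all operators of a representation.\<close>

lemma F_invariants:
  assumes Q: "is_rep K G E \<phi> Q" and W: "is_rep K G E \<phi> W"
  shows "carrier (invariants G (F_obj K G E Q W)) = carrier (hom_space K (rep_ops G E) Q W)"
proof (intro equalityI subsetI)
  fix f assume "f \<in> carrier (invariants G (F_obj K G E Q W))"
  then have f: "f \<in> op_hom K halo_ops (halo_restrict K G Q) (halo_restrict K G W)"
    "f \<in> extensional (carrier Q)" and inv: "\<And>g. g \<in> carrier G \<Longrightarrow> act (F_obj K G E Q W) g f = f"
    by (auto simp: invariants_def)
  note fl = halo_restrict_homD[OF Q W f(1)]
  have "f (rg Q g v) = rg W g (f v)" if "g \<in> carrier G" "v \<in> carrier Q" for g v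
    using F_act[OF Q that(1), of "rg Q g v" W f] inv[OF that(1)] that rg_closed[OF Q] rg_inv(1)[OF Q] by simp
  then show "f \<in> carrier (hom_space K (rep_ops G E) Q W)"
    using rep_homI[OF Q W fl] f(2) by simp
next
  fix f assume "f \<in> carrier (hom_space K (rep_ops G E) Q W)"
  then have f: "f \<in> op_hom K (rep_ops G E) Q W" "f \<in> extensional (carrier Q)" by auto
  have "act (F_obj K G E Q W) g f = f" if g: "g \<in> carrier G" for g
  proof (rule extensionalityI[of _ "carrier Q"])
    fix x assume x: "x \<in> carrier Q"
    have "rg Q (inv\<^bsub>G\<^esub> g) x \<in> carrier Q" using rg_closed[OF Q] g x by simp
    then show "act (F_obj K G E Q W) g f x = f x"
      using g x rep_homD(2)[OF f(1) g, of "rg Q (inv\<^bsub>G\<^esub> g) x"] rg_inv(2)[OF Q g x] by (simp add: F_act[OF Q])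
  qed (use f in \<open>auto simp: F_obj_def\<close>)
  then show "f \<in> carrier (invariants G (F_obj K G E Q W))"
    using rep_hom_halo_hom[OF Q W f(1)] f(2) by (simp add: invariants_def)
qed

lemma F_complex:
  assumes Q: "is_rep K G E \<phi> Q"
    and I: "rep_injective_resolution K G E \<phi> W \<eta> I d"
  shows "operator_complex K (carrier G) (\<lambda>n. F_obj K G E Q (I n)) (\<lambda>n. post Q (d n))"
proof
  interpret C: operator_category K "rep_ops G E" "is_rep K G E \<phi>" by (rule rep_category)
  note ID = C.resolutionD[OF I]
  show "operator_module K (carrier G) (F_obj K G E Q (I n))" for n
    by (rule is_gmodD(2)[OF F_gmod[OF Q ID(2)]])
  show "post Q (d n) \<in> op_hom K (carrier G) (F_obj K G E Q (I n)) (F_obj K G E Q (I (Suc n)))" for n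
    by (rule F_post[OF Q ID(2) ID(2) ID(7)])
  show "post Q (d (Suc n)) (post Q (d n) f) = \<zero>\<^bsub>F_obj K G E Q (I (Suc (Suc n)))\<^esub>"
    if "f \<in> carrier (F_obj K G E Q (I n))" for f n
    using that op_homD(2)[of f K halo_ops "halo_restrict K G Q" "halo_restrict K G (I n)"]
    by (auto simp: post_def compose_def ID(11) intro!: restrict_ext)
qed

lemma restrict_resolution:
  fixes W :: "('k, 'g, 'e, 'w) dig_rep" and I :: "nat \<Rightarrow> ('k, 'g, 'e, 'v) dig_rep" and \<gamma> :: "'g \<Rightarrow> 'v"
  assumes W: "is_rep K G E \<phi> W" and I: "rep_injective_resolution K G E \<phi> W \<eta> I d"
    and large: "infinite (UNIV :: 'v set)" "inj_on \<gamma> (carrier G)"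
  shows "halo_injective_resolution K E (halo_restrict K G W) \<eta> (\<lambda>n. halo_restrict K G (I n)) d"
proof -
  interpret C: operator_category K "rep_ops G E" "is_rep K G E \<phi>" by (rule rep_category)
  note ID = C.resolutionD[OF I]
  have cb: "cocycles (\<lambda>n. halo_restrict K G (I n)) d q = cocycles I d q"
    "coboundaries (\<lambda>n. halo_restrict K G (I n)) d q = coboundaries I d q" for q
    by (rule cohomology_cong; simp)+
  show ?thesis
    unfolding injective_resolution_def
  proof (intro conjI allI)
    show "injective_object K halo_ops (is_halo_module K E) (halo_restrict K G (I n))" for n
      by (rule halo_restrict_injective[OF ID(1) large])
    show "\<eta> \<in> op_hom K halo_ops (halo_restrict K G W) (halo_restrict K G (I 0))"
      by (rule rep_hom_halo_hom[OF W ID(2) ID(5)])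
    show "d n \<in> op_hom K halo_ops (halo_restrict K G (I n)) (halo_restrict K G (I (Suc n)))" for n
      by (rule rep_hom_halo_hom[OF ID(2) ID(2) ID(7)])
  qed (simp_all add: cb ID(6,8,9))
qed

lemma F_cohomology:
  "cohomology (\<lambda>n. F_obj K G E Q (I n)) \<delta> q
    = cohomology (\<lambda>n. halo_hom K E (halo_restrict K G Q) (halo_restrict K G (I n))) \<delta> q"
  "cohomology_map (\<lambda>n. F_obj K G E Q (I n)) \<delta> q
    = cohomology_map (\<lambda>n. halo_hom K E (halo_restrict K G Q) (halo_restrict K G (I n))) \<delta> q"
  by (rule cohomology_cong; simp)+

text \<open>Both resolutions by representations are injective resolutions over the halo algebra.  The
  isomorphism is the map induced by a comparison \<open>u\<close> between them, followed by the map \<open>\<Theta>\<close> induced by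
  \<open>c\<close>: the former is equivariant because \<open>u\<close> consists of morphisms of representations, the latter
  because the action on the target was transported along it.\<close>

theorem RF_iso_Ext:
  fixes Q W :: "('k, 'g, 'e, 'u) dig_rep" and \<gamma> :: "'g \<Rightarrow> 'u"
    and I I' :: "nat \<Rightarrow> ('k, 'g, 'e, 'u) dig_rep" and J :: "nat \<Rightarrow> ('k, 'u, ('e list \<Rightarrow> 'k) set) opmod"
  assumes large: "infinite (UNIV :: 'u set)" "inj_on \<gamma> (carrier G)"
    and Q: "is_rep K G E \<phi> Q" and W: "is_rep K G E \<phi> W"
    and I: "rep_injective_resolution K G E \<phi> W \<eta> I d"
    and I': "rep_injective_resolution K G E \<phi> W \<eta>' I' d'"
    and J: "halo_injective_resolution K E (halo_restrict K G W) \<theta> J \<epsilon>"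
    and c: "halo_comparison K G E W \<eta>' I' d' \<theta> J \<epsilon> c"
  shows "opmod_iso K (carrier G) (RF K G E Q I d q) (Ext_halo_G K G E Q I' d' J \<epsilon> c q)"
proof -
  interpret C: operator_category K "rep_ops G E" "is_rep K G E \<phi>" by (rule rep_category)
  interpret H: operator_category K halo_ops "is_halo_module K E" by (rule halo_category)
  note ID = C.resolutionD[OF I] and ID' = C.resolutionD[OF I']
  note Qh = halo_moduleD(1)[OF halo_restrict_module(1)[OF Q]]
  note Wh = halo_moduleD(1)[OF halo_restrict_module(1)[OF W]]
  note Ih = restrict_resolution[OF W I large] and Ih' = restrict_resolution[OF W I' large]
  obtain u where u: "\<And>n. u n \<in> op_hom K (rep_ops G E) (I n) (I' n)"
    "\<And>n x. x \<in> carrier (I n) \<Longrightarrow> u (Suc n) (d n x) = d' n (u n x)"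
    "\<And>x. x \<in> carrier W \<Longrightarrow> u 0 (\<eta> x) = \<eta>' x"
    using C.comparison_exists[OF I I' rep_operator[OF W]] by blast
  have uh: "u n \<in> op_hom K halo_ops (halo_restrict K G (I n)) (halo_restrict K G (I' n))" for n
    by (rule rep_hom_halo_hom[OF ID(2) ID'(2) u(1)])
  have c1: "c n \<in> op_hom K halo_ops (halo_restrict K G (I' n)) (J n)"
    and c2: "x \<in> carrier (halo_restrict K G (I' n)) \<Longrightarrow> c (Suc n) (d' n x) = \<epsilon> n (c n x)"
    and c3: "x \<in> carrier (halo_restrict K G W) \<Longrightarrow> c 0 (\<eta>' x) = \<theta> x" for n x
    using c unfolding halo_comparison_def by auto
  let ?FI = "\<lambda>n. F_obj K G E Q (I n)" and ?FI' = "\<lambda>n. F_obj K G E Q (I' n)"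
  let ?HJ = "\<lambda>n. halo_hom K E (halo_restrict K G Q) (J n)"
  define H where "H = op_cohomology ?FI' (\<lambda>n. post Q (d' n)) q"
  define \<Psi> where "\<Psi> = cohomology_map ?FI' (\<lambda>n. post Q (d' n)) q (post Q (u q))"
  define \<Theta> where "\<Theta> = cohomology_map ?HJ (\<lambda>n. post Q (\<epsilon> n)) q (post Q (c q))"
  let ?RF = "RF K G E Q I d q" and ?Ext = "Ext_halo_G K G E Q I' d' J \<epsilon> c q"
  have Ext: "?Ext = with_act (Ext_halo K G E Q J \<epsilon> q) (\<lambda>g y. \<Theta> (act H g (inv_into (carrier H) \<Theta> y)))"
    by (simp add: Ext_halo_G_def H_def \<Theta>_def Let_def)
  have bij\<Psi>: "bij_betw \<Psi> (carrier ?RF) (carrier H)"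
    using H.comparison_bij[OF Qh Wh Ih Ih' uh, of q] u(2,3)
    by (simp add: \<Psi>_def RF_def H_def op_cohomology_def F_cohomology)
  have bij\<Theta>: "bij_betw \<Theta> (carrier H) (carrier ?Ext)"
    using H.comparison_bij[OF Qh Wh Ih' J c1 c2 c3, of q]
    by (simp add: \<Theta>_def Ext H_def op_cohomology_def F_cohomology Ext_halo_def)
  have lin\<Psi>: "\<Psi> \<in> linear_maps K ?RF H"
    using cochain_map.map_linear[OF H.hom_cochain_map[OF Qh Ih Ih' uh], of q] u(2)
    by (simp add: \<Psi>_def RF_def H_def op_cohomology_def F_cohomology linear_maps_def)
  have lin\<Theta>: "\<Theta> \<in> linear_maps K H ?Ext"
    using cochain_map.map_linear[OF H.hom_cochain_map[OF Qh Ih' J c1 c2], of q]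
    by (simp add: \<Theta>_def Ext H_def op_cohomology_def F_cohomology Ext_halo_def linear_maps_def)
  have act\<Psi>: "\<Psi> (act ?RF g X) = act H g (\<Psi> X)" if "g \<in> carrier G" "X \<in> carrier ?RF" for g X
    unfolding \<Psi>_def RF_def H_def
  proof (rule cohomology_map_act[OF F_complex[OF Q I] F_complex[OF Q I'], of "\<lambda>n. post Q (u n)"])
    show "post Q (u n) \<in> op_hom K (carrier G) (?FI n) (?FI' n)" for n
      by (rule F_post[OF Q ID(2) ID'(2) u(1)])
    show "post Q (u (Suc n)) (post Q (d n) f) = post Q (d' n) (post Q (u n) f)"
      if "f \<in> carrier (?FI n)" for n f
      using that op_homD(2)[of f K halo_ops "halo_restrict K G Q" "halo_restrict K G (I n)"] u(2)
      by (auto simp: post_def compose_def intro!: restrict_ext)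
  qed (use that in \<open>auto simp: RF_def\<close>)
  have "(\<lambda>X. \<Theta> (\<Psi> X)) \<in> op_hom K (carrier G) ?RF ?Ext"
  proof (rule op_homI[OF linear_comp[OF lin\<Psi> lin\<Theta>]])
    fix g X assume g: "g \<in> carrier G" and X: "X \<in> carrier ?RF"
    have "inv_into (carrier H) \<Theta> (\<Theta> (\<Psi> X)) = \<Psi> X"
      using bij\<Theta> linear_mapsD(1)[OF lin\<Psi> X] by (simp add: bij_betw_def)
    then show "\<Theta> (\<Psi> (act ?RF g X)) = act ?Ext g (\<Theta> (\<Psi> X))"
      using act\<Psi>[OF g X] by (simp add: Ext)
  qed
  moreover have "bij_betw (\<lambda>X. \<Theta> (\<Psi> X)) (carrier ?RF) (carrier ?Ext)"
    using bij_betw_trans[OF bij\<Psi> bij\<Theta>] by (simp add: comp_def)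
  ultimately show ?thesis unfolding opmod_iso_def by blast
qed

end

section \<open>Averaging over a finite group\<close>

text \<open>When the order of \<open>G\<close> is invertible, \<open>avg\<close> below is a natural projection of \<open>G\<close>-modules onto their
  invariants.\<close>

locale averaging =
  fixes K :: "('k, 'm) ring_scheme" and G :: "('g, 'n) monoid_scheme"
  assumes field: "field K" and group: "group G" and finite_group: "finite (carrier G)"
    and card_nonzero: "[card (carrier G)] \<cdot>\<^bsub>K\<^esub> \<one>\<^bsub>K\<^esub> \<noteq> \<zero>\<^bsub>K\<^esub>"
begin

sublocale K: field K by (rule field)
sublocale G: group G by (rule group)

definition avg :: "('k, 'v, 'g) opmod \<Rightarrow> 'v \<Rightarrow> 'v" where
  "avg M x = inv\<^bsub>K\<^esub> ([card (carrier G)] \<cdot>\<^bsub>K\<^esub> \<one>\<^bsub>K\<^esub>) \<odot>\<^bsub>M\<^esub> (\<Oplus>\<^bsub>M\<^esub>g \<in> carrier G. act M g x)"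

lemma inv_card: "inv\<^bsub>K\<^esub> ([card (carrier G)] \<cdot>\<^bsub>K\<^esub> \<one>\<^bsub>K\<^esub>) \<in> carrier K"
  "inv\<^bsub>K\<^esub> ([card (carrier G)] \<cdot>\<^bsub>K\<^esub> \<one>\<^bsub>K\<^esub>) \<otimes>\<^bsub>K\<^esub> ([card (carrier G)] \<cdot>\<^bsub>K\<^esub> \<one>\<^bsub>K\<^esub>) = \<one>\<^bsub>K\<^esub>"
proof -
  have "[card (carrier G)] \<cdot>\<^bsub>K\<^esub> \<one>\<^bsub>K\<^esub> \<in> Units K"
    using card_nonzero K.field_Units by simp
  then show "inv\<^bsub>K\<^esub> ([card (carrier G)] \<cdot>\<^bsub>K\<^esub> \<one>\<^bsub>K\<^esub>) \<in> carrier K"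
    "inv\<^bsub>K\<^esub> ([card (carrier G)] \<cdot>\<^bsub>K\<^esub> \<one>\<^bsub>K\<^esub>) \<otimes>\<^bsub>K\<^esub> ([card (carrier G)] \<cdot>\<^bsub>K\<^esub> \<one>\<^bsub>K\<^esub>) = \<one>\<^bsub>K\<^esub>"
    by simp_all
qed

context
  fixes M :: "('k, 'v, 'g) opmod"
  assumes M: "is_gmod K G M"
begin

interpretation M: module K M by (rule is_gmodD(1)[OF M])

lemma avg_closed: "x \<in> carrier M \<Longrightarrow> avg M x \<in> carrier M"
  unfolding avg_def using is_gmodD(4)[OF M] inv_card(1) by (intro M.smult_closed M.M.finsum_closed) auto

lemma add_pow_smult:
  fixes n :: nat
  assumes "x \<in> carrier M"
  shows "([n] \<cdot>\<^bsub>K\<^esub> \<one>\<^bsub>K\<^esub>) \<odot>\<^bsub>M\<^esub> x = [n] \<cdot>\<^bsub>M\<^esub> x"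
proof (induction n)
  case (Suc n)
  then show ?case using assms by (simp add: K.add.nat_pow_Suc M.M.add.nat_pow_Suc M.smult_l_distr)
qed (simp add: assms)

lemma avg_invariant:
  assumes "x \<in> carrier M" "\<And>g. g \<in> carrier G \<Longrightarrow> act M g x = x"
  shows "avg M x = x"
proof -
  have "(\<Oplus>\<^bsub>M\<^esub>g \<in> carrier G. act M g x) = (\<Oplus>\<^bsub>M\<^esub>g \<in> carrier G. x)"
    by (rule M.M.finsum_cong') (use assms in auto)
  also have "\<dots> = [card (carrier G)] \<cdot>\<^bsub>M\<^esub> x"
    using M.M.add.finprod_const[OF assms(1), of "carrier G"] by simp
  also have "\<dots> = ([card (carrier G)] \<cdot>\<^bsub>K\<^esub> \<one>\<^bsub>K\<^esub>) \<odot>\<^bsub>M\<^esub> x"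
    by (rule add_pow_smult[OF assms(1), symmetric])
  finally show ?thesis
    unfolding avg_def using inv_card assms(1) by (simp flip: M.smult_assoc1)
qed

lemma act_avg:
  assumes "h \<in> carrier G" "x \<in> carrier M"
  shows "act M h (avg M x) = avg M x"
proof -
  note l = is_gmodD(3)[OF M assms(1)]
  have c: "act M g x \<in> carrier M" if "g \<in> carrier G" for g using is_gmodD(4)[OF M that assms(2)] .
  have "act M h (\<Oplus>\<^bsub>M\<^esub>g \<in> carrier G. act M g x) = (\<Oplus>\<^bsub>M\<^esub>g \<in> carrier G. act M h (act M g x))"
    by (rule linear_finsum[OF M.module_axioms M.module_axioms l]) (use c in auto)
  also have "\<dots> = (\<Oplus>\<^bsub>M\<^esub>g \<in> carrier G. act M (h \<otimes>\<^bsub>G\<^esub> g) x)"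
    by (rule M.M.finsum_cong') (use c assms is_gmodD(6)[OF M] in auto)
  also have "\<dots> = (\<Oplus>\<^bsub>M\<^esub>g \<in> (\<lambda>g. h \<otimes>\<^bsub>G\<^esub> g) ` carrier G. act M g x)"
    by (rule M.M.add.finprod_reindex[symmetric]) (use c assms in \<open>auto simp: inj_on_def\<close>)
  also have "(\<lambda>g. h \<otimes>\<^bsub>G\<^esub> g) ` carrier G = carrier G"
    by (rule G.surj_const_mult[OF assms(1)])
  finally show ?thesis
    unfolding avg_def using linear_mapsD(3)[OF l inv_card(1)] c by (simp add: Pi_iff)
qed

lemma avg_linear: "avg M \<in> linear_maps K M M"
proof (rule linear_mapsI)
  note c = is_gmodD(4)[OF M] and l = linear_mapsD[OF is_gmodD(3)[OF M]]
  show "avg M (x \<oplus>\<^bsub>M\<^esub> y) = avg M x \<oplus>\<^bsub>M\<^esub> avg M y" if "x \<in> carrier M" "y \<in> carrier M" for x y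
  proof -
    have "(\<Oplus>\<^bsub>M\<^esub>g \<in> carrier G. act M g (x \<oplus>\<^bsub>M\<^esub> y)) = (\<Oplus>\<^bsub>M\<^esub>g \<in> carrier G. act M g x \<oplus>\<^bsub>M\<^esub> act M g y)"
      by (rule M.M.finsum_cong') (use c l that in auto)
    also have "\<dots> = (\<Oplus>\<^bsub>M\<^esub>g \<in> carrier G. act M g x) \<oplus>\<^bsub>M\<^esub> (\<Oplus>\<^bsub>M\<^esub>g \<in> carrier G. act M g y)"
      by (rule M.M.finsum_addf) (use c that in auto)
    finally show ?thesis unfolding avg_def using c that inv_card by (simp add: M.smult_r_distr Pi_iff)
  qed
  show "avg M (k \<odot>\<^bsub>M\<^esub> x) = k \<odot>\<^bsub>M\<^esub> avg M x" if k: "k \<in> carrier K" and x: "x \<in> carrier M" for k x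
  proof -
    have "(\<Oplus>\<^bsub>M\<^esub>g \<in> carrier G. act M g (k \<odot>\<^bsub>M\<^esub> x)) = (\<Oplus>\<^bsub>M\<^esub>g \<in> carrier G. k \<odot>\<^bsub>M\<^esub> act M g x)"
      by (rule M.M.finsum_cong') (use c l that in auto)
    also have "\<dots> = k \<odot>\<^bsub>M\<^esub> (\<Oplus>\<^bsub>M\<^esub>g \<in> carrier G. act M g x)"
      by (rule M.finsum_smult_ldistr[symmetric]) (use c x k finite_group in auto)
    finally show ?thesis
      unfolding avg_def using c x k inv_card(1)
        M.smult_assoc1[of k, symmetric] M.smult_assoc1[of _ k, symmetric]
      by (simp add: Pi_iff K.m_comm)
  qed
qed (rule avg_closed)

lemma avg_mem_invariants: "x \<in> carrier M \<Longrightarrow> avg M x \<in> carrier (invariants G M)"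
  using avg_closed act_avg by (simp add: invariants_def)

end

lemma avg_hom:
  assumes M: "is_gmod K G M" and N: "is_gmod K G N" and f: "f \<in> op_hom K (carrier G) M N"
    and x: "x \<in> carrier M"
  shows "f (avg M x) = avg N (f x)"
proof -
  note l = op_homD(1)[OF f]
  have c: "act M g x \<in> carrier M" if "g \<in> carrier G" for g using is_gmodD(4)[OF M that x] .
  interpret M: module K M by (rule is_gmodD(1)[OF M])
  interpret N: module K N by (rule is_gmodD(1)[OF N])
  have "f (\<Oplus>\<^bsub>M\<^esub>g \<in> carrier G. act M g x) = (\<Oplus>\<^bsub>N\<^esub>g \<in> carrier G. f (act M g x))"
    by (rule linear_finsum[OF M.module_axioms N.module_axioms l]) (use c in auto)
  also have "\<dots> = (\<Oplus>\<^bsub>N\<^esub>g \<in> carrier G. act N g (f x))"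
    by (rule N.M.finsum_cong')
      (use op_homD(3)[OF f _ x] is_gmodD(4)[OF N _ op_homD(2)[OF f x]] in auto)
  finally show ?thesis
    unfolding avg_def using linear_mapsD(3)[OF l inv_card(1)] c by (simp add: Pi_iff)
qed

end

lemma invariants_simps [simp]:
  "add (invariants G M) = add M" "zero (invariants G M) = zero M" "smult (invariants G M) = smult M"
  "act (invariants G M) = act M"
  by (simp_all add: invariants_def)

lemma invariants_carrier:
  "x \<in> carrier (invariants G M) \<longleftrightarrow> x \<in> carrier M \<and> (\<forall>g \<in> carrier G. act M g x = x)"
  by (simp add: invariants_def)

lemma invariants_submodule:
  assumes M: "is_gmod K G M"
  shows "submodule (carrier (invariants G M)) K M"
proof -
  interpret M: module K M by (rule is_gmodD(1)[OF M])
  note l = is_gmodD(3)[OF M]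
  show ?thesis
    by (rule M.submoduleI)
      (use l in \<open>auto simp: invariants_carrier linear_mapsD[OF l]
        linear_zero[OF M.module_axioms M.module_axioms l] linear_uminus[OF M.module_axioms M.module_axioms l]\<close>)
qed

lemma invariants_module:
  assumes M: "is_gmod K G M"
  shows "module K (invariants G M)"
proof -
  have "invariants G M = M\<lparr>carrier := carrier (invariants G M)\<rparr>" by (simp add: invariants_def)
  then show ?thesis
    using submodule.submodule_is_module[OF invariants_submodule[OF M] is_gmodD(1)[OF M]] by simp
qed

lemma invariants_hom:
  assumes "f \<in> op_hom K (carrier G) M N"
  shows "f \<in> linear_maps K (invariants G M) (invariants G N)"
  by (rule linear_mapsI)
    (use op_homD[OF assms] linear_mapsD[OF op_homD(1)[OF assms]] in \<open>auto simp: invariants_carrier simp flip: op_homD(3)[OF assms]\<close>)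

locale gmod_complex = operator_complex K "carrier G" A \<delta>
  for K :: "('k, 'm) ring_scheme" and G :: "('g, 'n) monoid_scheme"
    and A :: "nat \<Rightarrow> ('k, 'v, 'g) opmod" and \<delta> +
  assumes gmod: "is_gmod K G (A n)"
begin

lemma invariants_complex: "cochain_complex K (\<lambda>n. invariants G (A n)) \<delta>"
  by (rule cochain_complex.intro)
    (use invariants_module[OF gmod] invariants_hom[OF diff_hom] diff_diff in \<open>auto simp: invariants_carrier\<close>)

lemma invariant_cocycles:
  "x \<in> cocycles (\<lambda>n. invariants G (A n)) \<delta> q \<longleftrightarrow> x \<in> cocycles A \<delta> q \<and> (\<forall>g \<in> carrier G. act (A q) g x = x)"
  by (auto simp: cocycles_def invariants_carrier)

end

locale averaging_complex = averaging K G + gmod_complex K G A \<delta>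
  for K :: "('k, 'm) ring_scheme" and G :: "('g, 'n) monoid_scheme"
    and A :: "nat \<Rightarrow> ('k, 'v, 'g) opmod" and \<delta>
begin

lemma avg_coboundaries:
  assumes "x \<in> coboundaries A \<delta> q"
  shows "avg (A q) x \<in> coboundaries (\<lambda>n. invariants G (A n)) \<delta> q"
proof (cases q)
  case 0
  then have "x = \<zero>\<^bsub>A q\<^esub>" using assms by (simp add: coboundaries_def)
  then show ?thesis using 0 linear_zero[OF mod mod avg_linear[OF gmod]] by (simp add: coboundaries_def)
next
  case (Suc p)
  then obtain y where y: "y \<in> carrier (A p)" "x = \<delta> p y" using assms by (auto simp: coboundaries_def)
  then have "avg (A q) x = \<delta> p (avg (A p) y)" using avg_hom[OF gmod gmod diff_hom, of y p] Suc by simp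
  then show ?thesis using avg_mem_invariants[OF gmod y(1)] Suc by (auto simp: coboundaries_def)
qed

text \<open>With \<open>avg_class\<close> below, this says that taking invariants commutes with cohomology: averaging a
  cochain that bounds an invariant cocycle gives an invariant cochain with the same coboundary.\<close>

lemma invariant_coboundary:
  assumes "x \<in> carrier (invariants G (A q))"
  shows "x \<in> coboundaries (\<lambda>n. invariants G (A n)) \<delta> q \<longleftrightarrow> x \<in> coboundaries A \<delta> q"
proof
  assume "x \<in> coboundaries (\<lambda>n. invariants G (A n)) \<delta> q"
  then show "x \<in> coboundaries A \<delta> q" by (auto simp: coboundaries_def invariants_carrier split: nat.splits)
next
  assume "x \<in> coboundaries A \<delta> q"
  from avg_coboundaries[OF this] show "x \<in> coboundaries (\<lambda>n. invariants G (A n)) \<delta> q"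
    using avg_invariant[OF gmod, of x q] assms by (simp add: invariants_carrier)
qed

text \<open>An invariant class contains an invariant cocycle: the translates of \<open>x\<close> differ from \<open>x\<close> by
  coboundaries, hence so does their average.\<close>

lemma avg_class:
  assumes x: "x \<in> cocycles A \<delta> q"
    and inv: "\<And>g. g \<in> carrier G \<Longrightarrow> act (op_cohomology A \<delta> q) g (coboundaries A \<delta> q +>\<^bsub>A q\<^esub> x)
       = coboundaries A \<delta> q +>\<^bsub>A q\<^esub> x"
  shows "avg (A q) x \<in> cocycles (\<lambda>n. invariants G (A n)) \<delta> q"
    and "coboundaries A \<delta> q +>\<^bsub>A q\<^esub> avg (A q) x = coboundaries A \<delta> q +>\<^bsub>A q\<^esub> x"
proof -
  note c = cocycles_carrier[OF x]
  note ac = avg_closed[OF gmod c]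
  interpret Aq: module K "A q" by (rule mod)
  have "\<delta> q (avg (A q) x) = avg (A (Suc q)) (\<delta> q x)" by (rule avg_hom[OF gmod gmod diff_hom c])
  also have "\<dots> = \<zero>\<^bsub>A (Suc q)\<^esub>" using x linear_zero[OF mod mod avg_linear[OF gmod]] by (simp add: cocycles_def)
  finally have "avg (A q) x \<in> cocycles A \<delta> q" using ac by (simp add: cocycles_def)
  then show "avg (A q) x \<in> cocycles (\<lambda>n. invariants G (A n)) \<delta> q"
    unfolding invariant_cocycles using act_avg[OF gmod _ c] by simp
  let ?B = "coboundaries A \<delta> q"
  let ?\<pi> = "\<lambda>x. ?B +>\<^bsub>A q\<^esub> x"
  have d: "act (A q) g x \<ominus>\<^bsub>A q\<^esub> x \<in> ?B" if "g \<in> carrier G" for g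
    using inv[OF that] act_class[OF that c] class_eq_iff[OF is_gmodD(4)[OF gmod that c] c] by simp
  let ?f = "\<lambda>g. act (A q) g x"
  have fc: "?f g \<in> carrier (A q)" if "g \<in> carrier G" for g using is_gmodD(4)[OF gmod that c] .
  \<comment> \<open>\<open>avg x - x\<close> is the average of the \<open>g x - x\<close>\<close>
  let ?k = "inv\<^bsub>K\<^esub> ([card (carrier G)] \<cdot>\<^bsub>K\<^esub> \<one>\<^bsub>K\<^esub>)"
  have sum: "(\<Oplus>\<^bsub>A q\<^esub>g \<in> X. ?f g \<ominus>\<^bsub>A q\<^esub> x) \<in> ?B" if "finite X" "X \<subseteq> carrier G" for X
    using that
  proof (induction X rule: finite_induct)
    case empty
    then show ?case using submodule_zero[OF mod coboundaries_submodule] by simp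
  next
    case (insert g X)
    then show ?case using d[of g] fc c Aq.submoduleE(5)[OF coboundaries_submodule]
      by (subst Aq.finsum_insert) (auto intro!: Aq.minus_closed)
  qed
  have "(\<Oplus>\<^bsub>A q\<^esub>g \<in> carrier G. ?f g) = (\<Oplus>\<^bsub>A q\<^esub>g \<in> carrier G. (?f g \<ominus>\<^bsub>A q\<^esub> x) \<oplus>\<^bsub>A q\<^esub> x)"
    by (rule Aq.M.finsum_cong') (use fc c in \<open>auto simp: Aq.minus_eq Aq.M.a_assoc Aq.l_neg\<close>)
  also have "\<dots> = (\<Oplus>\<^bsub>A q\<^esub>g \<in> carrier G. ?f g \<ominus>\<^bsub>A q\<^esub> x) \<oplus>\<^bsub>A q\<^esub> (\<Oplus>\<^bsub>A q\<^esub>g \<in> carrier G. x)"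
    by (rule Aq.M.finsum_addf) (use fc c in auto)
  also have "(\<Oplus>\<^bsub>A q\<^esub>g \<in> carrier G. x) = ([card (carrier G)] \<cdot>\<^bsub>K\<^esub> \<one>\<^bsub>K\<^esub>) \<odot>\<^bsub>A q\<^esub> x"
    using Aq.M.add.finprod_const[OF c, of "carrier G"] add_pow_smult[OF gmod c] by simp
  finally have "avg (A q) x = ?k \<odot>\<^bsub>A q\<^esub> (\<Oplus>\<^bsub>A q\<^esub>g \<in> carrier G. ?f g \<ominus>\<^bsub>A q\<^esub> x) \<oplus>\<^bsub>A q\<^esub> x"
    unfolding avg_def using inv_card c coboundaries_carrier[OF sum[OF finite_group order.refl]]
    by (simp add: Aq.smult_r_distr flip: Aq.smult_assoc1)
  moreover have "?k \<odot>\<^bsub>A q\<^esub> (\<Oplus>\<^bsub>A q\<^esub>g \<in> carrier G. ?f g \<ominus>\<^bsub>A q\<^esub> x) \<in> ?B" (is "?b \<in> _")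
    by (rule Aq.submoduleE(4)[OF coboundaries_submodule inv_card(1) sum[OF finite_group order.refl]])
  ultimately have "avg (A q) x \<ominus>\<^bsub>A q\<^esub> x = ?b"
    using c coboundaries_carrier by (simp add: Aq.minus_eq Aq.M.a_assoc Aq.r_neg)
  then show "?\<pi> (avg (A q) x) = ?\<pi> x"
    using class_eq_iff[OF ac c] \<open>?b \<in> ?B\<close> by simp
qed

end

section \<open>Double complexes and the pages of the total complex\<close>

lemma total_simps [simp]:
  "carrier (total X n) = (\<Pi>\<^sub>E i \<in> {..n}. carrier (X i (n - i)))"
  "zero (total X n) = (\<lambda>i \<in> {..n}. \<zero>\<^bsub>X i (n - i)\<^esub>)"
  "add (total X n) = (\<lambda>x y. \<lambda>i \<in> {..n}. x i \<oplus>\<^bsub>X i (n - i)\<^esub> y i)"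
  "smult (total X n) = (\<lambda>k x. \<lambda>i \<in> {..n}. k \<odot>\<^bsub>X i (n - i)\<^esub> x i)"
  by (simp_all add: total_def)

locale double_complex =
  fixes K :: "('k, 'm) ring_scheme" and X :: "nat \<Rightarrow> nat \<Rightarrow> ('k, 'v, 'x) module_scheme"
    and dh dv :: "nat \<Rightarrow> nat \<Rightarrow> 'v \<Rightarrow> 'v"
  assumes X: "module K (X i j)"
    and dh: "dh i j \<in> linear_maps K (X i j) (X (Suc i) j)"
    and dv: "dv i j \<in> linear_maps K (X i j) (X i (Suc j))"
    and dh_dh: "x \<in> carrier (X i j) \<Longrightarrow> dh (Suc i) j (dh i j x) = \<zero>\<^bsub>X (Suc (Suc i)) j\<^esub>"
    and dv_dv: "x \<in> carrier (X i j) \<Longrightarrow> dv i (Suc j) (dv i j x) = \<zero>\<^bsub>X i (Suc (Suc j))\<^esub>"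
    and dh_dv: "x \<in> carrier (X i j) \<Longrightarrow> dh i (Suc j) (dv i j x) = dv (Suc i) j (dh i j x)"
begin

lemmas X_group = module_abelian[OF X] and X_monoid = abelian_group.axioms(1)[OF module_abelian[OF X]]

lemma X_uminus_zero: "\<ominus>\<^bsub>X i j\<^esub> \<zero>\<^bsub>X i j\<^esub> = \<zero>\<^bsub>X i j\<^esub>"
  using abelian_group.minus_equality[OF X_group] abelian_monoid.l_zero[OF X_monoid]
    abelian_monoid.zero_closed[OF X_monoid] by metis

lemmas X_simps [simp] = abelian_monoid.zero_closed[OF X_monoid] abelian_monoid.a_closed[OF X_monoid]
  abelian_group.a_inv_closed[OF X_group] abelian_monoid.l_zero[OF X_monoid] abelian_monoid.r_zero[OF X_monoid]
  X_uminus_zero abelian_group.minus_minus[OF X_group] abelian_group.l_neg[OF X_group]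
  abelian_group.r_neg[OF X_group] module.smult_closed[OF X]

lemmas X_ac = X_monoid[THEN abelian_monoid.a_assoc] X_monoid[THEN abelian_monoid.a_comm]
  X_monoid[THEN abelian_monoid.a_lcomm]

lemmas X_minus = abelian_group.minus_eq[OF X_group]

lemmas dh_simps [simp] = linear_mapsD(1)[OF dh] linear_zero[OF X X dh] linear_uminus[OF X X dh]
lemmas dv_simps [simp] = linear_mapsD(1)[OF dv] linear_zero[OF X X dv] linear_uminus[OF X X dv]
lemmas dh_add = linear_mapsD(2)[OF dh] and dv_add = linear_mapsD(2)[OF dv]

abbreviation T where "T \<equiv> total X"
abbreviation D where "D \<equiv> total_diff X dh dv"
abbreviation Fil where "Fil \<equiv> total_filtration X"

lemma total_memD: "x \<in> carrier (T n) \<Longrightarrow> i \<le> n \<Longrightarrow> x i \<in> carrier (X i (n - i))"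
  by (auto simp: PiE_def)

lemma total_eqI:
  assumes "x \<in> carrier (T n)" "y \<in> carrier (T n)" "\<And>i. i \<le> n \<Longrightarrow> x i = y i"
  shows "x = y"
  using assms by (intro PiE_ext[of x "{..n}" "\<lambda>i. carrier (X i (n - i))" y]) auto

lemma total_module: "module K (T n)"
proof (rule moduleI)
  show "cring K" by (rule module.axioms(1)[OF X])
  show "abelian_group (T n)"
  proof (rule abelian_groupI)
    fix x assume x: "x \<in> carrier (T n)"
    show "\<exists>y\<in>carrier (T n). y \<oplus>\<^bsub>T n\<^esub> x = \<zero>\<^bsub>T n\<^esub>"
      by (intro bexI[of _ "\<lambda>i\<in>{..n}. \<ominus>\<^bsub>X i (n - i)\<^esub> x i"])
        (use x in \<open>auto simp: PiE_iff intro!: restrict_ext\<close>)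
  qed (auto simp: PiE_iff X_ac extensional_def fun_eq_iff)
qed (auto simp: PiE_iff fun_eq_iff extensional_def module.smult_l_distr[OF X] module.smult_r_distr[OF X]
     module.smult_assoc1[OF X] module.smult_one[OF X])

lemma total_component: "i \<le> n \<Longrightarrow> (\<lambda>x. x i) \<in> linear_maps K (T n) (X i (n - i))"
  by (rule linear_mapsI) (auto simp: PiE_iff)

lemmas comp_minus = linear_minus[OF total_module X total_component]
lemmas comp_add = linear_mapsD(2)[OF total_component]
lemmas comp_smult = linear_mapsD(3)[OF total_component]

lemma comp_zero: "i \<le> n \<Longrightarrow> \<zero>\<^bsub>T n\<^esub> i = \<zero>\<^bsub>X i (n - i)\<^esub>"
  by simp

text \<open>The two contributions to a component of the total differential; \<open>dh\<close> kills the first and \<open>dv\<close>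
  the second, and in \<open>D (D x)\<close> the mixed terms cancel by the alternating sign.\<close>

definition hpart :: "nat \<Rightarrow> (nat \<Rightarrow> 'v) \<Rightarrow> nat \<Rightarrow> 'v" where
  "hpart n x i = (case i of 0 \<Rightarrow> \<zero>\<^bsub>X 0 (Suc n)\<^esub> | Suc i' \<Rightarrow> dh i' (n - i') (x i'))"

definition vpart :: "nat \<Rightarrow> (nat \<Rightarrow> 'v) \<Rightarrow> nat \<Rightarrow> 'v" where
  "vpart n x i = (if i = Suc n then \<zero>\<^bsub>X i 0\<^esub>
      else if even i then dv i (n - i) (x i)
      else \<ominus>\<^bsub>X i (Suc n - i)\<^esub> dv i (n - i) (x i))"

lemma diff_component: "i \<le> Suc n \<Longrightarrow> D n x i = hpart n x i \<oplus>\<^bsub>X i (Suc n - i)\<^esub> vpart n x i"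
  by (simp add: total_diff_def hpart_def vpart_def)

lemma hpart_linear:
  assumes "i \<le> Suc n"
  shows "(\<lambda>x. hpart n x i) \<in> linear_maps K (T n) (X i (Suc n - i))"
proof (cases i)
  case 0
  then show ?thesis
    by (intro linear_mapsI) (auto simp: hpart_def module.smult_r_null[OF X])
next
  case (Suc i')
  then have "(\<lambda>x. dh i' (n - i') (x i')) \<in> linear_maps K (T n) (X i (Suc n - i))"
    using linear_comp[OF total_component[of i' n] dh] assms by simp
  then show ?thesis using Suc by (simp add: hpart_def)
qed

lemma uminus_linear: "(\<lambda>x. \<ominus>\<^bsub>X i j\<^esub> x) \<in> linear_maps K (X i j) (X i j)"
proof -
  interpret M: module K "X i j" by (rule X)
  show ?thesis by (rule linear_mapsI) (auto simp: M.minus_add M.smult_r_minus)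
qed

lemma vpart_linear:
  assumes "i \<le> Suc n"
  shows "(\<lambda>x. vpart n x i) \<in> linear_maps K (T n) (X i (Suc n - i))"
proof (cases "i = Suc n")
  case True
  then show ?thesis
    by (intro linear_mapsI) (auto simp: vpart_def module.smult_r_null[OF X])
next
  case False
  then have i: "i \<le> n" using assms by simp
  then have s: "Suc n - i = Suc (n - i)" by simp
  have *: "(\<lambda>x. dv i (n - i) (x i)) \<in> linear_maps K (T n) (X i (Suc n - i))"
    using linear_comp[OF total_component[OF i] dv] s by simp
  show ?thesis
  proof (cases "even i")
    case True
    with * show ?thesis using False by (simp add: vpart_def)
  next
    case odd: False
    with linear_comp[OF * uminus_linear] show ?thesis using False by (simp add: vpart_def)
  qed
qed

lemmas hpart_closed = linear_mapsD(1)[OF hpart_linear] and vpart_closed = linear_mapsD(1)[OF vpart_linear]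

lemma diff_closed:
  assumes x: "x \<in> carrier (T n)"
  shows "D n x \<in> carrier (T (Suc n))"
proof -
  have "D n x i \<in> carrier (X i (Suc n - i))" if "i \<le> Suc n" for i
    using hpart_closed[OF that x] vpart_closed[OF that x] by (simp add: diff_component[OF that])
  moreover have "D n x \<in> extensional {..Suc n}" by (simp add: total_diff_def)
  ultimately show ?thesis by (auto simp: PiE_iff)
qed

lemma diff_linear: "D n \<in> linear_maps K (T n) (T (Suc n))"
proof (rule linear_mapsI)
  note T1 = module_abelian[OF total_module, THEN abelian_group.axioms(1), THEN abelian_monoid.a_closed]
    module.smult_closed[OF total_module]
  fix x y assume xy: "x \<in> carrier (T n)" "y \<in> carrier (T n)"
  show "D n (x \<oplus>\<^bsub>T n\<^esub> y) = D n x \<oplus>\<^bsub>T (Suc n)\<^esub> D n y"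
  proof (rule total_eqI[OF diff_closed[OF T1(1)[OF xy]] T1(1)[OF diff_closed[OF xy(1)] diff_closed[OF xy(2)]]])
    fix i assume i: "i \<le> Suc n"
    note c = hpart_closed[OF i xy(1)] hpart_closed[OF i xy(2)] vpart_closed[OF i xy(1)] vpart_closed[OF i xy(2)]
    show "D n (x \<oplus>\<^bsub>T n\<^esub> y) i = (D n x \<oplus>\<^bsub>T (Suc n)\<^esub> D n y) i"
      using c i xy by (simp add: comp_add diff_closed diff_component linear_mapsD(2)[OF hpart_linear]
          linear_mapsD(2)[OF vpart_linear] X_ac del: total_simps)
  qed
next
  note T1 = module.smult_closed[OF total_module]
  fix k x assume k: "k \<in> carrier K" and x: "x \<in> carrier (T n)"
  show "D n (k \<odot>\<^bsub>T n\<^esub> x) = k \<odot>\<^bsub>T (Suc n)\<^esub> D n x"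
  proof (rule total_eqI[OF diff_closed[OF T1[OF k x]] T1[OF k diff_closed[OF x]]])
    fix i assume i: "i \<le> Suc n"
    show "D n (k \<odot>\<^bsub>T n\<^esub> x) i = (k \<odot>\<^bsub>T (Suc n)\<^esub> D n x) i"
      using i x k hpart_closed[OF i x] vpart_closed[OF i x]
      by (simp add: comp_smult diff_closed diff_component linear_mapsD(3)[OF hpart_linear]
          linear_mapsD(3)[OF vpart_linear] module.smult_r_distr[OF X] del: total_simps)
  qed
qed (rule diff_closed)

lemma dh_hpart: "i \<le> Suc n \<Longrightarrow> x \<in> carrier (T n) \<Longrightarrow> dh i (Suc n - i) (hpart n x i) = \<zero>\<^bsub>X (Suc i) (Suc n - i)\<^esub>"
  by (cases i) (auto simp: hpart_def dh_dh total_memD simp del: total_simps)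

lemma dv_vpart:
  assumes "i \<le> Suc n" "x \<in> carrier (T n)"
  shows "dv i (Suc n - i) (vpart n x i) = \<zero>\<^bsub>X i (Suc (Suc n - i))\<^esub>"
proof (cases "i = Suc n")
  case False
  then have s: "Suc n - i = Suc (n - i)" "i \<le> n" using assms by auto
  then have "dv i (n - i) (x i) \<in> carrier (X i (Suc (n - i)))" using total_memD[OF assms(2)] by simp
  then show ?thesis using s False dv_dv total_memD[OF assms(2) s(2)] by (simp add: vpart_def)
qed (simp add: vpart_def)

lemma diff_diff:
  assumes x: "x \<in> carrier (T n)"
  shows "D (Suc n) (D n x) = \<zero>\<^bsub>T (Suc (Suc n))\<^esub>"
proof (rule total_eqI[of _ "Suc (Suc n)"])
  note Dx = diff_closed[OF x]
  show "D (Suc n) (D n x) \<in> carrier (T (Suc (Suc n)))" by (rule diff_closed[OF Dx])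
  show "\<zero>\<^bsub>T (Suc (Suc n))\<^esub> \<in> carrier (T (Suc (Suc n)))" by auto
  fix i assume i: "i \<le> Suc (Suc n)"
  have h: "dh i (Suc n - i) (D n x i) = dh i (Suc n - i) (vpart n x i)" if "i \<le> Suc n" for i
    using that hpart_closed[OF that x] vpart_closed[OF that x] dh_hpart[OF that x]
    by (simp add: diff_component dh_add)
  have v: "dv i (Suc n - i) (D n x i) = dv i (Suc n - i) (hpart n x i)" if "i \<le> Suc n" for i
    using that hpart_closed[OF that x] vpart_closed[OF that x] dv_vpart[OF that x]
    by (simp add: diff_component dv_add)
  have "hpart (Suc n) (D n x) i \<oplus>\<^bsub>X i (Suc (Suc n) - i)\<^esub> vpart (Suc n) (D n x) i = \<zero>\<^bsub>X i (Suc (Suc n) - i)\<^esub>"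
  proof (cases i)
    case 0
    then show ?thesis using v[of 0] by (simp add: hpart_def vpart_def)
  next
    case (Suc i')
    then have i': "i' \<le> Suc n" using i by simp
    have H: "hpart (Suc n) (D n x) i = dh i' (Suc n - i') (vpart n x i')"
      using h[OF i'] Suc by (simp add: hpart_def)
    show ?thesis
    proof (cases "i' = Suc n")
      case True
      then show ?thesis using H Suc by (simp add: vpart_def)
    next
      case False
      then have le: "i' \<le> n" using i' by simp
      then have s: "Suc n - i' = Suc (n - i')" by simp
      have xi: "x i' \<in> carrier (X i' (n - i'))" using total_memD[OF x le] .
      have hx: "hpart n x i = dh i' (n - i') (x i')" using Suc by (simp add: hpart_def)
      have V: "vpart (Suc n) (D n x) i = (if even i then dv i (n - i') (dh i' (n - i') (x i'))
          else \<ominus>\<^bsub>X i (Suc (n - i'))\<^esub> dv i (n - i') (dh i' (n - i') (x i')))"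
        using v[of i] hx Suc le s by (simp add: vpart_def)
      have H': "hpart (Suc n) (D n x) i = (if even i' then dv i (n - i') (dh i' (n - i') (x i'))
          else \<ominus>\<^bsub>X i (Suc (n - i'))\<^esub> dv i (n - i') (dh i' (n - i') (x i')))"
        unfolding H using le s Suc xi dh_dv[OF xi] by (simp add: vpart_def)
      show ?thesis using V H' Suc s xi by simp
    qed
  qed
  then show "D (Suc n) (D n x) i = \<zero>\<^bsub>T (Suc (Suc n))\<^esub> i"
    using i by (simp add: diff_component)
qed

lemma Fil_mem: "x \<in> Fil p n \<longleftrightarrow> x \<in> carrier (T n) \<and> (\<forall>i \<le> n. n - i < p \<longrightarrow> x i = \<zero>\<^bsub>X i (n - i)\<^esub>)"
  by (simp add: total_filtration_def)

lemma Fil_mono: "p \<le> p' \<Longrightarrow> Fil p' n \<subseteq> Fil p n"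
  by (auto simp: Fil_mem)

lemma Fil_submodule: "submodule (Fil p n) K (T n)"
proof -
  interpret T: module K "T n" by (rule total_module)
  show ?thesis
  proof (rule T.submoduleI)
    show "\<ominus>\<^bsub>T n\<^esub> x \<in> Fil p n" if "x \<in> Fil p n" for x
      using that linear_uminus[OF total_module X total_component, of _ n x] unfolding Fil_mem
      by (simp del: total_simps)
  qed (auto simp: Fil_mem comp_add comp_smult comp_zero module.smult_r_null[OF X] simp del: total_simps)
qed

abbreviation Zr where "Zr \<equiv> filtered_Z D Fil"
abbreviation Br where "Br \<equiv> filtered_B T D Fil"
abbreviation den where "den \<equiv> filtered_denominator T D Fil"

lemma Zr_mem: "x \<in> Zr r p n \<longleftrightarrow> x \<in> Fil p n \<and> D n x \<in> Fil (p + r) (Suc n)"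
  by (simp add: filtered_Z_def)

lemma Zr_submodule: "submodule (Zr r p n) K (T n)"
proof -
  interpret T: module K "T n" by (rule total_module)
  have 1: "submodule {x \<in> carrier (T n). D n x \<in> Fil (p + r) (Suc n)} K (T n)"
    by (rule kernel_submodule[OF total_module total_module diff_linear Fil_submodule])
  note E = T.submoduleE[OF Fil_submodule[of p n]] T.submoduleE[OF 1]
  have "Zr r p n = Fil p n \<inter> {x \<in> carrier (T n). D n x \<in> Fil (p + r) (Suc n)}"
    by (auto simp: Zr_mem Fil_mem simp del: total_simps)
  then show ?thesis
    using E submodule_zero[OF total_module 1] submodule_zero[OF total_module Fil_submodule]
    by (intro T.submoduleI) (auto simp del: total_simps)
qed

lemma Br_mem:
  "x \<in> Br r p n \<longleftrightarrow> (case n of 0 \<Rightarrow> x = \<zero>\<^bsub>T 0\<^esub>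
    | Suc m \<Rightarrow> \<exists>y. y \<in> Fil (p - (r - 1)) m \<and> x = D m y \<and> x \<in> Fil p n)"
  by (auto simp: filtered_B_def split: nat.splits)

lemma Br_submodule: "submodule (Br r p n) K (T n)"
proof (cases n)
  case 0
  then have "Br r p n = {\<zero>\<^bsub>T n\<^esub>}" by (auto simp: Br_mem)
  then show ?thesis using zero_submodule[OF total_module] by simp
next
  case (Suc m)
  interpret T: module K "T m" by (rule total_module)
  have 1: "submodule {x \<in> carrier (T m). D m x \<in> Fil p n} K (T m)"
    unfolding Suc by (rule kernel_submodule[OF total_module total_module diff_linear Fil_submodule])
  let ?Y = "Fil (p - (r - 1)) m \<inter> {x \<in> carrier (T m). D m x \<in> Fil p n}"
  note E = T.submoduleE[OF Fil_submodule[of "p - (r - 1)" m]] T.submoduleE[OF 1]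
  have "submodule ?Y K (T m)"
    using E submodule_zero[OF total_module 1] submodule_zero[OF total_module Fil_submodule]
    by (intro T.submoduleI) (auto simp del: total_simps)
  moreover have "Br r p n = D m ` ?Y" unfolding Suc by (auto simp: Br_mem Fil_mem simp del: total_simps)
  ultimately show ?thesis using image_submodule[OF total_module total_module diff_linear] Suc by simp
qed

lemma den_submodule: "submodule (den r p n) K (T n)"
  unfolding filtered_denominator_def
  by (rule set_add_submodule[OF total_module Zr_submodule Br_submodule])

lemma den_mem: "x \<in> den r p n \<longleftrightarrow> (\<exists>u \<in> Zr (r - 1) (Suc p) n. \<exists>b \<in> Br r p n. x = u \<oplus>\<^bsub>T n\<^esub> b)"
  by (auto simp: filtered_denominator_def set_add_def set_mult_def)

lemma Br_carrier: "x \<in> Br r p n \<Longrightarrow> x \<in> carrier (T n)"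
  by (rule submodule_carrierD[OF Br_submodule])

lemma Zr_carrier: "x \<in> Zr r p n \<Longrightarrow> x \<in> carrier (T n)"
  by (rule submodule_carrierD[OF Zr_submodule])

lemma diff_Br: "x \<in> Br r p n \<Longrightarrow> D n x = \<zero>\<^bsub>T (Suc n)\<^esub>"
  using linear_zero[OF total_module total_module diff_linear, of n]
  by (cases n) (auto simp: Br_mem diff_diff Fil_mem simp del: total_simps)

lemma Br_Zr: "Br r p n \<subseteq> Zr r p n"
proof
  fix x assume x: "x \<in> Br r p n"
  have "x \<in> Fil p n"
    using x submodule_zero[OF total_module Fil_submodule] by (cases n) (auto simp: Br_mem simp del: total_simps)
  then show "x \<in> Zr r p n" using diff_Br[OF x] submodule_zero[OF total_module Fil_submodule]
    by (simp add: Zr_mem del: total_simps)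
qed

lemma den_Zr: "r \<ge> 1 \<Longrightarrow> den r p n \<subseteq> Zr r p n"
proof
  interpret T: module K "T n" by (rule total_module)
  fix x assume r: "r \<ge> 1" and "x \<in> den r p n"
  then obtain u b where "u \<in> Zr (r - 1) (Suc p) n" "b \<in> Br r p n" "x = u \<oplus>\<^bsub>T n\<^esub> b" by (auto simp: den_mem)
  moreover from this(1) r have "u \<in> Zr r p n" using Fil_mono[of p "Suc p" n] by (auto simp: Zr_mem)
  ultimately show "x \<in> Zr r p n" using T.submoduleE(5)[OF Zr_submodule] Br_Zr by blast
qed

abbreviation page where "page \<equiv> filtered_page T D Fil"
abbreviation pdiff where "pdiff \<equiv> filtered_diff T D Fil"

lemma page_module: "r \<ge> 1 \<Longrightarrow> module K (page r p q)"
  unfolding filtered_page_def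
  by (rule subquotient_module[OF total_module Zr_submodule den_submodule den_Zr])

lemma page_simps:
  "carrier (page r p q) = (\<lambda>x. den r p (p + q) +>\<^bsub>T (p + q)\<^esub> x) ` Zr r p (p + q)"
  "\<zero>\<^bsub>page r p q\<^esub> = den r p (p + q)"
  by (simp_all add: filtered_page_def)

lemma page_diff_linear:
  assumes "r \<ge> 1" "r \<le> q + 1"
  shows "pdiff r p q \<in> linear_maps K (page r p q) (page r (p + r) (q + 1 - r))"
proof -
  define n where "n = p + q"
  have n': "p + r + (q + 1 - r) = Suc n" using assms by (simp add: n_def)
  let ?P = "page r p q" and ?P' = "page r (p + r) (q + 1 - r)"
  have P': "?P' = subquotient (T (Suc n)) (Zr r (p + r) (Suc n)) (den r (p + r) (Suc n))"
    unfolding filtered_page_def n' ..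
  have P: "?P = subquotient (T n) (Zr r p n) (den r p n)" by (simp add: filtered_page_def n_def)
  have DZ: "D n x \<in> Zr r (p + r) (Suc n)" if "x \<in> Zr r p n" for x
    using that diff_diff[OF Zr_carrier[OF that]] submodule_zero[OF total_module Fil_submodule]
    by (simp add: Zr_mem del: total_simps)
  have Dden: "D n x \<in> den r (p + r) (Suc n)" if x: "x \<in> den r p n" for x
  proof -
    interpret T: module K "T (Suc n)" by (rule total_module)
    obtain u b where u: "u \<in> Zr (r - 1) (Suc p) n" "b \<in> Br r p n" "x = u \<oplus>\<^bsub>T n\<^esub> b"
      using x by (auto simp: den_mem)
    have "D n x = D n u"
      using u Zr_carrier[OF u(1)] Br_carrier[OF u(2)] diff_Br[OF u(2)] diff_closed[OF Zr_carrier[OF u(1)]]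
      by (simp add: linear_mapsD(2)[OF diff_linear] del: total_simps)
    also have "\<dots> \<in> Br r (p + r) (Suc n)"
    proof -
      have "p + r - (r - 1) = Suc p" "Suc p + (r - 1) = p + r" using assms by auto
      then show ?thesis using u(1) by (auto simp: Br_mem Zr_mem)
    qed
    also have "\<dots> \<subseteq> den r (p + r) (Suc n)"
    proof
      fix y assume "y \<in> Br r (p + r) (Suc n)"
      then show "y \<in> den r (p + r) (Suc n)"
        unfolding den_mem using submodule_zero[OF total_module Zr_submodule] Br_carrier
        by (intro bexI[of _ "\<zero>\<^bsub>T (Suc n)\<^esub>"] bexI[of _ y]) (simp_all del: total_simps)
    qed
    finally show ?thesis .
  qed
  have val: "pdiff r p q (den r p n +>\<^bsub>T n\<^esub> x) = den r (p + r) (Suc n) +>\<^bsub>T (Suc n)\<^esub> D n x"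
    if "x \<in> carrier (T n)" for x
    unfolding filtered_diff_def n_def[symmetric]
    by (rule coset_map_coset[OF total_module total_module diff_linear den_submodule den_submodule Dden that])
  interpret T: module K "T n" by (rule total_module)
  note c = Zr_carrier and cl = diff_closed
  show ?thesis
    unfolding P P'
  proof (rule linear_mapsI, goal_cases)
    case (1 x)
    then show ?case using val DZ c by auto
  next
    case (2 x y)
    then obtain u v where "u \<in> Zr r p n" "v \<in> Zr r p n" "x = den r p n +>\<^bsub>T n\<^esub> u" "y = den r p n +>\<^bsub>T n\<^esub> v" by auto
    then show ?case
      using c[of u] c[of v] cl
      by (simp add: coset_add[OF total_module den_submodule] val linear_mapsD(2)[OF diff_linear] del: total_simps)
  next
    case (3 k x)
    then obtain u where "u \<in> Zr r p n" "x = den r p n +>\<^bsub>T n\<^esub> u" by auto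
    then show ?case
      using c[of u] cl 3
      by (simp add: coset_smult[OF total_module den_submodule] val linear_mapsD(3)[OF diff_linear] del: total_simps)
  qed
qed

definition concentrated :: "nat \<Rightarrow> nat \<Rightarrow> 'v \<Rightarrow> nat \<Rightarrow> 'v" where
  "concentrated n i y = (\<lambda>k \<in> {..n}. if k = i then y else \<zero>\<^bsub>X k (n - k)\<^esub>)"

lemma concentrated_carrier: "y \<in> carrier (X i (n - i)) \<Longrightarrow> concentrated n i y \<in> carrier (T n)"
  by (auto simp: concentrated_def PiE_iff)

lemma concentrated_component: "k \<le> n \<Longrightarrow> concentrated n i y k = (if k = i then y else \<zero>\<^bsub>X k (n - k)\<^esub>)"
  by (simp add: concentrated_def)

lemma concentrated_linear: "i \<le> n \<Longrightarrow> concentrated n i \<in> linear_maps K (X i (n - i)) (T n)"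
  by (rule linear_mapsI)
    (auto simp: concentrated_carrier simp del: total_simps(1),
     auto simp: concentrated_def fun_eq_iff module.smult_r_null[OF X])

lemma diff_concentrated:
  assumes i: "i \<le> n" and y: "y \<in> carrier (X i (n - i))" and k: "k \<le> Suc n"
  shows "D n (concentrated n i y) k = (if k = Suc i then dh i (n - i) y
     else if k = i then (if even i then dv i (n - i) y else \<ominus>\<^bsub>X i (Suc (n - i))\<^esub> dv i (n - i) y)
     else \<zero>\<^bsub>X k (Suc n - k)\<^esub>)"
proof -
  have h: "hpart n (concentrated n i y) k = (if k = Suc i then dh i (n - i) y else \<zero>\<^bsub>X k (Suc n - k)\<^esub>)"
    using k by (cases k) (auto simp: hpart_def concentrated_component)
  have v: "vpart n (concentrated n i y) k = (if k = i then (if even i then dv i (n - i) y else \<ominus>\<^bsub>X i (Suc (n - i))\<^esub> dv i (n - i) y)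
     else \<zero>\<^bsub>X k (Suc n - k)\<^esub>)"
  proof (cases "k = Suc n")
    case False
    then have "k \<le> n" "Suc n - k = Suc (n - k)" using k by auto
    then show ?thesis using False by (auto simp: vpart_def concentrated_component)
  qed (use i in \<open>simp add: vpart_def\<close>)
  have "Suc n - i = Suc (n - i)" using i by simp
  then show ?thesis using y i by (auto simp: diff_component[OF k] h v)
qed

end

section \<open>Degeneration at the second page\<close>

text \<open>If the row cohomology, as a complex along the columns, is a resolution of the cohomology
  of \<open>(A, \<delta>)\<close>, then the second page is concentrated in the column \<open>p = 0\<close>.  The hypotheses below
  say this in terms of representatives.\<close>

locale degenerate_double_complex = double_complex K X dh dv + A: cochain_complex K A \<delta>
  for K :: "('k, 'm) ring_scheme" and X :: "nat \<Rightarrow> nat \<Rightarrow> ('k, 'v, 'x) module_scheme" and dh dv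
    and A :: "nat \<Rightarrow> ('k, 'a, 'y) module_scheme" and \<delta> +
  fixes \<eta> :: "nat \<Rightarrow> 'a \<Rightarrow> 'v"
  assumes aug: "\<eta> i \<in> linear_maps K (A i) (X i 0)"
    and dh_aug: "a \<in> carrier (A i) \<Longrightarrow> dh i 0 (\<eta> i a) = \<eta> (Suc i) (\<delta> i a)"
    and dv_aug: "a \<in> carrier (A i) \<Longrightarrow> dv i 0 (\<eta> i a) = \<zero>\<^bsub>X i (Suc 0)\<^esub>"
    and row_exact: "x \<in> carrier (X i (Suc j)) \<Longrightarrow> dh i (Suc j) x = \<zero>\<^bsub>X (Suc i) (Suc j)\<^esub> \<Longrightarrow>
       dv i (Suc j) x \<in> coboundaries (\<lambda>i. X i (Suc (Suc j))) (\<lambda>i. dh i (Suc (Suc j))) i \<Longrightarrow>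
       \<exists>y \<in> carrier (X i j). dh i j y = \<zero>\<^bsub>X (Suc i) j\<^esub> \<and>
         x \<ominus>\<^bsub>X i (Suc j)\<^esub> dv i j y \<in> coboundaries (\<lambda>i. X i (Suc j)) (\<lambda>i. dh i (Suc j)) i"
    and row_exact_0: "x \<in> carrier (X i 0) \<Longrightarrow> dh i 0 x = \<zero>\<^bsub>X (Suc i) 0\<^esub> \<Longrightarrow>
       dv i 0 x \<in> coboundaries (\<lambda>i. X i (Suc 0)) (\<lambda>i. dh i (Suc 0)) i \<Longrightarrow>
       \<exists>a \<in> cocycles A \<delta> i. x \<ominus>\<^bsub>X i 0\<^esub> \<eta> i a \<in> coboundaries (\<lambda>i. X i 0) (\<lambda>i. dh i 0) i"
    and row_injective: "a \<in> cocycles A \<delta> i \<Longrightarrow> \<eta> i a \<in> coboundaries (\<lambda>i. X i 0) (\<lambda>i. dh i 0) i \<Longrightarrow>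
       a \<in> coboundaries A \<delta> i"
begin

lemma uminus_mem_iff:
  assumes "module K M" "submodule B K M" "x \<in> carrier M"
  shows "\<ominus>\<^bsub>M\<^esub> x \<in> B \<longleftrightarrow> x \<in> B"
proof -
  interpret M: module K M by fact
  show ?thesis using M.submoduleE(3)[OF assms(2)] M.minus_minus[OF assms(3)] by metis
qed

lemma row_complex: "cochain_complex K (\<lambda>i. X i j) (\<lambda>i. dh i j)"
  by (rule cochain_complex.intro) (simp_all add: X dh dh_dh)

lemma row_coboundaries_submodule: "submodule (coboundaries (\<lambda>i. X i j) (\<lambda>i. dh i j) i) K (X i j)"
  by (rule cochain_complex.coboundaries_submodule[OF row_complex])

text \<open>For \<open>r \<ge> 2\<close> two components of \<open>D x\<close> next to the leading component \<open>x q\<close> vanish: one contains only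
  \<open>dh (x q)\<close>, and the other equates \<open>dv (x q)\<close> with a row coboundary up to sign.\<close>

lemma leading_component:
  assumes r: "r \<ge> 2" and x: "x \<in> Zr r p (p + q)"
  shows "x q \<in> carrier (X q p)" "dh q p (x q) = \<zero>\<^bsub>X (Suc q) p\<^esub>"
    and "dv q p (x q) \<in> coboundaries (\<lambda>i. X i (Suc p)) (\<lambda>i. dh i (Suc p)) q"
proof -
  let ?n = "p + q"
  have xT: "x \<in> carrier (T ?n)" and xF: "\<And>i. i \<le> ?n \<Longrightarrow> ?n - i < p \<Longrightarrow> x i = \<zero>\<^bsub>X i (?n - i)\<^esub>"
    and Dx: "\<And>i. i \<le> Suc ?n \<Longrightarrow> Suc ?n - i < p + r \<Longrightarrow> D ?n x i = \<zero>\<^bsub>X i (Suc ?n - i)\<^esub>"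
    using x by (auto simp: Zr_mem Fil_mem simp del: total_simps)
  show xq: "x q \<in> carrier (X q p)" using total_memD[OF xT, of q] by simp
  have "vpart ?n x (Suc q) = \<zero>\<^bsub>X (Suc q) p\<^esub>"
  proof (cases p)
    case (Suc p')
    then have "x (Suc q) = \<zero>\<^bsub>X (Suc q) p'\<^esub>" using xF[of "Suc q"] by simp
    then show ?thesis using Suc by (simp add: vpart_def)
  qed (simp add: vpart_def)
  then show "dh q p (x q) = \<zero>\<^bsub>X (Suc q) p\<^esub>"
    using Dx[of "Suc q"] r xq by (simp add: diff_component hpart_def)
  let ?B = "coboundaries (\<lambda>i. X i (Suc p)) (\<lambda>i. dh i (Suc p)) q"
  interpret M: module K "X q (Suc p)" by (rule X)
  let ?h = "hpart ?n x q" and ?v = "vpart ?n x q"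
  have h: "?h \<in> ?B"
  proof (cases q)
    case 0
    then show ?thesis by (simp add: hpart_def coboundaries_def)
  next
    case (Suc q')
    then have "x q' \<in> carrier (X q' (Suc p))" using total_memD[OF xT, of q'] by (simp add: Suc_diff_le)
    then show ?thesis using Suc by (auto simp: hpart_def coboundaries_def Suc_diff_le)
  qed
  have hv: "?h \<oplus>\<^bsub>X q (Suc p)\<^esub> ?v = \<zero>\<^bsub>X q (Suc p)\<^esub>"
    using Dx[of q] r by (simp add: diff_component Suc_diff_le)
  have c: "?h \<in> carrier (X q (Suc p))" "?v \<in> carrier (X q (Suc p))"
    using hpart_closed[OF _ xT, of q] vpart_closed[OF _ xT, of q] by (simp_all add: Suc_diff_le)
  have "\<ominus>\<^bsub>X q (Suc p)\<^esub> ?h = ?v" using hv c by (metis M.minus_equality M.M.a_comm)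
  then have "?v \<in> ?B" using h M.submoduleE(3)[OF row_coboundaries_submodule] by metis
  then show "dv q p (x q) \<in> ?B"
    using xq uminus_mem_iff[OF X row_coboundaries_submodule, of "dv q p (x q)" q "Suc p"]
    by (auto simp: vpart_def split: if_splits)
qed

text \<open>If the leading component is \<open>dh z\<close>, then subtracting the total differential of \<open>z\<close> leaves a cochain
  of higher filtration with the same total differential as \<open>x\<close>.\<close>

lemma lower_leading_term:
  assumes r: "r \<ge> 2" and x: "x \<in> Zr r p (p + q)"
    and lead: "x q \<in> coboundaries (\<lambda>i. X i p) (\<lambda>i. dh i p) q"
  shows "x \<in> den r p (p + q)"
proof -
  let ?n = "p + q"
  interpret T: module K "T ?n" by (rule total_module)
  have xF: "x \<in> Fil p ?n" and xT: "x \<in> carrier (T ?n)" using x by (auto simp: Zr_mem Fil_mem simp del: total_simps)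
  have "\<exists>b \<in> Br r p ?n. b q = x q"
  proof (cases q)
    case 0
    then have "x q = \<zero>\<^bsub>X q p\<^esub>" using lead by (simp add: coboundaries_def)
    then show ?thesis using 0 submodule_zero[OF total_module Br_submodule]
      by (intro bexI[of _ "\<zero>\<^bsub>T ?n\<^esub>"]) auto
  next
    case (Suc q')
    then obtain z where z: "z \<in> carrier (X q' p)" "x q = dh q' p z" using lead by (auto simp: coboundaries_def)
    let ?m = "p + q'"
    have n: "?n = Suc ?m" using Suc by simp
    let ?w = "concentrated ?m q' z"
    have zc: "z \<in> carrier (X q' (?m - q'))" using z by simp
    have w: "?w \<in> Fil (p - (r - 1)) ?m"
      using concentrated_carrier[OF zc] by (auto simp: Fil_mem concentrated_component simp del: total_simps)
    have Dw: "D ?m ?w k = (if k = Suc q' then x q else if k = q' then (if even q' then dv q' p z else \<ominus>\<^bsub>X q' (Suc p)\<^esub> dv q' p z)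
        else \<zero>\<^bsub>X k (?n - k)\<^esub>)" if "k \<le> ?n" for k
      using that diff_concentrated[OF _ zc, of k] z(2) n by simp
    have "D ?m ?w \<in> Fil p ?n"
      using diff_closed[OF concentrated_carrier[OF zc]] Dw n Suc by (auto simp: Fil_mem simp del: total_simps)
    then have "D ?m ?w \<in> Br r p ?n" using w n by (auto simp: Br_mem)
    then show ?thesis using Dw[of q] Suc by auto
  qed
  then obtain b where b: "b \<in> Br r p ?n" "b q = x q" by blast
  have bF: "b \<in> Fil p ?n" and bT: "b \<in> carrier (T ?n)" using subsetD[OF Br_Zr b(1)] Br_carrier[OF b(1)] by (simp_all add: Zr_mem del: total_simps)
  let ?u = "x \<ominus>\<^bsub>T ?n\<^esub> b"
  have uT: "?u \<in> carrier (T ?n)" using xT bT by (simp del: total_simps)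
  have "?u i = \<zero>\<^bsub>X i (?n - i)\<^esub>" if i: "i \<le> ?n" "?n - i < Suc p" for i
  proof (cases "i = q")
    case True
    then show ?thesis using comp_minus[OF i(1) xT bT] b(2) total_memD[OF xT i(1)]
      by (simp add: X_minus)
  next
    case False
    then have "?n - i < p" using i by auto
    then have "x i = \<zero>\<^bsub>X i (?n - i)\<^esub>" "b i = \<zero>\<^bsub>X i (?n - i)\<^esub>" using xF bF i by (auto simp: Fil_mem)
    then show ?thesis using comp_minus[OF i(1) xT bT] by (simp add: X_minus)
  qed
  then have "?u \<in> Fil (Suc p) ?n" using uT by (simp add: Fil_mem)
  moreover have "D ?n ?u = D ?n x"
    using linear_minus[OF total_module total_module diff_linear xT bT] diff_Br[OF b(1)] diff_closed[OF xT]
      module_abelian[OF total_module]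
    by (metis abelian_group.minus_eq abelian_group.axioms(1) abelian_monoid.r_zero abelian_group.minus_equality abelian_monoid.zero_closed)
  moreover have "Suc p + (r - 1) = p + r" using r by simp
  ultimately have "?u \<in> Zr (r - 1) (Suc p) ?n" using x by (simp add: Zr_mem)
  moreover have "x = ?u \<oplus>\<^bsub>T ?n\<^esub> b" using xT bT by (simp add: T.minus_eq T.M.a_assoc T.l_neg del: total_simps)
  ultimately show ?thesis using b(1) unfolding den_mem by blast
qed

text \<open>Row exactness gives \<open>y\<close> in the previous column with \<open>dh y = 0\<close> such that \<open>x q - dv y\<close> is a row
  coboundary, so \<open>x\<close> minus the total differential of \<open>y\<close> has a leading component as in the preceding
  lemma.  As \<open>r \<ge> 2\<close>, the column of \<open>y\<close> is still among those that contribute to \<open>Br\<close>.\<close>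

lemma page_zero:
  assumes r: "r \<ge> 2" and p: "p > 0"
  shows "carrier (page r p q) = {\<zero>\<^bsub>page r p q\<^esub>}"
proof -
  let ?n = "p + q"
  obtain p' where p': "p = Suc p'" using p by (cases p) auto
  interpret T: module K "T ?n" by (rule total_module)
  have "x \<in> den r p ?n" if x: "x \<in> Zr r p ?n" for x
  proof -
    note lc = leading_component[OF r x]
    obtain y where y: "y \<in> carrier (X q p')" "dh q p' y = \<zero>\<^bsub>X (Suc q) p'\<^esub>"
      "x q \<ominus>\<^bsub>X q p\<^esub> dv q p' y \<in> coboundaries (\<lambda>i. X i p) (\<lambda>i. dh i p) q"
      using row_exact[of "x q" q p'] lc unfolding p' by blast
    let ?m = "p' + q"
    have n: "?n = Suc ?m" using p' by simp
    \<comment> \<open>the sign compensates the one in the total differential\<close>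
    let ?y = "if even q then y else \<ominus>\<^bsub>X q p'\<^esub> y"
    let ?w = "concentrated ?m q ?y"
    have yc: "?y \<in> carrier (X q (?m - q))" using y by simp
    have Dw: "D ?m ?w k = (if k = q then dv q p' y else \<zero>\<^bsub>X k (?n - k)\<^esub>)" if "k \<le> ?n" for k
      using that diff_concentrated[OF _ yc, of k] y n by (auto simp: p')
    have "?w \<in> Fil (p - (r - 1)) ?m"
      using concentrated_carrier[OF yc] r p' by (auto simp: Fil_mem concentrated_component simp del: total_simps)
    moreover have "D ?m ?w \<in> Fil p ?n"
      using diff_closed[OF concentrated_carrier[OF yc]] Dw n by (auto simp: Fil_mem simp del: total_simps)
    ultimately have b: "D ?m ?w \<in> Br r p ?n" unfolding n by (auto simp: Br_mem)
    then have bden: "D ?m ?w \<in> den r p ?n"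
      unfolding den_mem using submodule_zero[OF total_module Zr_submodule] Br_carrier[OF b]
      by (intro bexI[of _ "\<zero>\<^bsub>T ?n\<^esub>"] bexI[of _ "D ?m ?w"]) (simp_all del: total_simps)
    let ?u = "x \<ominus>\<^bsub>T ?n\<^esub> D ?m ?w"
    note xT = Zr_carrier[OF x] and bT = Br_carrier[OF b]
    have "?u \<in> Zr r p ?n"
      using T.submoduleE(3,5)[OF Zr_submodule] x subsetD[OF Br_Zr b] by (simp add: T.minus_eq del: total_simps)
    moreover have "?u q \<in> coboundaries (\<lambda>i. X i p) (\<lambda>i. dh i p) q"
      using comp_minus[OF _ xT bT, of q] Dw[of q] y(3) by simp
    ultimately have "?u \<in> den r p ?n" by (rule lower_leading_term[OF r])
    then have "?u \<oplus>\<^bsub>T ?n\<^esub> D ?m ?w \<in> den r p ?n" using bden T.submoduleE(5)[OF den_submodule] by blast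
    then show ?thesis using xT bT by (simp add: T.minus_eq T.M.a_assoc T.l_neg del: total_simps)
  qed
  moreover have "\<zero>\<^bsub>T ?n\<^esub> \<in> Zr r p ?n" by (rule submodule_zero[OF total_module Zr_submodule])
  ultimately show ?thesis
    unfolding page_simps using coset_zero[OF total_module den_submodule] by blast
qed

text \<open>The edge map sends a cocycle \<open>a\<close> to the cochain with the single component \<open>\<eta> a\<close>, which is a
  cocycle of the total complex.  It is onto because an element of \<open>Zr r 0 q\<close> can be corrected to such a
  cochain at its leading component.\<close>

lemma page_first_column:
  assumes r: "r \<ge> 2"
  shows "module_iso K (cohomology A \<delta> q) (page r 0 q)"
proof -
  let ?f = "\<lambda>a. concentrated q q (\<eta> q a)"
  let ?cl = "\<lambda>x. den r 0 q +>\<^bsub>T q\<^esub> x"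
  interpret T: module K "T q" by (rule total_module)
  have c: "\<eta> q a \<in> carrier (X q (q - q))" if "a \<in> carrier (A q)" for a using linear_mapsD(1)[OF aug that] by simp
  have fT: "?f a \<in> carrier (T q)" if "a \<in> carrier (A q)" for a using concentrated_carrier[OF c[OF that]] .
  have flin: "?f \<in> linear_maps K (A q) (T q)"
    using linear_comp[OF aug, of "concentrated q q" q "T q"] concentrated_linear[of q q] by simp
  have Zr0: "x \<in> Fil 0 n" if "x \<in> carrier (T n)" for x n using that by (simp add: Fil_mem)
  have fZ: "?f a \<in> Zr r 0 q" "D q (?f a) = \<zero>\<^bsub>T (Suc q)\<^esub>" if a: "a \<in> cocycles A \<delta> q" for a
  proof -
    note ac = A.cocycles_carrier[OF a]
    show "D q (?f a) = \<zero>\<^bsub>T (Suc q)\<^esub>"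
    proof (rule total_eqI[OF diff_closed[OF fT[OF ac]]])
      show "\<zero>\<^bsub>T (Suc q)\<^esub> \<in> carrier (T (Suc q))" by auto
      have "\<eta> (Suc q) (\<delta> q a) = \<zero>\<^bsub>X (Suc q) 0\<^esub>"
        using a linear_zero[OF A.mod X aug] by (simp add: cocycles_def)
      then show "D q (?f a) k = \<zero>\<^bsub>T (Suc q)\<^esub> k" if "k \<le> Suc q" for k
        using diff_concentrated[OF order.refl c[OF ac] that] dh_aug[OF ac] dv_aug[OF ac] that by auto
    qed
    then show "?f a \<in> Zr r 0 q" using Zr0[OF fT[OF ac]] submodule_zero[OF total_module Fil_submodule]
      by (simp add: Zr_mem del: total_simps)
  qed
  have "module_iso K (subquotient (A q) (cocycles A \<delta> q) (coboundaries A \<delta> q)) (page r 0 q)"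
  proof (rule subquotient_iso[OF A.mod page_module A.cocycles_submodule])
    show "1 \<le> r" using r by simp
    show "(\<lambda>a. ?cl (?f a)) \<in> linear_maps K (A q\<lparr>carrier := cocycles A \<delta> q\<rparr>) (page r 0 q)"
      by (rule linear_mapsI)
        (use A.cocycles_carrier fZ fT linear_mapsD[OF flin] in \<open>auto simp: filtered_page_def
           coset_add[OF total_module den_submodule] coset_smult[OF total_module den_submodule] simp del: total_simps\<close>)
    show "(\<lambda>a. ?cl (?f a)) ` cocycles A \<delta> q = carrier (page r 0 q)"
    proof (intro equalityI subsetI)
      fix Y assume "Y \<in> carrier (page r 0 q)"
      then obtain x where x: "x \<in> Zr r 0 q" "Y = ?cl x" unfolding page_simps by auto
      note xT = Zr_carrier[OF x(1)]
      obtain a where a: "a \<in> cocycles A \<delta> q"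
        "x q \<ominus>\<^bsub>X q 0\<^esub> \<eta> q a \<in> coboundaries (\<lambda>i. X i 0) (\<lambda>i. dh i 0) q"
        using row_exact_0[of "x q" q] leading_component[OF r, of x 0 q] x(1) by auto
      note ac = A.cocycles_carrier[OF a(1)]
      have "x \<ominus>\<^bsub>T q\<^esub> ?f a \<in> Zr r 0 q"
        using T.submoduleE(3,5)[OF Zr_submodule] x(1) fZ(1)[OF a(1)] by (simp add: T.minus_eq del: total_simps)
      moreover have "(x \<ominus>\<^bsub>T q\<^esub> ?f a) q \<in> coboundaries (\<lambda>i. X i 0) (\<lambda>i. dh i 0) q"
        using comp_minus[OF order.refl xT fT[OF ac]] a(2) by (simp add: concentrated_component)
      ultimately have "x \<ominus>\<^bsub>T q\<^esub> ?f a \<in> den r 0 q"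
        using lower_leading_term[OF r, of _ 0 q] by simp
      then have "Y = ?cl (?f a)" using coset_eq_iff[OF total_module den_submodule xT fT[OF ac]] x(2) by simp
      then show "Y \<in> (\<lambda>a. ?cl (?f a)) ` cocycles A \<delta> q" using a(1) by blast
    qed (use fZ in \<open>auto simp: page_simps\<close>)
    have "?f a \<in> den r 0 q \<longleftrightarrow> a \<in> coboundaries A \<delta> q" if a: "a \<in> cocycles A \<delta> q" for a
    proof
      note ac = A.cocycles_carrier[OF a]
      assume "?f a \<in> den r 0 q"
      then obtain u b where ub: "u \<in> Zr (r - 1) (Suc 0) q" "b \<in> Br r 0 q" "?f a = u \<oplus>\<^bsub>T q\<^esub> b"
        unfolding den_mem by blast
      have u0: "u q = \<zero>\<^bsub>X q 0\<^esub>" using ub(1) by (auto simp: Zr_mem Fil_mem)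
      have bc: "b q \<in> carrier (X q 0)" using total_memD[OF Br_carrier[OF ub(2)], of q] by simp
      have "\<eta> q a = (u \<oplus>\<^bsub>T q\<^esub> b) q" using ub(3) concentrated_component[of q q q "\<eta> q a"] by simp
      also have "\<dots> = b q"
        using comp_add[OF order.refl Zr_carrier[OF ub(1)] Br_carrier[OF ub(2)]] u0 bc by simp
      also have "\<dots> \<in> coboundaries (\<lambda>i. X i 0) (\<lambda>i. dh i 0) q"
      proof (cases q)
        case 0
        then show ?thesis using ub(2) by (simp add: Br_mem coboundaries_def)
      next
        case (Suc m)
        then obtain w where w: "w \<in> carrier (T m)" "b = D m w" using ub(2) by (auto simp: Br_mem Fil_mem simp del: total_simps)
        then have "b q = dh m 0 (w m)" "w m \<in> carrier (X m 0)"
          using Suc total_memD[OF w(1), of m] by (simp_all add: diff_component hpart_def vpart_def)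
        then show ?thesis using Suc by (auto simp: coboundaries_def)
      qed
      finally show "a \<in> coboundaries A \<delta> q" by (rule row_injective[OF a])
    next
      assume b: "a \<in> coboundaries A \<delta> q"
      have "?f a q \<in> coboundaries (\<lambda>i. X i 0) (\<lambda>i. dh i 0) q"
      proof (cases q)
        case 0
        then show ?thesis using b linear_zero[OF A.mod X aug] by (simp add: coboundaries_def concentrated_component)
      next
        case (Suc m)
        then obtain a' where "a' \<in> carrier (A m)" "a = \<delta> m a'" using b by (auto simp: coboundaries_def)
        then show ?thesis
          using Suc dh_aug[of a' m, symmetric] linear_mapsD(1)[OF aug, of a' m] by (simp add: coboundaries_def concentrated_component)
      qed
      then show "?f a \<in> den r 0 q" using lower_leading_term[OF r, of "?f a" 0 q] fZ(1)[OF a] by simp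
    qed
    then have "coboundaries A \<delta> q = {a \<in> cocycles A \<delta> q. ?f a \<in> den r 0 q}"
      using A.coboundaries_subset by blast
    also have "\<dots> = {a \<in> cocycles A \<delta> q. ?cl (?f a) = \<zero>\<^bsub>page r 0 q\<^esub>}"
      by (rule Collect_cong)
        (simp add: page_simps coset_eq_zero_iff[OF total_module den_submodule fT[OF A.cocycles_carrier]] cong: conj_cong)
    finally show "coboundaries A \<delta> q = {a \<in> cocycles A \<delta> q. ?cl (?f a) = \<zero>\<^bsub>page r 0 q\<^esub>}" .
  qed
  then show ?thesis by (simp add: cohomology_def)
qed

lemma page_stable:
  assumes "r \<ge> 2" "s \<ge> 2"
  shows "module_iso K (page r p q) (page s p q)"
proof (cases "p > 0")
  case True
  then show ?thesis
    using assms by (intro module_iso_zero page_module page_zero) auto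
next
  case False
  have "r \<ge> 1" using assms by simp
  from module_iso_trans[OF module_iso_sym[OF A.cohomology_module page_module[OF this] page_first_column[OF assms(1)]]
      page_first_column[OF assms(2)]]
  show ?thesis using False by simp
qed

text \<open>Every differential ends in a column \<open>p > 0\<close>, where the pages with \<open>r \<ge> 2\<close> are zero.\<close>

theorem degenerate_spectral_sequence: "spectral_sequence K page pdiff"
  unfolding spectral_sequence_def
proof (intro allI impI)
  fix r p q :: nat
  assume r: "2 \<le> r"
  then have r1: "r \<ge> 1" by simp
  note m = page_module[OF r1]
  have z: "\<zero>\<^bsub>page r p q\<^esub> \<in> carrier (page r p q)" for p q
    by (rule submodule_zero[OF m module.carrier_is_submodule[OF m]])
  have ker: "page_kernel page pdiff r p q = carrier (page r p q)"
    unfolding page_kernel_def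
    using linear_mapsD(1)[OF page_diff_linear[OF r1, of q p]] page_zero[OF r, of "p + r" "q + 1 - r"] r by auto
  have im: "page_image page pdiff r p q = {\<zero>\<^bsub>page r p q\<^esub>}"
  proof (cases "r \<le> p")
    case True
    then have e: "p - r + r = p" "q + r - 1 + 1 - r = q" "r \<le> q + r - 1 + 1" using r by auto
    have "pdiff r (p - r) (q + r - 1) x = \<zero>\<^bsub>page r p q\<^esub>" if "x \<in> carrier (page r (p - r) (q + r - 1))" for x
      using linear_mapsD(1)[OF page_diff_linear[OF r1 e(3), of "p - r"] that]
      unfolding e using page_zero[OF r, of p q] True r by auto
    then show ?thesis unfolding page_image_def using True z[of "p - r" "q + r - 1"] by auto
  qed (simp add: page_image_def)
  show "module K (page r p q) \<and>
    (r \<le> q + 1 \<longrightarrow> pdiff r p q \<in> linear_maps K (page r p q) (page r (p + r) (q + 1 - r))) \<and>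
    page_image page pdiff r p q \<subseteq> page_kernel page pdiff r p q \<and>
    module_iso K (page (Suc r) p q)
      (subquotient (page r p q) (page_kernel page pdiff r p q) (page_image page pdiff r p q))"
    unfolding ker im
  proof (intro conjI impI)
    show "module_iso K (page (Suc r) p q) (subquotient (page r p q) (carrier (page r p q)) {\<zero>\<^bsub>page r p q\<^esub>})"
    proof (rule module_iso_trans)
      show "module_iso K (page (Suc r) p q) (page r p q)" using page_stable[of "Suc r" r] r by simp
      show "module_iso K (page r p q) (subquotient (page r p q) (carrier (page r p q)) {\<zero>\<^bsub>page r p q\<^esub>})"
        using z by (intro module_iso_sym[OF _ m subquotient_whole_iso[OF m]]
            subquotient_module[OF m module.carrier_is_submodule[OF m] zero_submodule[OF m]]) auto
    qed
  qed (use m page_diff_linear[OF r1] z in auto)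
qed

text \<open>The limit filtration of \<open>H n\<close> has its only jump at \<open>p = 0\<close>.\<close>

theorem degenerate_converges: "converges_to K page (cohomology A \<delta>)"
  unfolding converges_to_def
proof (rule allI)
  fix n
  let ?H = "cohomology A \<delta> n"
  let ?F = "\<lambda>p::nat. if p = 0 then carrier ?H else {\<zero>\<^bsub>?H\<^esub>}"
  note m = A.cohomology_module[of n]
  note z = submodule_zero[OF m module.carrier_is_submodule[OF m]] and zs = zero_submodule[OF m]
  have "module_iso K (page r p (n - p)) (subquotient ?H (?F p) (?F (Suc p)))" if "p \<le> n" "r \<ge> 2" for p r
  proof (cases "p = 0")
    case True
    have r1: "r \<ge> 1" using that by simp
    have "module_iso K (page r 0 n) ?H"
      by (rule module_iso_sym[OF m page_module[OF r1] page_first_column[OF that(2)]])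
    moreover have "module_iso K ?H (subquotient ?H (carrier ?H) {\<zero>\<^bsub>?H\<^esub>})"
      using z by (intro module_iso_sym[OF _ m subquotient_whole_iso[OF m]]
            subquotient_module[OF m module.carrier_is_submodule[OF m] zs]) auto
    ultimately show ?thesis using True module_iso_trans by simp blast
  next
    case False
    have "module_iso K (page r p (n - p)) (subquotient ?H {\<zero>\<^bsub>?H\<^esub>} {\<zero>\<^bsub>?H\<^esub>})"
    proof (rule module_iso_zero)
      show "carrier (page r p (n - p)) = {\<zero>\<^bsub>page r p (n - p)\<^esub>}" using page_zero that False by simp
      show "carrier (subquotient ?H {\<zero>\<^bsub>?H\<^esub>} {\<zero>\<^bsub>?H\<^esub>}) = {\<zero>\<^bsub>subquotient ?H {\<zero>\<^bsub>?H\<^esub>} {\<zero>\<^bsub>?H\<^esub>}\<^esub>}"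
        using coset_zero[OF m zs] by simp
    qed (use that in \<open>auto intro: page_module subquotient_module[OF m zs zs]\<close>)
    then show ?thesis using False by simp
  qed
  then have lim: "\<forall>p\<le>n. \<exists>r0. \<forall>r\<ge>r0. module_iso K (page r p (n - p)) (subquotient ?H (?F p) (?F (Suc p)))"
    by blast
  have "\<forall>p. submodule (?F p) K ?H \<and> ?F (Suc p) \<subseteq> ?F p"
    using z zs module.carrier_is_submodule[OF m] by simp
  with lim show "\<exists>F. F 0 = carrier ?H \<and> F (Suc n) = {\<zero>\<^bsub>?H\<^esub>} \<and>
    (\<forall>p. submodule (F p) K ?H \<and> F (Suc p) \<subseteq> F p) \<and>
    (\<forall>p\<le>n. \<exists>r0. \<forall>r\<ge>r0. module_iso K (page r p (n - p)) (subquotient ?H (F p) (F (Suc p))))"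
    by (intro exI[of _ ?F] conjI) simp_all
qed

end

section \<open>The spectral sequence over a finite group\<close>

lemma invariants_minus:
  assumes M: "is_gmod K G M" and "x \<in> carrier (invariants G M)" "y \<in> carrier (invariants G M)"
  shows "x \<ominus>\<^bsub>invariants G M\<^esub> y = x \<ominus>\<^bsub>M\<^esub> y"
proof -
  interpret M: module K M by (rule is_gmodD(1)[OF M])
  interpret I: module K "invariants G M" by (rule invariants_module[OF M])
  have y: "y \<in> carrier M" using assms(3) by (simp add: invariants_carrier)
  have "\<ominus>\<^bsub>M\<^esub> y \<in> carrier (invariants G M)"
    by (rule M.submoduleE(3)[OF invariants_submodule[OF M] assms(3)])
  then have "\<ominus>\<^bsub>invariants G M\<^esub> y = \<ominus>\<^bsub>M\<^esub> y"
    using I.minus_equality[of "\<ominus>\<^bsub>M\<^esub> y" y] assms(3) y by (simp add: M.l_neg)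
  then show ?thesis by (simp add: I.minus_eq M.minus_eq)
qed

lemma gmod_category:
  fixes K :: "('k, 'm) ring_scheme" and G :: "('g, 'n) monoid_scheme"
  assumes "group G"
  shows "operator_category K (carrier G) (is_gmod K G)"
proof
  interpret group G by fact
  fix M :: "('k, 'v, 'g) opmod" and N
  assume M: "is_gmod K G M"
  show "operator_module K (carrier G) M" by (rule is_gmodD(2)[OF M])
  assume N: "submodule N K M" and cl: "\<And>s x. s \<in> carrier G \<Longrightarrow> x \<in> N \<Longrightarrow> act M s x \<in> N"
  note c = submodule_carrierD[OF N]
  show "is_gmod K G (M\<lparr>carrier := N\<rparr>)"
    unfolding is_gmod_def
  proof (intro conjI ballI)
    show "module K (M\<lparr>carrier := N\<rparr>)" by (rule submodule.submodule_is_module[OF N is_gmodD(1)[OF M]])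
    show "act (M\<lparr>carrier := N\<rparr>) g \<in> linear_maps K (M\<lparr>carrier := N\<rparr>) (M\<lparr>carrier := N\<rparr>)" if "g \<in> carrier G" for g
      using is_gmodD(3)[OF M that] cl that c by (auto simp: linear_maps_def)
  qed (use is_gmodD[OF M] c in auto)
qed

text \<open>An invariant cocycle of positive degree in a resolution is a coboundary, and then the coboundary
  of an invariant cochain.\<close>

lemma (in averaging) group_cohomology_vanishes:
  assumes N: "gmod_injective_resolution K G M \<iota> N dN" and p: "p > 0"
  shows "module K (group_cohomology G N dN p)"
    and "carrier (group_cohomology G N dN p) = {\<zero>\<^bsub>group_cohomology G N dN p\<^esub>}"
proof -
  interpret C: operator_category K "carrier G" "is_gmod K G" by (rule gmod_category[OF group])
  note ND = C.resolutionD[OF N]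
  interpret N: averaging_complex K G N dN
    by (intro averaging_complex.intro averaging_axioms gmod_complex.intro operator_complex.intro gmod_complex_axioms.intro)
      (simp_all add: ND)
  interpret I: cochain_complex K "\<lambda>n. invariants G (N n)" dN by (rule N.invariants_complex)
  show "module K (group_cohomology G N dN p)" unfolding group_cohomology_def by (rule I.cohomology_module)
  obtain p' where p': "p = Suc p'" using p by (cases p) auto
  have "x \<in> coboundaries (\<lambda>n. invariants G (N n)) dN p" if "x \<in> cocycles (\<lambda>n. invariants G (N n)) dN p" for x
    using that N.invariant_coboundary[OF I.cocycles_carrier[OF that]] ND(9)[of p'] N.invariant_cocycles
    unfolding p' by blast
  then show "carrier (group_cohomology G N dN p) = {\<zero>\<^bsub>group_cohomology G N dN p\<^esub>}"
    unfolding group_cohomology_def I.cohomology_simps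
    using I.coboundaries_subset submodule_zero[OF I.mod I.cocycles_submodule]
      coset_zero[OF I.mod I.coboundaries_submodule] by blast
qed

context averaging_complex
begin

text \<open>Degree zero of the cohomology of \<open>G\<close> with coefficients in \<open>M\<close> is the space of invariants of \<open>M\<close>.
  A cocycle of invariants is sent to the image in \<open>N 0\<close> of its class; the map is onto because every
  invariant class contains an invariant cocycle.\<close>

lemma invariants_cohomology_iso:
  assumes iso: "opmod_iso K (carrier G) (op_cohomology A \<delta> q) M"
    and N: "gmod_injective_resolution K G M \<iota> N dN"
  shows "module K (group_cohomology G N dN 0)"
    and "module_iso K (cohomology (\<lambda>n. invariants G (A n)) \<delta> q) (group_cohomology G N dN 0)"
proof -
  interpret C: operator_category K "carrier G" "is_gmod K G" by (rule gmod_category[OF group])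
  note ND = C.resolutionD[OF N]
  interpret N: averaging_complex K G N dN
    by (intro averaging_complex.intro averaging_axioms gmod_complex.intro operator_complex.intro gmod_complex_axioms.intro)
      (simp_all add: ND)
  interpret IN: cochain_complex K "\<lambda>n. invariants G (N n)" dN by (rule N.invariants_complex)
  interpret IA: cochain_complex K "\<lambda>n. invariants G (A n)" \<delta> by (rule invariants_complex)
  show mod0: "module K (group_cohomology G N dN 0)" unfolding group_cohomology_def by (rule IN.cohomology_module)
  obtain \<psi> where \<psi>: "\<psi> \<in> op_hom K (carrier G) (op_cohomology A \<delta> q) M"
    "bij_betw \<psi> (carrier (op_cohomology A \<delta> q)) (carrier M)"
    using iso unfolding opmod_iso_def by blast
  let ?cl = "\<lambda>a. coboundaries A \<delta> q +>\<^bsub>A q\<^esub> a"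
  define f where "f X = \<iota> (\<psi> X)" for X
  have f: "f \<in> op_hom K (carrier G) (op_cohomology A \<delta> q) (N 0)"
    using op_hom_comp[OF \<psi>(1) ND(5)] by (simp add: f_def[abs_def])
  have finj: "inj_on f (carrier (op_cohomology A \<delta> q))"
    using comp_inj_on[of \<psi> _ \<iota>] \<psi>(2) ND(6) by (simp add: f_def[abs_def] bij_betw_def comp_def)
  have fim: "f ` carrier (op_cohomology A \<delta> q) = cocycles N dN 0"
    unfolding ND(8) using \<psi>(2) by (auto simp: f_def bij_betw_def image_image[symmetric])
  note fl = linear_mapsD[OF op_homD(1)[OF f]]
  have cl: "?cl a \<in> carrier (op_cohomology A \<delta> q)" if "a \<in> cocycles A \<delta> q" for a
    using that by (simp add: op_cohomology_simps)
  have IAc: "a \<in> cocycles A \<delta> q" "a \<in> carrier (A q)" if "a \<in> cocycles (\<lambda>n. invariants G (A n)) \<delta> q" for a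
    using that invariant_cocycles cocycles_carrier by blast+
  have act: "f (?cl (act (A q) g a)) = act (N 0) g (f (?cl a))" if "g \<in> carrier G" "a \<in> cocycles A \<delta> q" for g a
    using op_homD(3)[OF f that(1) cl[OF that(2)]] act_class[OF that(1) cocycles_carrier[OF that(2)]] by simp
  have fc: "f (?cl a) \<in> cocycles (\<lambda>n. invariants G (N n)) dN 0"
    if a: "a \<in> cocycles (\<lambda>n. invariants G (A n)) \<delta> q" for a
    unfolding N.invariant_cocycles
    using act[OF _ IAc(1)[OF a]] cl[OF IAc(1)[OF a]] fim a invariant_cocycles by fastforce
  have zero: "f (?cl a) = \<zero>\<^bsub>N 0\<^esub> \<longleftrightarrow> a \<in> coboundaries A \<delta> q" if a: "a \<in> cocycles A \<delta> q" for a
  proof -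
    have m: "module K (op_cohomology A \<delta> q)"
      unfolding op_cohomology_def by (rule module_with_act[OF cohomology_module])
    have "f (\<zero>\<^bsub>op_cohomology A \<delta> q\<^esub>) = \<zero>\<^bsub>N 0\<^esub>" by (rule linear_zero[OF m ND(4) op_homD(1)[OF f]])
    moreover have "\<zero>\<^bsub>op_cohomology A \<delta> q\<^esub> \<in> carrier (op_cohomology A \<delta> q)"
      by (rule submodule_zero[OF m module.carrier_is_submodule[OF m]])
    ultimately have "f (?cl a) = \<zero>\<^bsub>N 0\<^esub> \<longleftrightarrow> ?cl a = \<zero>\<^bsub>op_cohomology A \<delta> q\<^esub>"
      using cl[OF a] finj by (metis inj_onD)
    then show ?thesis using class_eq_zero_iff[OF cocycles_carrier[OF a]] by (simp add: op_cohomology_simps)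
  qed
  let ?G = "group_cohomology G N dN 0" and ?q = "\<lambda>x. {\<zero>\<^bsub>N 0\<^esub>} +>\<^bsub>invariants G (N 0)\<^esub> x"
  note m0 = IN.mod[of 0] and z0 = zero_submodule[OF IN.mod, of 0]
  have G: "?G = subquotient (invariants G (N 0)) (cocycles (\<lambda>n. invariants G (N n)) dN 0) {\<zero>\<^bsub>N 0\<^esub>}"
    by (simp add: group_cohomology_def cohomology_def coboundaries_def)
  have z0': "submodule {\<zero>\<^bsub>N 0\<^esub>} K (invariants G (N 0))" using z0 by simp
  have "module_iso K (subquotient (invariants G (A q)) (cocycles (\<lambda>n. invariants G (A n)) \<delta> q)
      (coboundaries (\<lambda>n. invariants G (A n)) \<delta> q)) ?G"
  proof (rule subquotient_iso[OF IA.mod mod0 IA.cocycles_submodule])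
    show "(\<lambda>a. ?q (f (?cl a))) \<in> linear_maps K ((invariants G (A q))\<lparr>carrier := cocycles (\<lambda>n. invariants G (A n)) \<delta> q\<rparr>) ?G"
    proof (rule linear_mapsI)
      fix a b assume "a \<in> carrier ((invariants G (A q))\<lparr>carrier := cocycles (\<lambda>n. invariants G (A n)) \<delta> q\<rparr>)"
      then have a: "a \<in> cocycles (\<lambda>n. invariants G (A n)) \<delta> q" by simp
      note a' = IN.cocycles_carrier[OF fc[OF a]]
      show "?q (f (?cl a)) \<in> carrier ?G" unfolding G using fc[OF a] by simp
      { assume "b \<in> carrier ((invariants G (A q))\<lparr>carrier := cocycles (\<lambda>n. invariants G (A n)) \<delta> q\<rparr>)"
        then have b: "b \<in> cocycles (\<lambda>n. invariants G (A n)) \<delta> q" by simp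
        note b' = IN.cocycles_carrier[OF fc[OF b]]
        have "?cl (a \<oplus>\<^bsub>A q\<^esub> b) = ?cl a \<oplus>\<^bsub>op_cohomology A \<delta> q\<^esub> ?cl b"
          using class_add[OF IAc(2)[OF a] IAc(2)[OF b]] by (simp add: op_cohomology_simps)
        then show "?q (f (?cl (a \<oplus>\<^bsub>(invariants G (A q))\<lparr>carrier := cocycles (\<lambda>n. invariants G (A n)) \<delta> q\<rparr>\<^esub> b)))
          = ?q (f (?cl a)) \<oplus>\<^bsub>?G\<^esub> ?q (f (?cl b))"
          unfolding G using fl(2)[OF cl[OF IAc(1)[OF a]] cl[OF IAc(1)[OF b]]] coset_add[OF m0 z0' a' b'] by simp }
      fix k assume k: "k \<in> carrier K"
      have "?cl (k \<odot>\<^bsub>A q\<^esub> a) = k \<odot>\<^bsub>op_cohomology A \<delta> q\<^esub> ?cl a"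
        using class_smult[OF IAc(2)[OF a] k] by (simp add: op_cohomology_simps)
      then show "?q (f (?cl (k \<odot>\<^bsub>(invariants G (A q))\<lparr>carrier := cocycles (\<lambda>n. invariants G (A n)) \<delta> q\<rparr>\<^esub> a)))
        = k \<odot>\<^bsub>?G\<^esub> ?q (f (?cl a))"
        unfolding G using fl(3)[OF k cl[OF IAc(1)[OF a]]] coset_smult[OF m0 z0' a' k] by simp
    qed
    show "(\<lambda>a. ?q (f (?cl a))) ` cocycles (\<lambda>n. invariants G (A n)) \<delta> q = carrier ?G"
    proof (intro equalityI subsetI)
      fix Y assume "Y \<in> carrier ?G"
      then obtain x where x: "x \<in> cocycles (\<lambda>n. invariants G (N n)) dN 0" "Y = ?q x" unfolding G by auto
      then have "x \<in> f ` carrier (op_cohomology A \<delta> q)" unfolding fim using N.invariant_cocycles by blast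
      then obtain a where a: "a \<in> cocycles A \<delta> q" "x = f (?cl a)" unfolding op_cohomology_simps by blast
      have inv: "act (op_cohomology A \<delta> q) g (?cl a) = ?cl a" if g: "g \<in> carrier G" for g
      proof (rule inj_onD[OF finj])
        show "f (act (op_cohomology A \<delta> q) g (?cl a)) = f (?cl a)"
          using op_homD(3)[OF f g cl[OF a(1)]] x(1) a(2) g N.invariant_cocycles by simp
        show "act (op_cohomology A \<delta> q) g (?cl a) \<in> carrier (op_cohomology A \<delta> q)"
          using act_class[OF g cocycles_carrier[OF a(1)]] cl[OF act_cocycles[OF g a(1)]] by simp
      qed (rule cl[OF a(1)])
      have "Y = ?q (f (?cl (avg (A q) a)))" using avg_class(2)[OF a(1)] inv x(2) a(2) by simp
      then show "Y \<in> (\<lambda>a. ?q (f (?cl a))) ` cocycles (\<lambda>n. invariants G (A n)) \<delta> q"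
        using avg_class(1)[OF a(1)] inv by blast
    qed (use fc in \<open>auto simp: G\<close>)
    have "?q (f (?cl a)) = \<zero>\<^bsub>?G\<^esub> \<longleftrightarrow> a \<in> coboundaries (\<lambda>n. invariants G (A n)) \<delta> q"
      if a: "a \<in> cocycles (\<lambda>n. invariants G (A n)) \<delta> q" for a
    proof -
      have "?q (f (?cl a)) = \<zero>\<^bsub>?G\<^esub> \<longleftrightarrow> f (?cl a) = \<zero>\<^bsub>N 0\<^esub>"
        unfolding G using coset_eq_zero_iff[OF m0 z0' IN.cocycles_carrier[OF fc[OF a]]] by simp
      then show ?thesis using zero[OF IAc(1)[OF a]] invariant_coboundary[OF IA.cocycles_carrier[OF a]] by simp
    qed
    then show "coboundaries (\<lambda>n. invariants G (A n)) \<delta> q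
      = {a \<in> cocycles (\<lambda>n. invariants G (A n)) \<delta> q. ?q (f (?cl a)) = \<zero>\<^bsub>?G\<^esub>}"
      using IA.coboundaries_subset by blast
  qed
  then show "module_iso K (cohomology (\<lambda>n. invariants G (A n)) \<delta> q) ?G" by (simp add: cohomology_def)
qed

text \<open>By the definition of a Cartan--Eilenberg resolution its row cohomology resolves the cohomology of
  \<open>A\<close>.  Exactness gives preimages up to row coboundaries, and averaging makes them invariant.\<close>

lemma cartan_eilenberg_degenerate:
  assumes CE: "cartan_eilenberg K G A \<delta> \<eta> C dh dv"
  shows "degenerate_double_complex K (\<lambda>i j. invariants G (C i j)) dh dv (\<lambda>i. invariants G (A i)) \<delta> \<eta>"
proof -
  interpret Cat: operator_category K "carrier G" "is_gmod K G" by (rule gmod_category[OF group])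
  note CE' = CE[unfolded cartan_eilenberg_def]
  have dh: "dh i j \<in> op_hom K (carrier G) (C i j) (C (Suc i) j)"
    and dhdh: "x \<in> carrier (C i j) \<Longrightarrow> dh (Suc i) j (dh i j x) = \<zero>\<^bsub>C (Suc (Suc i)) j\<^esub>"
    and comm: "x \<in> carrier (C i j) \<Longrightarrow> dh i (Suc j) (dv i j x) = dv (Suc i) j (dh i j x)"
    and dh\<eta>: "a \<in> carrier (A i) \<Longrightarrow> dh i 0 (\<eta> i a) = \<eta> (Suc i) (\<delta> i a)"
    and res: "gmod_injective_resolution K G (A i) (\<eta> i) (C i) (dv i)"
    and Hres: "gmod_injective_resolution K G (op_cohomology A \<delta> i)
        (cohomology_map (\<lambda>i. C i 0) (\<lambda>i. dh i 0) i (\<eta> i))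
        (\<lambda>j. op_cohomology (\<lambda>i. C i j) (\<lambda>i. dh i j) i)
        (\<lambda>j. cohomology_map (\<lambda>i. C i (Suc j)) (\<lambda>i. dh i (Suc j)) i (dv i j))" for i j x a
    using CE' by blast+
  note R = Cat.resolutionD[OF res]
  have row: "averaging_complex K G (\<lambda>i. C i j) (\<lambda>i. dh i j)" for j
    by (intro averaging_complex.intro averaging_axioms gmod_complex.intro operator_complex.intro gmod_complex_axioms.intro)
      (simp_all add: R dh dhdh)
  have chain_dv: "cochain_map K (\<lambda>i. C i j) (\<lambda>i. dh i j) (\<lambda>i. C i (Suc j)) (\<lambda>i. dh i (Suc j)) (\<lambda>i. dv i j)" for j
  proof -
    interpret R1: averaging_complex K G "\<lambda>i. C i j" "\<lambda>i. dh i j" by (rule row)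
    interpret R2: averaging_complex K G "\<lambda>i. C i (Suc j)" "\<lambda>i. dh i (Suc j)" by (rule row)
    show ?thesis
      by (intro cochain_map.intro R1.cochain_complex_axioms R2.cochain_complex_axioms cochain_map_axioms.intro)
        (simp_all add: op_homD(1)[OF R(7)] comm)
  qed
  have chain_\<eta>: "cochain_map K A \<delta> (\<lambda>i. C i 0) (\<lambda>i. dh i 0) \<eta>"
  proof -
    interpret R2: averaging_complex K G "\<lambda>i. C i 0" "\<lambda>i. dh i 0" by (rule row)
    show ?thesis
      by (intro cochain_map.intro cochain_complex_axioms R2.cochain_complex_axioms cochain_map_axioms.intro)
        (simp_all add: op_homD(1)[OF R(5)] dh\<eta>)
  qed
  let ?X = "\<lambda>i j. invariants G (C i j)"
  let ?B = "\<lambda>j i. coboundaries (\<lambda>i. C i j) (\<lambda>i. dh i j) i"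
  let ?Z = "\<lambda>j i. cocycles (\<lambda>i. C i j) (\<lambda>i. dh i j) i"
  let ?H = "\<lambda>i j. op_cohomology (\<lambda>i. C i j) (\<lambda>i. dh i j) i"
  let ?dH = "\<lambda>i j. cohomology_map (\<lambda>i. C i (Suc j)) (\<lambda>i. dh i (Suc j)) i (dv i j)"
  \<comment> \<open>such an \<open>x\<close> defines a cocycle of the complex of row cohomologies\<close>
  have class_cocycle: "?B j i +>\<^bsub>C i j\<^esub> x \<in> cocycles (?H i) (?dH i) j"
    if x: "x \<in> carrier (?X i j)" "dh i j x = \<zero>\<^bsub>C (Suc i) j\<^esub>"
      "dv i j x \<in> coboundaries (\<lambda>i. ?X i (Suc j)) (\<lambda>i. dh i (Suc j)) i" for i j x
  proof -
    interpret R1: averaging_complex K G "\<lambda>i. C i j" "\<lambda>i. dh i j" by (rule row)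
    interpret R2: averaging_complex K G "\<lambda>i. C i (Suc j)" "\<lambda>i. dh i (Suc j)" by (rule row)
    interpret c: cochain_map K "\<lambda>i. C i j" "\<lambda>i. dh i j" "\<lambda>i. C i (Suc j)" "\<lambda>i. dh i (Suc j)" "\<lambda>i. dv i j"
      by (rule chain_dv)
    have xc: "x \<in> carrier (C i j)" using x(1) by (simp add: invariants_carrier)
    have "dv i j x \<in> carrier (?X i (Suc j))" by (rule linear_mapsD(1)[OF invariants_hom[OF R(7)] x(1)])
    then have "dv i j x \<in> ?B (Suc j) i" using x(3) R2.invariant_coboundary by simp
    then have "?dH i j (?B j i +>\<^bsub>C i j\<^esub> x) = \<zero>\<^bsub>?H i (Suc j)\<^esub>"
      using c.map_class[OF xc] R2.class_eq_zero_iff[OF R2.coboundaries_carrier]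
      by (simp add: R2.op_cohomology_simps)
    then show ?thesis using xc x(2) by (simp add: cocycles_def[of "?H i"] R1.op_cohomology_simps)
        (simp add: cocycles_def)
  qed
  show ?thesis
  proof (intro degenerate_double_complex.intro double_complex.intro degenerate_double_complex_axioms.intro)
    show "cochain_complex K (\<lambda>i. invariants G (A i)) \<delta>" by (rule invariants_complex)
    show "module K (?X i j)" for i j by (rule invariants_module[OF R(2)])
    show "dh i j \<in> linear_maps K (?X i j) (?X (Suc i) j)" for i j by (rule invariants_hom[OF dh])
    show "dv i j \<in> linear_maps K (?X i j) (?X i (Suc j))" for i j by (rule invariants_hom[OF R(7)])
    show "\<eta> i \<in> linear_maps K (invariants G (A i)) (?X i 0)" for i by (rule invariants_hom[OF R(5)])
    show "dv i (Suc j) (dv i j x) = \<zero>\<^bsub>?X i (Suc (Suc j))\<^esub>" if "x \<in> carrier (?X i j)" for x i j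
      using that R(11) by (simp add: invariants_carrier)
    show "dh (Suc i) j (dh i j x) = \<zero>\<^bsub>?X (Suc (Suc i)) j\<^esub>" if "x \<in> carrier (?X i j)" for x i j
      using that dhdh by (simp add: invariants_carrier)
    show "dh i (Suc j) (dv i j x) = dv (Suc i) j (dh i j x)" if "x \<in> carrier (?X i j)" for x i j
      using that comm by (simp add: invariants_carrier)
    show "dh i 0 (\<eta> i a) = \<eta> (Suc i) (\<delta> i a)" if "a \<in> carrier (invariants G (A i))" for a i
      using that dh\<eta> by (simp add: invariants_carrier)
    show "dv i 0 (\<eta> i a) = \<zero>\<^bsub>?X i (Suc 0)\<^esub>" if "a \<in> carrier (invariants G (A i))" for a i
      using that R(10) by (simp add: invariants_carrier)
  next
    fix x i j
    assume x: "x \<in> carrier (?X i (Suc j))" "dh i (Suc j) x = \<zero>\<^bsub>?X (Suc i) (Suc j)\<^esub>"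
      "dv i (Suc j) x \<in> coboundaries (\<lambda>i. ?X i (Suc (Suc j))) (\<lambda>i. dh i (Suc (Suc j))) i"
    interpret R1: averaging_complex K G "\<lambda>i. C i j" "\<lambda>i. dh i j" by (rule row)
    interpret R2: averaging_complex K G "\<lambda>i. C i (Suc j)" "\<lambda>i. dh i (Suc j)" by (rule row)
    interpret c: cochain_map K "\<lambda>i. C i j" "\<lambda>i. dh i j" "\<lambda>i. C i (Suc j)" "\<lambda>i. dh i (Suc j)" "\<lambda>i. dv i j"
      by (rule chain_dv)
    have xc: "x \<in> carrier (C i (Suc j))" and xi: "\<And>g. g \<in> carrier G \<Longrightarrow> act (C i (Suc j)) g x = x"
      using x(1) by (auto simp: invariants_carrier)
    have "?B (Suc j) i +>\<^bsub>C i (Suc j)\<^esub> x \<in> coboundaries (?H i) (?dH i) (Suc j)"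
      using class_cocycle[OF x(1) _ x(3)] x(2) Cat.resolutionD(9)[OF Hres] by simp
    then obtain y where y: "y \<in> ?Z j i" "?B (Suc j) i +>\<^bsub>C i (Suc j)\<^esub> x = ?dH i j (?B j i +>\<^bsub>C i j\<^esub> y)"
      by (auto simp: coboundaries_def[of "?H i"] R1.op_cohomology_simps)
    note yc = R1.cocycles_carrier[OF y(1)]
    have dyc: "dv i j y \<in> carrier (C i (Suc j))" using op_homD(2)[OF R(7) yc] .
    have "x \<ominus>\<^bsub>C i (Suc j)\<^esub> dv i j y \<in> ?B (Suc j) i"
      using y(2) c.map_class[OF yc] R2.class_eq_iff[OF xc dyc] by simp
    from R2.avg_coboundaries[OF this]
    have "avg (C i (Suc j)) (x \<ominus>\<^bsub>C i (Suc j)\<^esub> dv i j y) \<in> coboundaries (\<lambda>i. ?X i (Suc j)) (\<lambda>i. dh i (Suc j)) i" .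
    moreover have "avg (C i (Suc j)) (x \<ominus>\<^bsub>C i (Suc j)\<^esub> dv i j y)
      = x \<ominus>\<^bsub>C i (Suc j)\<^esub> dv i j (avg (C i j) y)"
      using linear_minus[OF R2.mod R2.mod avg_linear[OF R(2)] xc dyc] avg_invariant[OF R(2) xc xi]
        avg_hom[OF R(2) R(2) R(7) yc] by simp
    moreover have "avg (C i j) y \<in> carrier (?X i j)" by (rule avg_mem_invariants[OF R(2) yc])
    moreover have "dh i j (avg (C i j) y) = \<zero>\<^bsub>?X (Suc i) j\<^esub>"
      using avg_hom[OF R(2) R(2) dh yc] y(1) linear_zero[OF R1.mod R1.mod avg_linear[OF R(2)], of "Suc i"]
      by (simp add: cocycles_def)
    ultimately show "\<exists>y \<in> carrier (?X i j). dh i j y = \<zero>\<^bsub>?X (Suc i) j\<^esub> \<and>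
         x \<ominus>\<^bsub>?X i (Suc j)\<^esub> dv i j y \<in> coboundaries (\<lambda>i. ?X i (Suc j)) (\<lambda>i. dh i (Suc j)) i"
      using x(1) invariants_minus[OF R(2) x(1)] linear_mapsD(1)[OF invariants_hom[OF R(7)], of "avg (C i j) y" i j]
      by (intro bexI[of _ "avg (C i j) y"]) auto
  next
    fix x i
    assume x: "x \<in> carrier (?X i 0)" "dh i 0 x = \<zero>\<^bsub>?X (Suc i) 0\<^esub>"
      "dv i 0 x \<in> coboundaries (\<lambda>i. ?X i (Suc 0)) (\<lambda>i. dh i (Suc 0)) i"
    interpret R1: averaging_complex K G "\<lambda>i. C i 0" "\<lambda>i. dh i 0" by (rule row)
    interpret c: cochain_map K A \<delta> "\<lambda>i. C i 0" "\<lambda>i. dh i 0" \<eta> by (rule chain_\<eta>)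
    have xc: "x \<in> carrier (C i 0)" and xi: "\<And>g. g \<in> carrier G \<Longrightarrow> act (C i 0) g x = x"
      using x(1) by (auto simp: invariants_carrier)
    have "?B 0 i +>\<^bsub>C i 0\<^esub> x \<in> cohomology_map (\<lambda>i. C i 0) (\<lambda>i. dh i 0) i (\<eta> i) ` carrier (op_cohomology A \<delta> i)"
      using class_cocycle[OF x(1) _ x(3)] x(2) Cat.resolutionD(8)[OF Hres] by simp
    then obtain a where a: "a \<in> cocycles A \<delta> i" "?B 0 i +>\<^bsub>C i 0\<^esub> x
      = cohomology_map (\<lambda>i. C i 0) (\<lambda>i. dh i 0) i (\<eta> i) (coboundaries A \<delta> i +>\<^bsub>A i\<^esub> a)"
      by (auto simp: op_cohomology_simps)
    note ac = cocycles_carrier[OF a(1)]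
    have \<eta>c: "\<eta> i a \<in> carrier (C i 0)" using op_homD(2)[OF R(5) ac] .
    have "x \<ominus>\<^bsub>C i 0\<^esub> \<eta> i a \<in> ?B 0 i"
      using a(2) c.map_class[OF ac] R1.class_eq_iff[OF xc \<eta>c] by simp
    from R1.avg_coboundaries[OF this]
    have "avg (C i 0) (x \<ominus>\<^bsub>C i 0\<^esub> \<eta> i a) \<in> coboundaries (\<lambda>i. ?X i 0) (\<lambda>i. dh i 0) i" .
    moreover have "avg (C i 0) (x \<ominus>\<^bsub>C i 0\<^esub> \<eta> i a) = x \<ominus>\<^bsub>C i 0\<^esub> \<eta> i (avg (A i) a)"
      using linear_minus[OF R1.mod R1.mod avg_linear[OF R(2)] xc \<eta>c] avg_invariant[OF R(2) xc xi]
        avg_hom[OF gmod R(2) R(5) ac] by simp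
    moreover have "avg (A i) a \<in> cocycles (\<lambda>i. invariants G (A i)) \<delta> i"
      using avg_mem_invariants[OF gmod ac] avg_hom[OF gmod gmod diff_hom ac] a(1)
        linear_zero[OF mod mod avg_linear[OF gmod], of "Suc i"] by (simp add: cocycles_def)
    ultimately show "\<exists>a \<in> cocycles (\<lambda>i. invariants G (A i)) \<delta> i.
        x \<ominus>\<^bsub>?X i 0\<^esub> \<eta> i a \<in> coboundaries (\<lambda>i. ?X i 0) (\<lambda>i. dh i 0) i"
      using invariants_minus[OF R(2) x(1)] linear_mapsD(1)[OF invariants_hom[OF R(5)], of "avg (A i) a" i]
      by (intro bexI[of _ "avg (A i) a"]) (auto simp: cocycles_def)
  next
    fix a i
    assume a: "a \<in> cocycles (\<lambda>i. invariants G (A i)) \<delta> i"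
      and b: "\<eta> i a \<in> coboundaries (\<lambda>i. ?X i 0) (\<lambda>i. dh i 0) i"
    interpret R1: averaging_complex K G "\<lambda>i. C i 0" "\<lambda>i. dh i 0" by (rule row)
    interpret c: cochain_map K A \<delta> "\<lambda>i. C i 0" "\<lambda>i. dh i 0" \<eta> by (rule chain_\<eta>)
    have az: "a \<in> cocycles A \<delta> i" and ai: "a \<in> carrier (invariants G (A i))"
      using a invariant_cocycles by (auto simp: cocycles_def)
    note ac = cocycles_carrier[OF az]
    have "\<eta> i a \<in> carrier (?X i 0)" by (rule linear_mapsD(1)[OF invariants_hom[OF R(5)] ai])
    then have "\<eta> i a \<in> ?B 0 i" using b R1.invariant_coboundary by simp
    let ?c = "\<lambda>a. coboundaries A \<delta> i +>\<^bsub>A i\<^esub> a"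
    have z: "\<zero>\<^bsub>A i\<^esub> \<in> cocycles A \<delta> i" by (rule submodule_zero[OF mod cocycles_submodule])
    have "cohomology_map (\<lambda>i. C i 0) (\<lambda>i. dh i 0) i (\<eta> i) (?c a)
      = cohomology_map (\<lambda>i. C i 0) (\<lambda>i. dh i 0) i (\<eta> i) (?c \<zero>\<^bsub>A i\<^esub>)"
      using c.map_class[OF ac] c.map_class[OF cocycles_carrier[OF z]] \<open>\<eta> i a \<in> ?B 0 i\<close>
        R1.class_eq_zero_iff[OF R1.coboundaries_carrier[OF \<open>\<eta> i a \<in> ?B 0 i\<close>]]
        R1.class_eq_zero_iff[of "\<zero>\<^bsub>C i 0\<^esub>" i] submodule_zero[OF R1.mod R1.coboundaries_submodule]
        R1.coboundaries_carrier linear_zero[OF mod R1.mod op_homD(1)[OF R(5)]] by simp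
    then have "?c a = ?c \<zero>\<^bsub>A i\<^esub>"
      by (rule inj_onD[OF Cat.resolutionD(6)[OF Hres]]) (use az z in \<open>auto simp: op_cohomology_simps\<close>)
    also have "\<dots> = coboundaries A \<delta> i"
      by (rule coset_zero[OF mod coboundaries_submodule submodule_zero[OF mod coboundaries_submodule]])
    finally show "a \<in> coboundaries (\<lambda>i. invariants G (A i)) \<delta> i"
      using class_eq_zero_iff[OF ac] invariant_coboundary[OF ai] by simp
  qed
qed

end

lemma (in digroup_setting) Ext_rep_invariants:
  assumes Q: "is_rep K G E \<phi> Q" and I: "\<And>n. is_rep K G E \<phi> (I n)"
  shows "cohomology (\<lambda>n. invariants G (F_obj K G E Q (I n))) (\<lambda>n. post Q (d n)) = Ext_rep K G E Q I d"
proof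
  fix q
  show "cohomology (\<lambda>n. invariants G (F_obj K G E Q (I n))) (\<lambda>n. post Q (d n)) q = Ext_rep K G E Q I d q"
    unfolding Ext_rep_def
    by (rule cohomology_cong(1))
      (simp_all only: F_invariants[OF Q I] invariants_simps F_obj_simps hom_space_simps halo_restrict_simps)
qed

theorem proposition59:
  fixes K :: "('k, 'm) ring_scheme" and G :: "('g, 'n) monoid_scheme"
    and E :: "'e set" and \<phi> :: "'g \<Rightarrow> 'e \<Rightarrow> 'e"
    and Q W :: "('k, 'g, 'e, 'u) dig_rep"
    and \<eta> \<eta>' \<theta> :: "'u \<Rightarrow> 'u"
    and I I' :: "nat \<Rightarrow> ('k, 'g, 'e, 'u) dig_rep" and d d' :: "nat \<Rightarrow> 'u \<Rightarrow> 'u"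
    and J :: "nat \<Rightarrow> ('k, 'u, ('e list \<Rightarrow> 'k) set) opmod" and \<epsilon> :: "nat \<Rightarrow> 'u \<Rightarrow> 'u"
    and c :: "nat \<Rightarrow> 'u \<Rightarrow> 'u"
    and large :: "'k \<times> 'g \<times> 'e \<times> nat \<Rightarrow> 'u"
    and large' :: "'k \<times> 'g \<times> nat \<Rightarrow> 'w"
  assumes "field K" and "group_action G E \<phi>" and "E \<noteq> {}"
    and "inj_on large (carrier K \<times> carrier G \<times> E \<times> UNIV)"
    and "inj_on large' (carrier K \<times> carrier G \<times> UNIV)"
    and "is_rep K G E \<phi> Q" and "is_rep K G E \<phi> W"
    and "rep_injective_resolution K G E \<phi> W \<eta> I d"
    and "rep_injective_resolution K G E \<phi> W \<eta>' I' d'"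
    and "halo_injective_resolution K E (halo_restrict K G W) \<theta> J \<epsilon>"
    and "halo_comparison K G E W \<eta>' I' d' \<theta> J \<epsilon> c"
  shows "(\<forall>q. opmod_iso K (carrier G) (RF K G E Q I d q) (Ext_halo_G K G E Q I' d' J \<epsilon> c q)) \<and>
    (finite (carrier G) \<and> (\<forall>n::nat. n > 0 \<longrightarrow> [n] \<cdot>\<^bsub>K\<^esub> \<one>\<^bsub>K\<^esub> \<noteq> \<zero>\<^bsub>K\<^esub>) \<longrightarrow>
      (\<forall>\<eta>C (C :: nat \<Rightarrow> nat \<Rightarrow> ('k, 'w, 'g) opmod) dh dv.
        cartan_eilenberg K G (\<lambda>n. F_obj K G E Q (I n)) (\<lambda>n. post Q (d n)) \<eta>C C dh dv \<longrightarrow>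
          spectral_sequence K (grothendieck_page G C dh dv) (grothendieck_diff G C dh dv) \<and>
          (\<forall>q \<iota> (N :: nat \<Rightarrow> ('k, 'w, 'g) opmod) dN.
            gmod_injective_resolution K G (Ext_halo_G K G E Q I' d' J \<epsilon> c q) \<iota> N dN \<longrightarrow>
            (\<forall>p. module_iso K (grothendieck_page G C dh dv 2 p q)
                   (group_cohomology G N dN p))) \<and>
          converges_to K (grothendieck_page G C dh dv) (Ext_rep K G E Q I d)))"
proof (intro conjI impI allI)
  interpret K: field K by fact
  interpret D: digroup_setting K G E \<phi>
    by (rule digroup_setting.intro[OF K.is_cring assms(2,3)])
  obtain k \<alpha> where k: "k \<in> carrier K" "\<alpha> \<in> E" using assms(3) K.one_closed by blast
  have large1: "inj_on (\<lambda>g. large (k, g, \<alpha>, 0)) (carrier G)"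
    using assms(4) k by (auto simp: inj_on_def)
  have "inj (\<lambda>n. large (k, \<one>\<^bsub>G\<^esub>, \<alpha>, n))"
  proof (rule injI)
    fix m n assume "large (k, \<one>\<^bsub>G\<^esub>, \<alpha>, m) = large (k, \<one>\<^bsub>G\<^esub>, \<alpha>, n)"
    from inj_onD[OF assms(4) this] k show "m = n" by auto
  qed
  \<comment> \<open>one component of the injection \<open>large\<close> embeds \<open>G\<close>, another the natural numbers\<close>
  then have large2: "infinite (UNIV :: 'u set)" using infinite_iff_countable_subset by blast
  show iso: "opmod_iso K (carrier G) (RF K G E Q I d q) (Ext_halo_G K G E Q I' d' J \<epsilon> c q)" for q
    by (rule D.RF_iso_Ext[OF large2 large1 assms(6-11)])
  fix \<eta>C dh dv and C :: "nat \<Rightarrow> nat \<Rightarrow> ('k, 'w, 'g) opmod"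
  assume fin: "finite (carrier G) \<and> (\<forall>n::nat. n > 0 \<longrightarrow> [n] \<cdot>\<^bsub>K\<^esub> \<one>\<^bsub>K\<^esub> \<noteq> \<zero>\<^bsub>K\<^esub>)"
    and CE: "cartan_eilenberg K G (\<lambda>n. F_obj K G E Q (I n)) (\<lambda>n. post Q (d n)) \<eta>C C dh dv"
  have "card (carrier G) > 0" using fin D.G.one_closed card_gt_0_iff by blast
  then have "[card (carrier G)] \<cdot>\<^bsub>K\<^esub> \<one>\<^bsub>K\<^esub> \<noteq> \<zero>\<^bsub>K\<^esub>" using fin by blast
  then interpret Av: averaging K G
    using fin by (intro averaging.intro K.field_axioms D.G.group_axioms) simp_all
  have rI: "is_rep K G E \<phi> (I n)" for n
    using assms(8) by (simp add: injective_resolution_def injective_object_def)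
  interpret A: averaging_complex K G "\<lambda>n. F_obj K G E Q (I n)" "\<lambda>n. post Q (d n)"
    by (intro averaging_complex.intro Av.averaging_axioms gmod_complex.intro gmod_complex_axioms.intro
        D.F_complex[OF assms(6,8)] D.F_gmod[OF assms(6) rI])
  let ?X = "\<lambda>i j. invariants G (C i j)"
  interpret X: degenerate_double_complex K ?X dh dv "\<lambda>n. invariants G (F_obj K G E Q (I n))" "\<lambda>n. post Q (d n)" \<eta>C
    by (rule A.cartan_eilenberg_degenerate[OF CE])
  have page: "grothendieck_page G C dh dv = X.page" "grothendieck_diff G C dh dv = X.pdiff"
    by (simp_all add: grothendieck_page_def grothendieck_diff_def Let_def)
  show "spectral_sequence K (grothendieck_page G C dh dv) (grothendieck_diff G C dh dv)"
    unfolding page by (rule X.degenerate_spectral_sequence)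
  show "converges_to K (grothendieck_page G C dh dv) (Ext_rep K G E Q I d)"
    unfolding page D.Ext_rep_invariants[OF assms(6) rI, symmetric] by (rule X.degenerate_converges)
  fix q p \<iota> dN and N :: "nat \<Rightarrow> ('k, 'w, 'g) opmod"
  assume N: "gmod_injective_resolution K G (Ext_halo_G K G E Q I' d' J \<epsilon> c q) \<iota> N dN"
  show "module_iso K (grothendieck_page G C dh dv 2 p q) (group_cohomology G N dN p)"
    unfolding page
  proof (cases "p = 0")
    case True
    show "module_iso K (X.page 2 p q) (group_cohomology G N dN p)"
      unfolding True
      by (rule module_iso_trans[OF module_iso_sym[OF X.A.cohomology_module X.page_module X.page_first_column]
            A.invariants_cohomology_iso(2)[OF iso[of q, unfolded RF_def] N]]) simp_all
  next
    case False
    then show "module_iso K (X.page 2 p q) (group_cohomology G N dN p)"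
      by (intro module_iso_zero X.page_module X.page_zero Av.group_cohomology_vanishes[OF N]) simp_all
  qed
qed

end
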